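(* Let $\Gamma$ be a finite simplicial graph, let $\{G_v\mid v\in V(\Gamma)\}$ be a collection of non-trivial groups, and let $G_\Gamma$ be the associated graph product. Assume that for all vertices $v,w\in V(\Gamma)$ with $v\neq w$ we have $lk(v)\nsubseteq st(w)$. The following statements are equivalent: (i) The group $G_\Gamma$ is semicomplete. (ii) All vertex groups $G_v$, $v\in V(\Gamma)$, are abelian and $\Gamma$ has no separating star.
   Context: Graphs are finite, with non-empty vertex set, without loops and multiple edges. For a graph $\Gamma$ with vertex set $V(\Gamma)$ and edge set $E(\Gamma)$ (a set of 2-element subsets of $V(\Gamma)$), and non-trivial groups $G_v$ ($v\in V(\Gamma)$), the graph product $G_\Gamma$ is the quotient of the free product $\ast_{v\in V(\Gamma)} G_v$ by the normal closure of all commutators $[g,h]$ with $g\in G_v$, $h\in G_w$, $\{v,w\}\in E(\Gamma)$. The groups $G_v$ are called the vertex groups. For $v\in V(\Gamma)$, the link of $v$ is $lk(v)=\{w\in V(\Gamma)\mid \{v,w\}\in E(\Gamma)\}$ and the star of $v$ is $st(v)=\{v\}\cup lk(v)$. A graph $\Gamma$ has a separating star if there is a vertex $v\in V(\Gamma)$ such that the subgraph spanned by $V(\Gamma)-st(v)$ is disconnected, i.e. there are two vertices of $V(\Gamma)-st(v)$ not joined by a path in this induced subgraph (in particular, the empty graph is not disconnected). For a group $G$ let $G^{ab}=G/G'$ be its abelianization, where $G'$ is the commutator subgroup, and let $\Phi\colon \mathrm{Aut}(G)\to\mathrm{Aut}(G^{ab})$ be the natural homomorphism induced by the abelianization map.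 Write $\mathrm{IA}(G)=\ker(\Phi)$; always $\mathrm{Inn}(G)\subseteq \mathrm{IA}(G)$, where $\mathrm{Inn}(G)$ is the group of inner automorphisms. The group $G$ is called semicomplete if $\mathrm{IA}(G)=\mathrm{Inn}(G)$.
   Formalization: The implication (i) ⇒ (ii) is stated only for graphs with at least two vertices: for a single vertex with group S_3 the link condition is vacuous and the graph product S_3 is semicomplete but not abelian. The implication (ii) ⇒ (i) is stated without restriction. *)

theory Defs
  imports "HOL-Algebra.Algebra"
begin

section \<open>Graphs\<close>

definition simple_graph :: "'v set \<Rightarrow> 'v set set \<Rightarrow> bool" where
  "simple_graph V E \<longleftrightarrow>
     finite V \<and> V \<noteq> {} \<and> (\<forall>e\<in>E. \<exists>v\<in>V. \<exists>w\<in>V. v \<noteq> w \<and> e = {v, w})"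

definition lk :: "'v set \<Rightarrow> 'v set set \<Rightarrow> 'v \<Rightarrow> 'v set" where
  "lk V E v = {w \<in> V. {v, w} \<in> E}"

definition st :: "'v set \<Rightarrow> 'v set set \<Rightarrow> 'v \<Rightarrow> 'v set" where
  "st V E v = {v} \<union> lk V E v"

definition induced_edges :: "'v set set \<Rightarrow> 'v set \<Rightarrow> 'v set set" where
  "induced_edges E W = {e \<in> E. e \<subseteq> W}"

text \<open>Two vertices are joined by a path iff they are related by the reflexive transitive
  closure of adjacency. The empty graph is not disconnected.\<close>

definition disconnected_graph :: "'v set \<Rightarrow> 'v set set \<Rightarrow> bool" where
  "disconnected_graph V E \<longleftrightarrow>
     (\<exists>x\<in>V. \<exists>y\<in>V. (x, y) \<notin> {(a, b). {a, b} \<in> E}\<^sup>*)"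

definition has_separating_star :: "'v set \<Rightarrow> 'v set set \<Rightarrow> bool" where
  "has_separating_star V E \<longleftrightarrow>
     (\<exists>v\<in>V. disconnected_graph (V - st V E v) (induced_edges E (V - st V E v)))"


section \<open>Free products\<close>

text \<open>The elements of the free product are words in the disjoint union of the groups
  \<open>G v\<close>, i.e. lists of pairs \<open>(v, g)\<close> with \<open>g \<in> carrier (G v)\<close>, modulo the congruence
  generated by multiplying adjacent letters of the same group and deleting identity
  letters.\<close>

definition fp_words :: "'v set \<Rightarrow> ('v \<Rightarrow> ('g, 'b) monoid_scheme) \<Rightarrow> ('v \<times> 'g) list set" where
  "fp_words V G = lists (SIGMA v:V. carrier (G v))"

inductive_set fp_rel ::
  "'v set \<Rightarrow> ('v \<Rightarrow> ('g, 'b) monoid_scheme) \<Rightarrow> (('v \<times> 'g) list \<times> ('v \<times> 'g) list) set"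
  for V :: "'v set" and G :: "'v \<Rightarrow> ('g, 'b) monoid_scheme"
where
  one: "\<lbrakk>x \<in> fp_words V G; y \<in> fp_words V G; v \<in> V\<rbrakk>
        \<Longrightarrow> (x @ [(v, \<one>\<^bsub>G v\<^esub>)] @ y, x @ y) \<in> fp_rel V G"
| mult: "\<lbrakk>x \<in> fp_words V G; y \<in> fp_words V G; v \<in> V; g \<in> carrier (G v); h \<in> carrier (G v)\<rbrakk>
        \<Longrightarrow> (x @ [(v, g), (v, h)] @ y, x @ [(v, g \<otimes>\<^bsub>G v\<^esub> h)] @ y) \<in> fp_rel V G"
| refl: "x \<in> fp_words V G \<Longrightarrow> (x, x) \<in> fp_rel V G"
| sym: "(x, y) \<in> fp_rel V G \<Longrightarrow> (y, x) \<in> fp_rel V G"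
| trans: "\<lbrakk>(x, y) \<in> fp_rel V G; (y, z) \<in> fp_rel V G\<rbrakk> \<Longrightarrow> (x, z) \<in> fp_rel V G"

definition free_product ::
  "'v set \<Rightarrow> ('v \<Rightarrow> ('g, 'b) monoid_scheme) \<Rightarrow> ('v \<times> 'g) list set monoid" where
  "free_product V G =
     \<lparr>carrier = fp_words V G // fp_rel V G,
      monoid.mult = (\<lambda>A B. \<Union>x\<in>A. \<Union>y\<in>B. fp_rel V G `` {x @ y}),
      one = fp_rel V G `` {[]}\<rparr>"

definition fp_inj ::
  "'v set \<Rightarrow> ('v \<Rightarrow> ('g, 'b) monoid_scheme) \<Rightarrow> 'v \<Rightarrow> 'g \<Rightarrow> ('v \<times> 'g) list set" where
  "fp_inj V G v g = fp_rel V G `` {[(v, g)]}"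

lemma fp_words_simps [simp]:
  "[] \<in> fp_words V G"
  "(v, g) # x \<in> fp_words V G \<longleftrightarrow> v \<in> V \<and> g \<in> carrier (G v) \<and> x \<in> fp_words V G"
  "x @ y \<in> fp_words V G \<longleftrightarrow> x \<in> fp_words V G \<and> y \<in> fp_words V G"
  by (auto simp: fp_words_def)

context
  fixes V :: "'v set" and G :: "'v \<Rightarrow> ('g, 'b) monoid_scheme"
  assumes grp: "\<And>v. v \<in> V \<Longrightarrow> group (G v)"
begin

lemma fp_rel_words:
  assumes "(x, y) \<in> fp_rel V G"
  shows "x \<in> fp_words V G \<and> y \<in> fp_words V G"
  using assms
proof (induction rule: fp_rel.induct)
  case (one x y v)
  interpret group "G v" by (rule grp) fact
  show ?case using one by simp
next
  case (mult x y v g h)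
  interpret group "G v" by (rule grp) fact
  show ?case using mult by simp
qed auto

lemma equiv_fp_rel: "equiv (fp_words V G) (fp_rel V G)"
proof (rule equivI)
  show "fp_rel V G \<subseteq> fp_words V G \<times> fp_words V G"
    using fp_rel_words by auto
  show "refl_on (fp_words V G) (fp_rel V G)"
    using fp_rel_words by (auto intro!: refl_onI fp_rel.refl)
  show "sym (fp_rel V G)"
    by (auto intro!: symI fp_rel.sym)
  show "trans (fp_rel V G)"
    by (auto intro!: transI intro: fp_rel.trans)
qed

lemma fp_rel_append_context:
  assumes "(x, y) \<in> fp_rel V G" "a \<in> fp_words V G" "b \<in> fp_words V G"
  shows "(a @ x @ b, a @ y @ b) \<in> fp_rel V G"
  using assms(1)
proof (induction rule: fp_rel.induct)
  case (one x y v)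
  then show ?case
    using fp_rel.one[of "a @ x" V G "y @ b" v] assms by simp
next
  case (mult x y v g h)
  then show ?case
    using fp_rel.mult[of "a @ x" V G "y @ b" v g h] assms by simp
next
  case (refl x)
  then show ?case using assms by (auto intro!: fp_rel.refl)
next
  case (sym x y)
  then show ?case by (auto intro: fp_rel.sym)
next
  case (trans x y z)
  then show ?case by (blast intro: fp_rel.trans)
qed

lemma fp_rel_append:
  assumes "(x, x') \<in> fp_rel V G" "(y, y') \<in> fp_rel V G"
  shows "(x @ y, x' @ y') \<in> fp_rel V G"
proof -
  have "(x @ y, x' @ y) \<in> fp_rel V G"
    using fp_rel_append_context[OF assms(1), of "[]" y] fp_rel_words[OF assms(2)] by simp
  moreover have "(x' @ y, x' @ y') \<in> fp_rel V G"
    using fp_rel_append_context[OF assms(2), of x' "[]"] fp_rel_words[OF assms(1)] by simp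
  ultimately show ?thesis by (rule fp_rel.trans)
qed

lemma free_product_mult:
  assumes "x \<in> fp_words V G" "y \<in> fp_words V G"
  shows "fp_rel V G `` {x} \<otimes>\<^bsub>free_product V G\<^esub> fp_rel V G `` {y} = fp_rel V G `` {x @ y}"
proof -
  have "congruent2 (fp_rel V G) (fp_rel V G) (\<lambda>x y. fp_rel V G `` {x @ y})"
    by (auto intro!: congruent2I' equiv_class_eq[OF equiv_fp_rel] fp_rel_append)
  then show ?thesis
    using UN_equiv_class2[OF equiv_fp_rel equiv_fp_rel _ assms]
    by (simp add: free_product_def)
qed

lemma fp_inverse_word:
  assumes "x \<in> fp_words V G"
  shows "\<exists>y\<in>fp_words V G. (y @ x, []) \<in> fp_rel V G"
  using assms
proof (induction x)
  case Nil
  then show ?case by (auto intro!: bexI[of _ "[]"] fp_rel.refl)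
next
  case (Cons p x)
  obtain v g where p: "p = (v, g)" by force
  with Cons have v: "v \<in> V" "g \<in> carrier (G v)" "x \<in> fp_words V G" by auto
  interpret group "G v" by (rule grp) fact
  obtain y where y: "y \<in> fp_words V G" "(y @ x, []) \<in> fp_rel V G"
    using Cons v by blast
  let ?z = "y @ [(v, inv\<^bsub>G v\<^esub> g)]"
  have "(y @ [(v, inv\<^bsub>G v\<^esub> g), (v, g)] @ x, y @ [(v, inv\<^bsub>G v\<^esub> g \<otimes>\<^bsub>G v\<^esub> g)] @ x) \<in> fp_rel V G"
    by (rule fp_rel.mult) (use y v in auto)
  moreover have "(y @ [(v, \<one>\<^bsub>G v\<^esub>)] @ x, y @ x) \<in> fp_rel V G"
    by (rule fp_rel.one) (use y v in auto)
  ultimately have "(?z @ p # x, []) \<in> fp_rel V G"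
    using y(2) v by (auto simp: p intro: fp_rel.trans)
  then show ?case using y v by (intro bexI[of _ ?z]) auto
qed

lemma group_free_product: "group (free_product V G)"
proof (rule groupI)
  let ?F = "free_product V G"
  have car: "carrier ?F = fp_words V G // fp_rel V G"
    and one: "\<one>\<^bsub>?F\<^esub> = fp_rel V G `` {[]}"
    by (simp_all add: free_product_def)
  show "A \<otimes>\<^bsub>?F\<^esub> B \<in> carrier ?F" if "A \<in> carrier ?F" "B \<in> carrier ?F" for A B
    using that by (auto simp: car free_product_mult intro!: quotientI elim!: quotientE)
  show "\<one>\<^bsub>?F\<^esub> \<in> carrier ?F"
    by (auto simp: car one intro!: quotientI)
  show "A \<otimes>\<^bsub>?F\<^esub> B \<otimes>\<^bsub>?F\<^esub> C = A \<otimes>\<^bsub>?F\<^esub> (B \<otimes>\<^bsub>?F\<^esub> C)"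
    if "A \<in> carrier ?F" "B \<in> carrier ?F" "C \<in> carrier ?F" for A B C
    using that by (auto simp: car free_product_mult elim!: quotientE)
  show "\<one>\<^bsub>?F\<^esub> \<otimes>\<^bsub>?F\<^esub> A = A" if "A \<in> carrier ?F" for A
    using that by (auto simp: car one free_product_mult elim!: quotientE)
  show "\<exists>B\<in>carrier ?F. B \<otimes>\<^bsub>?F\<^esub> A = \<one>\<^bsub>?F\<^esub>" if "A \<in> carrier ?F" for A
  proof -
    obtain x where x: "x \<in> fp_words V G" "A = fp_rel V G `` {x}"
      using \<open>A \<in> carrier ?F\<close> by (auto simp: car elim!: quotientE)
    obtain y where y: "y \<in> fp_words V G" "(y @ x, []) \<in> fp_rel V G"
      using fp_inverse_word[OF x(1)] by blast
    show ?thesis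
      using x y by (intro bexI[of _ "fp_rel V G `` {y}"])
        (auto simp: car one free_product_mult intro!: quotientI equiv_class_eq[OF equiv_fp_rel])
  qed
qed

lemma fp_inj_hom:
  assumes "v \<in> V"
  shows "fp_inj V G v \<in> hom (G v) (free_product V G)"
proof (rule homI)
  interpret group "G v" by (rule grp) fact
  show "fp_inj V G v g \<in> carrier (free_product V G)" if "g \<in> carrier (G v)" for g
    using that assms by (auto simp: fp_inj_def free_product_def intro!: quotientI)
  show "fp_inj V G v (g \<otimes>\<^bsub>G v\<^esub> h) = fp_inj V G v g \<otimes>\<^bsub>free_product V G\<^esub> fp_inj V G v h"
    if "g \<in> carrier (G v)" "h \<in> carrier (G v)" for g h
    using that assms fp_rel.mult[of "[]" V G "[]" v g h]
    by (auto simp: fp_inj_def free_product_mult intro!: equiv_class_eq[OF equiv_fp_rel] fp_rel.sym)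
qed

end


section \<open>Graph products\<close>

definition normal_closure :: "('a, 'b) monoid_scheme \<Rightarrow> 'a set \<Rightarrow> 'a set" where
  "normal_closure G S = \<Inter>{N. N \<lhd> G \<and> S \<subseteq> N}"

lemma (in group) normal_normal_closure:
  assumes "S \<subseteq> carrier G"
  shows "normal_closure G S \<lhd> G"
proof (rule normal_invI)
  have "carrier G \<lhd> G"
    by (simp add: normal_invI subgroup_self)
  with assms show "subgroup (normal_closure G S) G"
    unfolding normal_closure_def
    by (intro subgroups_Inter) (auto dest: normal_imp_subgroup)
  show "x \<otimes> h \<otimes> inv x \<in> normal_closure G S"
    if "x \<in> carrier G" "h \<in> normal_closure G S" for x h
    using that unfolding normal_closure_def by (auto dest: normal_invE(2))
qed

definition commutator :: "('a, 'b) monoid_scheme \<Rightarrow> 'a \<Rightarrow> 'a \<Rightarrow> 'a" where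
  "commutator G x y = x \<otimes>\<^bsub>G\<^esub> y \<otimes>\<^bsub>G\<^esub> inv\<^bsub>G\<^esub> x \<otimes>\<^bsub>G\<^esub> inv\<^bsub>G\<^esub> y"

definition edge_commutators ::
  "'v set \<Rightarrow> 'v set set \<Rightarrow> ('v \<Rightarrow> ('g, 'b) monoid_scheme) \<Rightarrow> ('v \<times> 'g) list set set" where
  "edge_commutators V E G =
     {commutator (free_product V G) (fp_inj V G v g) (fp_inj V G w h) | v w g h.
        v \<in> V \<and> w \<in> V \<and> {v, w} \<in> E \<and> g \<in> carrier (G v) \<and> h \<in> carrier (G w)}"

definition graph_product ::
  "'v set \<Rightarrow> 'v set set \<Rightarrow> ('v \<Rightarrow> ('g, 'b) monoid_scheme) \<Rightarrow> ('v \<times> 'g) list set set monoid" where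
  "graph_product V E G =
     free_product V G Mod normal_closure (free_product V G) (edge_commutators V E G)"

lemma group_graph_product:
  assumes "\<And>v. v \<in> V \<Longrightarrow> group (G v)"
  shows "group (graph_product V E G)"
proof -
  interpret F: group "free_product V G" by (rule group_free_product) (rule assms)
  have "fp_inj V G v g \<in> carrier (free_product V G)" if "v \<in> V" "g \<in> carrier (G v)" for v g
  proof -
    have "fp_inj V G v \<in> hom (G v) (free_product V G)"
      by (rule fp_inj_hom) (use assms that in auto)
    then show ?thesis
      using that(2) by (rule hom_in_carrier)
  qed
  then have "edge_commutators V E G \<subseteq> carrier (free_product V G)"
    by (auto simp: edge_commutators_def commutator_def)
  then show ?thesis
    unfolding graph_product_def
    by (rule normal.factorgroup_is_group[OF F.normal_normal_closure])
qed


section \<open>Semicomplete groups\<close>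

definition abelianization :: "('a, 'b) monoid_scheme \<Rightarrow> 'a set monoid" where
  "abelianization G = G Mod derived G (carrier G)"

text \<open>An automorphism \<open>f\<close> acts on the abelianization by mapping a coset of the derived
  subgroup to its image under \<open>f\<close>, which is again a coset; see \<open>ab_map_coset\<close>. Elements of
  \<open>auto G\<close> are extensional, hence the restriction.\<close>

definition ab_map :: "('a, 'b) monoid_scheme \<Rightarrow> ('a \<Rightarrow> 'a) \<Rightarrow> ('a set \<Rightarrow> 'a set)" where
  "ab_map G f = (\<lambda>A\<in>carrier (abelianization G). f ` A)"

definition IA :: "('a, 'b) monoid_scheme \<Rightarrow> ('a \<Rightarrow> 'a) set" where
  "IA G = kernel (AutoGroup G) (AutoGroup (abelianization G)) (ab_map G)"

definition Inn :: "('a, 'b) monoid_scheme \<Rightarrow> ('a \<Rightarrow> 'a) set" where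
  "Inn G = {\<lambda>x\<in>carrier G. g \<otimes>\<^bsub>G\<^esub> x \<otimes>\<^bsub>G\<^esub> inv\<^bsub>G\<^esub> g | g. g \<in> carrier G}"

definition semicomplete :: "('a, 'b) monoid_scheme \<Rightarrow> bool" where
  "semicomplete G \<longleftrightarrow> IA G = Inn G"

text \<open>Semicomplete groups need not be abelian: the symmetric group on three letters has only
  inner automorphisms. It is a graph product over a single vertex, where the condition that
  no link is contained in the star of another vertex holds vacuously. So deducing
  commutativity of the vertex groups from semicompleteness of a graph product requires at
  least two vertices.\<close>

lemma (in group) ab_map_coset:
  assumes f: "f \<in> auto G" and x: "x \<in> carrier G"
  shows "ab_map G f (derived G (carrier G) #> x) = derived G (carrier G) #> f x"
proof -
  have hom: "f \<in> hom G G" and bij: "bij_betw f (carrier G) (carrier G)"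
    using f by (auto simp: auto_def Bij_def)
  interpret f: group_hom G G f
    using hom by unfold_locales
  have derived: "f ` derived G (carrier G) = derived G (carrier G)"
    using f.derived_img[of "carrier G"] bij by (simp add: bij_betw_def)
  have "derived G (carrier G) \<subseteq> carrier G"
    by (rule derived_in_carrier) simp
  then have "f ` (derived G (carrier G) #> x) = f ` derived G (carrier G) #> f x"
    using x by (auto simp: r_coset_def image_UN subset_iff)
  moreover have "derived G (carrier G) #> x \<in> carrier (abelianization G)"
    using x by (auto simp: abelianization_def FactGroup_def RCOSETS_def)
  ultimately show ?thesis
    by (simp add: ab_map_def derived)
qed

end

theory Submission
  imports Defs
begin

text \<open>Let \<open>W\<close> range over the sets of vertices, let \<open>ret W\<close> be the retraction of the graph
  product \<open>P\<close> onto the special subgroup \<open>sp W\<close>, and fix a vertex \<open>s\<close>. The kernel of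
  \<open>ret (V - {s})\<close> is a free product of copies of \<open>G s\<close> indexed by the cosets of \<open>sp (lk s)\<close> in
  \<open>sp (V - {s})\<close>, and \<open>P\<close> acts on its reduced words; this replaces the Bass-Serre tree of the
  splitting of \<open>P\<close> over \<open>sp (lk s)\<close>. It shows that the centralizer of a nontrivial element of
  \<open>G s\<close> lies in \<open>sp (st s)\<close>, and that elements not conjugate into \<open>sp (V - {s})\<close> have an axis.

  Let \<open>\<phi>\<close> act trivially on the abelianization, with abelian vertex groups. For \<open>g\<close> in \<open>G v\<close> and
  \<open>s \<noteq> v\<close> choose \<open>w\<close> in \<open>lk v\<close> outside \<open>st s\<close>. The image of \<open>G w\<close> commutes with \<open>\<phi> g\<close> and has
  the full projection to \<open>G w\<close>, which an axis of \<open>\<phi> g\<close> would not allow. So \<open>\<phi> g\<close> is conjugate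
  into \<open>sp (V - {s})\<close> for all \<open>s \<noteq> v\<close>, hence to \<open>g\<close>, and \<open>\<phi>\<close> conjugates each \<open>G v\<close> by some
  \<open>c v\<close>. The coset \<open>c v sp (V - {u})\<close> is constant along edges outside \<open>st u\<close>, so without
  separating stars there is one coset for each \<open>u\<close>; these cosets have a common element, and \<open>\<phi>\<close> is
  conjugation by it. Conversely, conjugating a non-abelian vertex group, or one component of the
  complement of a separating star, gives an automorphism that is not inner.\<close>

section \<open>Conjugation and lifts\<close>

definition (in group) conjg :: "'a \<Rightarrow> 'a \<Rightarrow> 'a" where
  "conjg a x = a \<otimes> x \<otimes> inv a"

context group
begin

lemma inv_cancel_left [simp]:
  "a \<in> carrier G \<Longrightarrow> x \<in> carrier G \<Longrightarrow> inv a \<otimes> (a \<otimes> x) = x"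
  "a \<in> carrier G \<Longrightarrow> x \<in> carrier G \<Longrightarrow> a \<otimes> (inv a \<otimes> x) = x"
  by (simp_all add: m_assoc[symmetric])

lemma conjg_closed [simp]: "a \<in> carrier G \<Longrightarrow> x \<in> carrier G \<Longrightarrow> conjg a x \<in> carrier G"
  by (simp add: conjg_def)

lemma conjg_one [simp]: "x \<in> carrier G \<Longrightarrow> conjg \<one> x = x"
  by (simp add: conjg_def)

lemma conjg_one_right [simp]: "a \<in> carrier G \<Longrightarrow> conjg a \<one> = \<one>"
  by (simp add: conjg_def)

lemma conjg_conjg:
  "a \<in> carrier G \<Longrightarrow> b \<in> carrier G \<Longrightarrow> x \<in> carrier G \<Longrightarrow> conjg a (conjg b x) = conjg (a \<otimes> b) x"
  by (simp add: conjg_def inv_mult_group m_assoc)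

lemma conjg_mult:
  assumes "a \<in> carrier G" "x \<in> carrier G" "y \<in> carrier G"
  shows "conjg a (x \<otimes> y) = conjg a x \<otimes> conjg a y"
  using assms by (simp add: conjg_def m_assoc)

lemma conjg_hom: "a \<in> carrier G \<Longrightarrow> conjg a \<in> hom G G"
  by (auto intro!: homI simp: conjg_mult)

lemma conjg_pow:
  assumes "a \<in> carrier G" "x \<in> carrier G"
  shows "conjg a (x [^] (n::nat)) = conjg a x [^] n"
  by (induction n) (use assms in \<open>simp_all add: conjg_mult\<close>)

lemma conjg_inv_cancel [simp]:
  "a \<in> carrier G \<Longrightarrow> x \<in> carrier G \<Longrightarrow> conjg (inv a) (conjg a x) = x"
  "a \<in> carrier G \<Longrightarrow> x \<in> carrier G \<Longrightarrow> conjg a (conjg (inv a) x) = x"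
  by (simp_all add: conjg_conjg)

lemma conjg_eq_iff:
  "a \<in> carrier G \<Longrightarrow> x \<in> carrier G \<Longrightarrow> y \<in> carrier G \<Longrightarrow> conjg a x = y \<longleftrightarrow> x = conjg (inv a) y"
  by auto

lemma conjg_fix_iff:
  assumes "a \<in> carrier G" "x \<in> carrier G"
  shows "conjg a x = x \<longleftrightarrow> a \<otimes> x = x \<otimes> a"
  using assms by (auto simp: conjg_def inv_solve_right')

lemma conjg_eq_one_iff [simp]:
  "a \<in> carrier G \<Longrightarrow> x \<in> carrier G \<Longrightarrow> conjg a x = \<one> \<longleftrightarrow> x = \<one>"
  by (simp add: conjg_eq_iff)

end

lemma (in group_hom) hom_conjg:
  "a \<in> carrier G \<Longrightarrow> x \<in> carrier G \<Longrightarrow> h (G.conjg a x) = H.conjg (h a) (h x)"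
  by (simp add: G.conjg_def H.conjg_def)

text \<open>Serves twice: to factor a map out of the free product through the graph product, and to
  show that a map with commuting values kills the derived subgroup.\<close>

lemma (in group_hom) kernel_commutator:
  assumes "x \<in> carrier G" "y \<in> carrier G" "h x \<otimes>\<^bsub>H\<^esub> h y = h y \<otimes>\<^bsub>H\<^esub> h x"
  shows "commutator G x y \<in> kernel G H h"
proof -
  have "h (commutator G x y) = h x \<otimes>\<^bsub>H\<^esub> h y \<otimes>\<^bsub>H\<^esub> inv\<^bsub>H\<^esub> h x \<otimes>\<^bsub>H\<^esub> inv\<^bsub>H\<^esub> h y"
    using assms by (simp add: commutator_def)
  also have "\<dots> = \<one>\<^bsub>H\<^esub>"
    using assms by (simp add: H.m_assoc)
  finally show ?thesis using assms by (simp add: kernel_def commutator_def)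
qed

definition fp_eval :: "('h, 'd) monoid_scheme \<Rightarrow> ('v \<Rightarrow> 'g \<Rightarrow> 'h) \<Rightarrow> ('v \<times> 'g) list \<Rightarrow> 'h" where
  "fp_eval H f w = foldr (\<lambda>(v, g) y. f v g \<otimes>\<^bsub>H\<^esub> y) w \<one>\<^bsub>H\<^esub>"

section \<open>The graph product and its vertex groups\<close>

locale graph_of_groups =
  fixes V :: "'v set" and E :: "'v set set" and G :: "'v \<Rightarrow> ('g, 'b) monoid_scheme"
  assumes graph: "simple_graph V E"
    and vertex_group: "\<And>v. v \<in> V \<Longrightarrow> group (G v)"
begin

abbreviation "FP \<equiv> free_product V G"
abbreviation "NC \<equiv> normal_closure FP (edge_commutators V E G)"
abbreviation "P \<equiv> graph_product V E G"
abbreviation pmult (infixl "\<cdot>" 70) where "x \<cdot> y \<equiv> x \<otimes>\<^bsub>P\<^esub> y"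

sublocale FP: group FP
  by (rule group_free_product) (rule vertex_group)

sublocale P: group P
  by (rule group_graph_product) (rule vertex_group)

lemma finite_V: "finite V"
  using graph by (simp add: simple_graph_def)

lemma edge_sym: "{v, w} \<in> E \<Longrightarrow> {w, v} \<in> E"
  by (simp add: insert_commute)

lemma edge_in_V: "{v, w} \<in> E \<Longrightarrow> v \<in> V \<and> w \<in> V \<and> v \<noteq> w"
  using graph unfolding simple_graph_def by (metis doubleton_eq_iff)

lemma lk_iff: "w \<in> lk V E v \<longleftrightarrow> {v, w} \<in> E"
  using edge_in_V by (auto simp: lk_def)

lemma lk_sym: "w \<in> lk V E v \<longleftrightarrow> v \<in> lk V E w"
  by (simp add: lk_iff insert_commute)

lemma lk_subset: "lk V E v \<subseteq> V"
  by (auto simp: lk_def)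

lemma not_in_lk: "v \<notin> lk V E v"
  using edge_in_V[of v v] by (auto simp: lk_iff)

lemma fp_inj_closed:
  "v \<in> V \<Longrightarrow> g \<in> carrier (G v) \<Longrightarrow> fp_inj V G v g \<in> carrier FP"
  using fp_inj_hom[where V = V and G = G, OF vertex_group] by (auto simp: hom_def)

lemma edge_commutators_closed: "edge_commutators V E G \<subseteq> carrier FP"
  by (auto simp: edge_commutators_def commutator_def fp_inj_closed)

lemma normal_NC: "NC \<lhd> FP"
  by (rule FP.normal_normal_closure[OF edge_commutators_closed])

definition emb :: "'v \<Rightarrow> 'g \<Rightarrow> ('v \<times> 'g) list set set" where
  "emb v g = NC #>\<^bsub>FP\<^esub> fp_inj V G v g"

lemma proj_hom: "(\<lambda>x. NC #>\<^bsub>FP\<^esub> x) \<in> hom FP P"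
  unfolding graph_product_def by (rule normal.r_coset_hom_Mod[OF normal_NC])

lemma emb_hom: "v \<in> V \<Longrightarrow> emb v \<in> hom (G v) P"
  using hom_compose[OF fp_inj_hom[where V = V and G = G, OF vertex_group] proj_hom]
  by (simp add: emb_def[abs_def] comp_def)

lemma group_hom_emb: "v \<in> V \<Longrightarrow> group_hom (G v) P (emb v)"
  using emb_hom vertex_group P.is_group by (auto simp: group_hom_def group_hom_axioms_def)

lemma emb_closed [simp]: "v \<in> V \<Longrightarrow> g \<in> carrier (G v) \<Longrightarrow> emb v g \<in> carrier P"
  using emb_hom by (auto simp: hom_def)

lemma emb_mult:
  "v \<in> V \<Longrightarrow> g \<in> carrier (G v) \<Longrightarrow> h \<in> carrier (G v) \<Longrightarrow> emb v (g \<otimes>\<^bsub>G v\<^esub> h) = emb v g \<cdot> emb v h"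
  using emb_hom by (auto simp: hom_def)

lemma emb_one: "v \<in> V \<Longrightarrow> emb v \<one>\<^bsub>G v\<^esub> = \<one>\<^bsub>P\<^esub>"
  using group_hom.hom_one[OF group_hom_emb] .

lemma emb_inv: "v \<in> V \<Longrightarrow> g \<in> carrier (G v) \<Longrightarrow> emb v (inv\<^bsub>G v\<^esub> g) = inv\<^bsub>P\<^esub> emb v g"
  using group_hom.hom_inv[OF group_hom_emb] .

lemma emb_commute:
  assumes "{v, w} \<in> E" "g \<in> carrier (G v)" "h \<in> carrier (G w)"
  shows "emb v g \<cdot> emb w h = emb w h \<cdot> emb v g"
proof -
  interpret pr: group_hom FP P "\<lambda>x. NC #>\<^bsub>FP\<^esub> x"
    using proj_hom by unfold_locales
  have v: "v \<in> V" "w \<in> V" using edge_in_V[OF assms(1)] by auto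
  let ?a = "fp_inj V G v g" and ?b = "fp_inj V G w h"
  have ab: "?a \<in> carrier FP" "?b \<in> carrier FP" using v assms fp_inj_closed by auto
  have "commutator FP ?a ?b \<in> edge_commutators V E G"
    using assms v by (auto simp: edge_commutators_def)
  then have "commutator FP ?a ?b \<in> NC"
    by (auto simp: normal_closure_def)
  then have "NC #>\<^bsub>FP\<^esub> commutator FP ?a ?b = \<one>\<^bsub>P\<^esub>"
    unfolding graph_product_def FactGroup_def
    using ab by (simp add: FP.coset_join2 normal_imp_subgroup[OF normal_NC] commutator_def)
  then have "emb v g \<cdot> emb w h \<cdot> inv\<^bsub>P\<^esub> emb v g \<cdot> inv\<^bsub>P\<^esub> emb w h = \<one>\<^bsub>P\<^esub>"
    using ab by (simp add: commutator_def emb_def)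
  then show ?thesis
    using v assms by (simp add: P.inv_solve_right' P.m_assoc[symmetric])
qed

section \<open>The universal property of the graph product\<close>

lemma fp_eval_closed:
  fixes H :: "('h, 'd) monoid_scheme"
  assumes "group H" and f: "\<And>v. v \<in> V \<Longrightarrow> f v \<in> hom (G v) H" and "x \<in> fp_words V G"
  shows "fp_eval H f x \<in> carrier H"
proof -
  interpret H: group H by fact
  show ?thesis
    using assms(3)
  proof (induction x)
    case (Cons p x)
    then show ?case
      using hom_in_carrier[OF f] by (cases p) (auto simp: fp_eval_def)
  qed (simp add: fp_eval_def)
qed

lemma fp_eval_append:
  fixes H :: "('h, 'd) monoid_scheme"
  assumes "group H" and f: "\<And>v. v \<in> V \<Longrightarrow> f v \<in> hom (G v) H"
    and "x \<in> fp_words V G" "y \<in> fp_words V G"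
  shows "fp_eval H f (x @ y) = fp_eval H f x \<otimes>\<^bsub>H\<^esub> fp_eval H f y"
proof -
  interpret H: group H by fact
  have closed: "fp_eval H f z \<in> carrier H" if "z \<in> fp_words V G" for z
    using fp_eval_closed[of H f z] assms(1) f that by blast
  show ?thesis
    using assms(3)
  proof (induction x)
    case Nil
    then show ?case using closed[OF assms(4)] by (simp add: fp_eval_def)
  next
    case (Cons p x)
    obtain v g where p: "p = (v, g)" by force
    have w: "v \<in> V" "g \<in> carrier (G v)" "x \<in> fp_words V G" using Cons.prems by (auto simp: p)
    have eval: "fp_eval H f ((v, g) # z) = f v g \<otimes>\<^bsub>H\<^esub> fp_eval H f z" for z
      by (simp add: fp_eval_def)
    show ?case
      using Cons.IH[OF w(3)] hom_in_carrier[OF f[OF w(1)] w(2)] closed[OF w(3)] closed[OF assms(4)]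
      by (simp add: p eval H.m_assoc)
  qed
qed

lemma fp_eval_rel:
  fixes H :: "('h, 'd) monoid_scheme"
  assumes "group H" and f: "\<And>v. v \<in> V \<Longrightarrow> f v \<in> hom (G v) H"
    and "(x, y) \<in> fp_rel V G"
  shows "fp_eval H f x = fp_eval H f y"
proof -
  interpret H: group H by fact
  have fc: "f v g \<in> carrier H" if "v \<in> V" "g \<in> carrier (G v)" for v g
    using hom_in_carrier[OF f] that by blast
  have closed: "fp_eval H f x \<in> carrier H" if "x \<in> fp_words V G" for x
    using fp_eval_closed[of H f x] assms(1) f that by blast
  have append: "fp_eval H f (x @ y) = fp_eval H f x \<otimes>\<^bsub>H\<^esub> fp_eval H f y"
    if "x \<in> fp_words V G" "y \<in> fp_words V G" for x y
    using fp_eval_append[of H f x y] assms(1) f that by blast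
  from assms(3) show ?thesis
  proof (induction rule: fp_rel.induct)
    case (one x y v)
    have "f v \<one>\<^bsub>G v\<^esub> = \<one>\<^bsub>H\<^esub>"
      using hom_one[OF f] one vertex_group H.is_group by auto
    then have "fp_eval H f ([(v, \<one>\<^bsub>G v\<^esub>)] @ y) = fp_eval H f y"
      using closed[OF one(2)] by (simp add: fp_eval_def)
    moreover have "(v, \<one>\<^bsub>G v\<^esub>) # y \<in> fp_words V G"
      using one by (simp add: group.is_monoid vertex_group)
    ultimately show ?case
      using one by (simp add: append)
  next
    case (mult x y v g h)
    have "fp_eval H f ([(v, g), (v, h)] @ y) = fp_eval H f ([(v, g \<otimes>\<^bsub>G v\<^esub> h)] @ y)"
      using closed[OF mult(2)] mult f[OF mult(3)] by (simp add: fp_eval_def hom_def fc H.m_assoc[symmetric])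
    moreover have "g \<otimes>\<^bsub>G v\<^esub> h \<in> carrier (G v)"
      using mult by (simp add: group.is_monoid monoid.m_closed vertex_group)
    ultimately show ?case
      using mult append[of x "[(v, g), (v, h)] @ y"] append[of x "[(v, g \<otimes>\<^bsub>G v\<^esub> h)] @ y"] by simp
  qed auto
qed

text \<open>Evaluation of words is constant on classes of \<open>fp_rel\<close>, so it descends to
  the free product; there the commutators of adjacent vertex groups die, so \<open>NC\<close> lies
  in the kernel and the map factors through \<open>P\<close>. Retractions, the action on words and
  partial conjugations all come from here.\<close>

lemma lift_exists:
  fixes H :: "('h, 'd) monoid_scheme"
  assumes "group H" and f: "\<And>v. v \<in> V \<Longrightarrow> f v \<in> hom (G v) H"
    and comm: "\<And>v w g h. {v, w} \<in> E \<Longrightarrow> g \<in> carrier (G v) \<Longrightarrow> h \<in> carrier (G w) \<Longrightarrow>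
        f v g \<otimes>\<^bsub>H\<^esub> f w h = f w h \<otimes>\<^bsub>H\<^esub> f v g"
  shows "\<exists>F\<in>hom P H. \<forall>v\<in>V. \<forall>g\<in>carrier (G v). F (emb v g) = f v g"
proof -
  interpret H: group H by fact
  note equiv = equiv_fp_rel[where V = V and G = G, OF vertex_group]
  have fc: "f v g \<in> carrier H" if "v \<in> V" "g \<in> carrier (G v)" for v g
    using hom_in_carrier[OF f] that by blast
  have closed: "fp_eval H f x \<in> carrier H" if "x \<in> fp_words V G" for x
    using fp_eval_closed[of H f x] assms(1) f that by blast
  have append: "fp_eval H f (x @ y) = fp_eval H f x \<otimes>\<^bsub>H\<^esub> fp_eval H f y"
    if "x \<in> fp_words V G" "y \<in> fp_words V G" for x y
    using fp_eval_append[of H f x y] assms(1) f that by blast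
  \<comment> \<open>All words of a class have the same value, so the image of a class is a singleton
    and no representative has to be chosen.\<close>
  define F where "F A = the_elem (fp_eval H f ` A)" for A
  have F: "F (fp_rel V G `` {x}) = fp_eval H f x" if "x \<in> fp_words V G" for x
  proof -
    have "fp_eval H f y = fp_eval H f x" if "(x, y) \<in> fp_rel V G" for y
      using fp_eval_rel[of H f y x] assms(1) f fp_rel.sym[OF that] by blast
    then have "fp_eval H f ` (fp_rel V G `` {x}) = {fp_eval H f x}"
      using equiv_class_self[OF equiv that] by blast
    then show ?thesis by (simp add: F_def)
  qed
  have car: "carrier FP = fp_words V G // fp_rel V G"
    by (simp add: free_product_def)
  have hom: "F \<in> hom FP H"
  proof (rule homI)
    show "F A \<in> carrier H" if "A \<in> carrier FP" for A
      using that F closed by (auto simp: car elim!: quotientE)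
    show "F (A \<otimes>\<^bsub>FP\<^esub> B) = F A \<otimes>\<^bsub>H\<^esub> F B" if "A \<in> carrier FP" "B \<in> carrier FP" for A B
      using that F append by (auto simp: car free_product_mult[where V = V and G = G, OF vertex_group] elim!: quotientE)
  qed
  then interpret F: group_hom FP H F by unfold_locales
  have Finj: "F (fp_inj V G v g) = f v g" if "v \<in> V" "g \<in> carrier (G v)" for v g
    using that F[of "[(v, g)]"] fc by (simp add: fp_inj_def fp_eval_def)
  have "edge_commutators V E G \<subseteq> kernel FP H F"
    using Finj comm by (auto simp: edge_commutators_def fp_inj_closed intro!: F.kernel_commutator)
  then have "NC \<subseteq> kernel FP H F"
    using F.normal_kernel by (auto simp: normal_closure_def)
  with F.FactGroup_universal_kernel[OF normal_NC]
  obtain k where "k \<in> hom (FP Mod NC) H" "\<And>x. x \<in> carrier FP \<Longrightarrow> k (NC #>\<^bsub>FP\<^esub> x) = F x"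
    by metis
  then show ?thesis
    unfolding graph_product_def emb_def
    using Finj fp_inj_closed by (intro bexI[of _ k]) auto
qed

text \<open>Every element is the class of a word, and words are built letter by letter on the
  left.\<close>

lemma P_induct [consumes 1, case_names one mult]:
  assumes "x \<in> carrier P" and one: "Q \<one>\<^bsub>P\<^esub>"
    and mult: "\<And>v g x. v \<in> V \<Longrightarrow> g \<in> carrier (G v) \<Longrightarrow> x \<in> carrier P \<Longrightarrow> Q x \<Longrightarrow> Q (emb v g \<cdot> x)"
  shows "Q x"
proof -
  interpret pr: group_hom FP P "\<lambda>x. NC #>\<^bsub>FP\<^esub> x"
    using proj_hom by unfold_locales
  have car: "carrier FP = fp_words V G // fp_rel V G"
    and one_eq: "\<one>\<^bsub>FP\<^esub> = fp_rel V G `` {[]}"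
    by (simp_all add: free_product_def)
  have "Q (NC #>\<^bsub>FP\<^esub> (fp_rel V G `` {w}))" if "w \<in> fp_words V G" for w
    using that
  proof (induction w)
    case Nil
    then show ?case using one pr.hom_one by (simp add: one_eq)
  next
    case (Cons p w)
    obtain v g where p: "p = (v, g)" by force
    have w: "v \<in> V" "g \<in> carrier (G v)" "w \<in> fp_words V G" using Cons(2) by (auto simp: p)
    have in_car: "fp_rel V G `` {w} \<in> carrier FP"
      using w by (auto simp: car intro: quotientI)
    have "fp_rel V G `` {p # w} = fp_inj V G v g \<otimes>\<^bsub>FP\<^esub> (fp_rel V G `` {w})"
      using w by (simp add: fp_inj_def free_product_mult[where V = V and G = G, OF vertex_group] p)
    then have "NC #>\<^bsub>FP\<^esub> (fp_rel V G `` {p # w}) = emb v g \<cdot> (NC #>\<^bsub>FP\<^esub> (fp_rel V G `` {w}))"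
      using w in_car by (simp add: emb_def fp_inj_closed)
    then show ?case using Cons w in_car by (simp add: mult)
  qed
  moreover have "\<exists>w\<in>fp_words V G. x = NC #>\<^bsub>FP\<^esub> (fp_rel V G `` {w})"
    using assms(1) by (auto simp: graph_product_def FactGroup_def RCOSETS_def car elim!: quotientE)
  ultimately show ?thesis by auto
qed

lemma hom_eqI:
  assumes "group H" "f \<in> hom P H" "k \<in> hom P H"
    and "\<And>v g. v \<in> V \<Longrightarrow> g \<in> carrier (G v) \<Longrightarrow> f (emb v g) = k (emb v g)"
    and "x \<in> carrier P"
  shows "f x = k x"
proof -
  interpret f: group_hom P H f using assms by (simp add: group_hom_def group_hom_axioms_def P.is_group)
  interpret k: group_hom P H k using assms by (simp add: group_hom_def group_hom_axioms_def P.is_group)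
  show ?thesis
    using assms(5) by (induction rule: P_induct) (simp_all add: assms(4))
qed

end

section \<open>Retractions and special subgroups\<close>

context graph_of_groups
begin

text \<open>Chosen among the maps that \<open>lift_exists\<close> provides; by
  \<open>hom_eqI\<close> there is only one on \<open>carrier P\<close>. Having values in
  \<open>P\<close> itself, retractions compose without inclusion maps.\<close>

definition ret :: "'v set \<Rightarrow> ('v \<times> 'g) list set set \<Rightarrow> ('v \<times> 'g) list set set" where
  "ret W = (SOME F. F \<in> hom P P \<and>
     (\<forall>v\<in>V. \<forall>g\<in>carrier (G v). F (emb v g) = (if v \<in> W then emb v g else \<one>\<^bsub>P\<^esub>)))"

lemma ret_spec:
  "ret W \<in> hom P P \<and>
     (\<forall>v\<in>V. \<forall>g\<in>carrier (G v). ret W (emb v g) = (if v \<in> W then emb v g else \<one>\<^bsub>P\<^esub>))"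
proof -
  let ?f = "\<lambda>v g. if v \<in> W then emb v g else \<one>\<^bsub>P\<^esub>"
  have "\<exists>F\<in>hom P P. \<forall>v\<in>V. \<forall>g\<in>carrier (G v). F (emb v g) = ?f v g"
  proof (rule lift_exists[OF P.is_group])
    show "?f v \<in> hom (G v) P" if "v \<in> V" for v
      using that by (auto intro!: homI simp: emb_mult)
    show "?f v g \<cdot> ?f w h = ?f w h \<cdot> ?f v g"
      if "{v, w} \<in> E" "g \<in> carrier (G v)" "h \<in> carrier (G w)" for v w g h
      using that emb_commute[OF that] edge_in_V[OF that(1)] by simp
  qed
  then have "\<exists>F. F \<in> hom P P \<and> (\<forall>v\<in>V. \<forall>g\<in>carrier (G v). F (emb v g) = ?f v g)"
    by blast
  then show ?thesis
    unfolding ret_def by (rule someI_ex)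
qed

lemma ret_hom: "ret W \<in> hom P P"
  using ret_spec by blast

lemma ret_emb: "v \<in> V \<Longrightarrow> g \<in> carrier (G v) \<Longrightarrow> ret W (emb v g) = (if v \<in> W then emb v g else \<one>\<^bsub>P\<^esub>)"
  using ret_spec by blast

sublocale ret: group_hom P P "ret W" for W
  using ret_hom by unfold_locales

lemma ret_ret: "x \<in> carrier P \<Longrightarrow> ret W (ret W' x) = ret (W \<inter> W') x"
  by (rule hom_eqI[OF P.is_group, of "\<lambda>x. ret W (ret W' x)"])
    (auto intro!: homI simp: ret_emb)

lemma ret_full: "V \<subseteq> W \<Longrightarrow> x \<in> carrier P \<Longrightarrow> ret W x = x"
  by (rule hom_eqI[OF P.is_group, of "ret W" "\<lambda>x. x"])
    (auto intro!: homI simp: ret_emb ret_hom)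

lemma ret_Int_V: "x \<in> carrier P \<Longrightarrow> ret (W \<inter> V) x = ret W x"
  using ret_ret[of x W V] ret_full[of V x] by simp

lemma ret_empty: "x \<in> carrier P \<Longrightarrow> ret {} x = \<one>\<^bsub>P\<^esub>"
  by (rule hom_eqI[OF P.is_group, of "ret {}" "\<lambda>x. \<one>\<^bsub>P\<^esub>"])
    (auto intro!: homI simp: ret_emb ret_hom)

text \<open>Special subgroups as fixed points of retractions: intersections become computations with
  \<open>ret\<close>, and \<open>sp_induct\<close> recovers generation by the vertex groups.\<close>

definition sp :: "'v set \<Rightarrow> ('v \<times> 'g) list set set set" where
  "sp W = {x \<in> carrier P. ret W x = x}"

lemma sp_closed: "x \<in> sp W \<Longrightarrow> x \<in> carrier P"
  by (simp add: sp_def)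

lemma sp_ret: "x \<in> sp W \<Longrightarrow> ret W x = x"
  by (simp add: sp_def)

lemma sp_one [simp]: "\<one>\<^bsub>P\<^esub> \<in> sp W"
  by (simp add: sp_def)

lemma sp_mult: "x \<in> sp W \<Longrightarrow> y \<in> sp W \<Longrightarrow> x \<cdot> y \<in> sp W"
  by (simp add: sp_def)

lemma sp_inv: "x \<in> sp W \<Longrightarrow> inv\<^bsub>P\<^esub> x \<in> sp W"
  by (simp add: sp_def)

lemma sp_conjg: "x \<in> sp W \<Longrightarrow> y \<in> sp W \<Longrightarrow> P.conjg x y \<in> sp W"
  by (simp add: P.conjg_def sp_mult sp_inv)

lemma sp_emb: "v \<in> W \<Longrightarrow> v \<in> V \<Longrightarrow> g \<in> carrier (G v) \<Longrightarrow> emb v g \<in> sp W"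
  by (simp add: sp_def ret_emb)

lemma ret_sp: "x \<in> carrier P \<Longrightarrow> ret W x \<in> sp W"
  by (simp add: sp_def ret_ret)

lemma ret_sp_other: "x \<in> sp W' \<Longrightarrow> ret W x \<in> sp (W \<inter> W')"
proof -
  assume "x \<in> sp W'"
  then have "x \<in> carrier P" "ret W x = ret (W \<inter> W') x"
    using ret_ret[of x W W'] by (simp_all add: sp_def)
  then show ?thesis by (simp add: ret_sp)
qed

lemma sp_Int: "sp W \<inter> sp W' = sp (W \<inter> W')"
proof (intro equalityI subsetI)
  fix x assume "x \<in> sp W \<inter> sp W'"
  then have x: "x \<in> carrier P" "ret W x = x" "ret W' x = x" by (simp_all add: sp_def)
  have "ret (W \<inter> W') x = ret W (ret W' x)" using ret_ret x(1) by simp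
  also have "\<dots> = x" by (simp only: x)
  finally show "x \<in> sp (W \<inter> W')" using x(1) by (simp only: sp_def mem_Collect_eq simp_thms)
next
  fix x assume "x \<in> sp (W \<inter> W')"
  then have x: "x \<in> carrier P" "ret (W \<inter> W') x = x" by (simp_all add: sp_def)
  have "ret U x = x" if "U \<inter> (W \<inter> W') = W \<inter> W'" for U
    using ret_ret[OF x(1), of U "W \<inter> W'"] unfolding that x(2) .
  from this[of W] this[of W'] have "ret W x = x" "ret W' x = x" by blast+
  then show "x \<in> sp W \<inter> sp W'" using x(1) by (simp only: sp_def mem_Collect_eq Int_iff simp_thms)
qed

lemma sp_Int_V: "sp (W \<inter> V) = sp W"
  unfolding sp_def using ret_Int_V by (metis (no_types, lifting))

lemma sp_mono: "W \<inter> V \<subseteq> W' \<Longrightarrow> sp W \<subseteq> sp W'"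
  by (metis Int_absorb2 Int_lower2 sp_Int sp_Int_V)

lemma sp_full: "sp V = carrier P"
  by (auto simp: sp_def ret_full)

lemma sp_Diff_INT:
  assumes "x \<in> carrier P" "finite A" "\<And>u. u \<in> A \<Longrightarrow> x \<in> sp (V - {u})"
  shows "x \<in> sp (V - A)"
  using assms(2,3)
proof (induction A)
  case empty
  then show ?case using assms(1) by (simp add: sp_full)
next
  case (insert u A)
  then have "x \<in> sp (V - A) \<inter> sp (V - {u})" by auto
  moreover have "(V - A) \<inter> (V - {u}) = V - insert u A" by auto
  ultimately show ?case by (simp add: sp_Int)
qed

lemma ret_disjoint: "x \<in> sp W' \<Longrightarrow> W \<inter> W' = {} \<Longrightarrow> ret W x = \<one>\<^bsub>P\<^esub>"
  using ret_ret[of x W W'] by (simp add: sp_def ret_empty)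

text \<open>Induct over all of \<open>P\<close> on the image under \<open>ret W\<close>: letters
  outside \<open>W\<close> disappear, and an element of \<open>sp W\<close> is its own
  image.\<close>

lemma sp_induct [consumes 1, case_names one mult]:
  assumes "x \<in> sp W" and one: "Q \<one>\<^bsub>P\<^esub>"
    and mult: "\<And>v g x. v \<in> V \<Longrightarrow> v \<in> W \<Longrightarrow> g \<in> carrier (G v) \<Longrightarrow> x \<in> sp W \<Longrightarrow> Q x \<Longrightarrow> Q (emb v g \<cdot> x)"
  shows "Q x"
proof -
  have "Q (ret W x)" if "x \<in> carrier P" for x
    using that
  proof (induction rule: P_induct)
    case (mult v g x)
    then show ?case
      using assms(3)[of v g "ret W x"] by (simp add: ret_emb ret_sp)
  qed (simp add: one)
  from this[of x] show ?thesis using assms(1) by (simp add: sp_def)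
qed

lemma sp_commute:
  assumes "z \<in> sp (lk V E v)" "v \<in> V" "g \<in> carrier (G v)"
  shows "z \<cdot> emb v g = emb v g \<cdot> z"
  using assms(1)
proof (induction rule: sp_induct)
  case (mult w h x)
  then have "x \<in> carrier P" by (simp add: sp_closed)
  moreover have "emb w h \<cdot> emb v g = emb v g \<cdot> emb w h"
    using mult assms by (intro emb_commute) (simp_all add: lk_iff insert_commute)
  ultimately show ?case
    using mult assms by (metis P.m_assoc emb_closed)
qed (use assms in auto)

lemma conjg_emb_lk:
  assumes "z \<in> sp (lk V E v)" "v \<in> V" "g \<in> carrier (G v)"
  shows "P.conjg z (emb v g) = emb v g"
  using assms by (simp add: P.conjg_fix_iff sp_closed sp_commute)

lemma sp_singleE:
  assumes "x \<in> sp {v}" "v \<in> V"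
  obtains g where "g \<in> carrier (G v)" "x = emb v g"
proof -
  interpret group "G v" using vertex_group assms by auto
  from assms(1) have "\<exists>g\<in>carrier (G v). x = emb v g"
  proof (induction rule: sp_induct)
    case one
    then show ?case using emb_one[OF assms(2)] by (intro bexI[of _ "\<one>\<^bsub>G v\<^esub>"]) auto
  next
    case (mult w g x)
    then obtain h where "h \<in> carrier (G v)" "x = emb v h" "w = v" by auto
    then show ?case using mult by (intro bexI[of _ "g \<otimes>\<^bsub>G v\<^esub> h"]) (auto simp: emb_mult)
  qed
  then show ?thesis using that by auto
qed

text \<open>Letters from the link can be moved past those of \<open>G v\<close>, so all letters of
  \<open>G v\<close> can be collected in front.\<close>

lemma sp_stE:
  assumes "x \<in> sp (st V E v)" "v \<in> V"
  obtains g z where "g \<in> carrier (G v)" "z \<in> sp (lk V E v)" "x = emb v g \<cdot> z"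
proof -
  interpret group "G v" using vertex_group assms by auto
  from assms(1) have "\<exists>g\<in>carrier (G v). \<exists>z\<in>sp (lk V E v). x = emb v g \<cdot> z"
  proof (induction rule: sp_induct)
    case one
    then show ?case using emb_one[OF assms(2)]
      by (intro bexI[of _ "\<one>\<^bsub>G v\<^esub>"] bexI[of _ "\<one>\<^bsub>P\<^esub>"]) auto
  next
    case (mult w g x)
    then obtain h z where h: "h \<in> carrier (G v)" "z \<in> sp (lk V E v)" "x = emb v h \<cdot> z" by auto
    then have z: "z \<in> carrier P" by (simp add: sp_closed)
    show ?case
    proof (cases "w = v")
      case True
      then show ?thesis using mult h z
        by (intro bexI[of _ "g \<otimes>\<^bsub>G v\<^esub> h"] bexI[of _ z]) (auto simp: emb_mult P.m_assoc)
    next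
      case False
      then have w: "w \<in> lk V E v" using mult by (simp add: st_def)
      then have "emb w g \<in> sp (lk V E v)" using mult by (simp add: sp_emb)
      moreover from this have "emb w g \<cdot> (emb v h \<cdot> z) = emb v h \<cdot> (emb w g \<cdot> z)"
        using sp_commute[OF _ assms(2) h(1)] z h mult assms by (simp add: P.m_assoc[symmetric])
      ultimately show ?thesis using h
        by (intro bexI[of _ h] bexI[of _ "emb w g \<cdot> z"]) (auto simp: sp_mult)
    qed
  qed
  then show ?thesis using that by auto
qed

text \<open>A retraction with values in \<open>G v\<close> itself is a left inverse of
  \<open>emb v\<close>.\<close>

lemma emb_inj:
  assumes "v \<in> V" "g \<in> carrier (G v)" "h \<in> carrier (G v)" "emb v g = emb v h"
  shows "g = h"
proof -
  have grp: "group (G v)" by (rule vertex_group) fact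
  interpret group "G v" by fact
  let ?f = "\<lambda>w g. if w = v then g else \<one>\<^bsub>G v\<^esub>"
  have "\<exists>F\<in>hom P (G v). \<forall>w\<in>V. \<forall>g\<in>carrier (G w). F (emb w g) = ?f w g"
  proof (rule lift_exists[OF grp])
    show "?f w \<in> hom (G w) (G v)" for w
      by (cases "w = v") (auto intro!: homI)
    show "?f w g \<otimes>\<^bsub>G v\<^esub> ?f w' h = ?f w' h \<otimes>\<^bsub>G v\<^esub> ?f w g"
      if "{w, w'} \<in> E" "g \<in> carrier (G w)" "h \<in> carrier (G w')" for w w' g h
      using that edge_in_V[OF that(1)] by auto
  qed
  then show ?thesis using assms by metis
qed

lemma emb_eq_one_iff: "v \<in> V \<Longrightarrow> g \<in> carrier (G v) \<Longrightarrow> emb v g = \<one>\<^bsub>P\<^esub> \<longleftrightarrow> g = \<one>\<^bsub>G v\<^esub>"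
  using emb_inj[of v g "\<one>\<^bsub>G v\<^esub>"] emb_one[of v] group.is_monoid[OF vertex_group, of v] by auto

end

section \<open>Reduced words in a free product of copies of one group\<close>

text \<open>A syllable \<open>(i, g)\<close> is the element \<open>g\<close> of the copy of the group with index \<open>i\<close>.\<close>

context group
begin

definition red :: "'i set \<Rightarrow> ('i \<times> 'a) list set" where
  "red I = {w. set w \<subseteq> I \<times> (carrier G - {\<one>}) \<and> distinct_adj (map fst w)}"

text \<open>Left multiplication by one nontrivial syllable. For \<open>g = \<one>\<close> the result
  need not be reduced, so the identity is treated separately wherever this serves as an
  action.\<close>

fun smul :: "'i \<Rightarrow> 'a \<Rightarrow> ('i \<times> 'a) list \<Rightarrow> ('i \<times> 'a) list" where
  "smul i g [] = [(i, g)]"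
| "smul i g ((j, h) # w) =
    (if i = j then (if g \<otimes> h = \<one> then w else (i, g \<otimes> h) # w) else (i, g) # (j, h) # w)"

definition wmul :: "('i \<times> 'a) list \<Rightarrow> ('i \<times> 'a) list \<Rightarrow> ('i \<times> 'a) list" where
  "wmul p q = foldr (\<lambda>(i, g). smul i g) p q"

lemma wmul_simps [simp]:
  "wmul [] q = q"
  "wmul ((i, g) # p) q = smul i g (wmul p q)"
  by (simp_all add: wmul_def)

lemma wmul_append: "wmul (p @ p') q = wmul p (wmul p' q)"
  by (simp add: wmul_def)

lemma red_Nil [simp]: "[] \<in> red I"
  by (simp add: red_def)

lemma red_Cons:
  "(i, g) # w \<in> red I \<longleftrightarrow>
     i \<in> I \<and> g \<in> carrier G \<and> g \<noteq> \<one> \<and> w \<in> red I \<and> (w = [] \<or> fst (hd w) \<noteq> i)"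
  by (cases w) (auto simp: red_def)

lemma red_append:
  "p @ q \<in> red I \<longleftrightarrow> p \<in> red I \<and> q \<in> red I \<and> (p = [] \<or> q = [] \<or> fst (last p) \<noteq> fst (hd q))"
  by (auto simp: red_def distinct_adj_append_iff last_map hd_map)

lemma red_map:
  assumes "w \<in> red I" "inj_on f I" "f ` I \<subseteq> J"
  shows "map (apfst f) w \<in> red J"
  using assms(1)
proof (induction w)
  case (Cons x w)
  obtain i g where x: "x = (i, g)" by force
  show ?case
    using Cons assms(2,3)
    by (cases w) (auto simp: x red_Cons inj_on_eq_iff)
qed simp

lemma smul_red:
  assumes "w \<in> red I" "i \<in> I" "g \<in> carrier G" "g \<noteq> \<one>"
  shows "smul i g w \<in> red I"
  using assms by (cases w rule: list.exhaust[case_names Nil Cons]) (auto simp: red_Cons)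

text \<open>If \<open>h\<close> cancels the first syllable, the next one has another index, so
  \<open>g\<close> is put in front unmerged. This is the law of an action, with the case of a
  trivial product written out.\<close>

lemma smul_smul:
  assumes "w \<in> red I" "g \<in> carrier G" "h \<in> carrier G" "g \<noteq> \<one>"
  shows "smul i g (smul i h w) = (if g \<otimes> h = \<one> then w else smul i (g \<otimes> h) w)"
proof (cases w)
  case (Cons x w')
  obtain j k where x: "x = (j, k)" by force
  have k: "k \<in> carrier G" "k \<noteq> \<one>" "w' \<in> red I" "w' = [] \<or> fst (hd w') \<noteq> j"
    using assms(1) by (auto simp: Cons x red_Cons)
  show ?thesis
  proof (cases "i = j")
    case [simp]: True
    show ?thesis
    proof (cases "h \<otimes> k = \<one>")
      case True
      then have "g \<otimes> h \<otimes> k = g" using assms k by (simp add: m_assoc)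
      moreover have "smul i g w' = (i, g) # w'"
        using k by (cases w') auto
      moreover have "g = k" if "g \<otimes> h = \<one>"
        using that True assms k by (metis inv_equality inv_inv inv_comm)
      ultimately show ?thesis using True assms by (auto simp: Cons x)
    next
      case False
      then show ?thesis using assms k
        by (auto simp: Cons x m_assoc[symmetric])
    qed
  next
    case False
    then show ?thesis by (auto simp: Cons x)
  qed
qed simp

lemma map_smul:
  assumes "inj_on f I" "i \<in> I" "w \<in> red I"
  shows "map (apfst f) (smul i g w) = smul (f i) g (map (apfst f) w)"
proof (cases w)
  case (Cons x w')
  then show ?thesis
    using assms by (cases x) (auto simp: red_Cons inj_on_eq_iff)
qed simp

lemma wmul_red: "p \<in> red I \<Longrightarrow> q \<in> red I \<Longrightarrow> wmul p q \<in> red I"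
  by (induction p) (auto simp: red_Cons smul_red)

lemma map_wmul:
  assumes "inj_on f I" "p \<in> red I" "q \<in> red I"
  shows "map (apfst f) (wmul p q) = wmul (map (apfst f) p) (map (apfst f) q)"
  using assms(2)
proof (induction p)
  case (Cons x p)
  obtain i g where x: "x = (i, g)" by force
  have "map (apfst f) (smul i g (wmul p q)) = smul (f i) g (map (apfst f) (wmul p q))"
    using Cons assms by (intro map_smul[of f I]) (auto simp: x red_Cons wmul_red)
  then show ?case using Cons by (simp add: x red_Cons)
qed simp

lemma wmul_smul:
  assumes "p \<in> red I" "q \<in> red I" "g \<in> carrier G" "g \<noteq> \<one>"
  shows "wmul (smul i g p) q = smul i g (wmul p q)"
proof (cases p)
  case (Cons x p')
  obtain j h where x: "x = (j, h)" by force
  have "wmul p' q \<in> red I" "h \<in> carrier G"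
    using assms by (auto simp: Cons x red_Cons wmul_red)
  from smul_smul[OF this(1) assms(3) this(2) assms(4), of i] show ?thesis
    by (auto simp: Cons x)
qed simp

lemma wmul_eq_append: "p @ q \<in> red I \<Longrightarrow> wmul p q = p @ q"
proof (induction p)
  case (Cons x p)
  then show ?case
    by (cases x; cases "p @ q") (auto simp: red_Cons)
qed simp

lemma length_smul: "length (smul i g w) \<le> Suc (length w)"
  by (cases w) auto

lemma length_wmul: "length (wmul p q) \<le> length p + length q"
proof (induction p)
  case (Cons x p)
  then show ?case
    using length_smul[of "fst x" "snd x" "wmul p q"] by (cases x) auto
qed simp

text \<open>Only the end of \<open>p\<close> and the beginning of \<open>q\<close> interact:
  \<open>j\<close> syllables vanish from each, and at most one merged syllable replaces them. This
  allows syllables of long products to be compared by position.\<close>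

lemma wmul_cancel:
  assumes "p \<in> red I"
  shows "\<exists>j m. j \<le> length p \<and> j \<le> length q \<and> length m \<le> 1 \<and>
     wmul p q = take (length p - j) p @ m @ drop j q"
proof -
  \<comment> \<open>The stronger claim records the index of a merged syllable: it is that of the
    leftmost consumed syllable of \<open>p\<close>, whose left neighbour has another index and stops
    the cancellation.\<close>
  have "\<exists>j u. j \<le> length p \<and> j \<le> length q \<and> wmul p q = take (length p - j) p @ u \<and>
     (u = drop j q \<or> (0 < j \<and> (\<exists>g. u = (fst (p ! (length p - j)), g) # drop j q)))"
    using assms
  proof (induction p)
    case (Cons x p)
    obtain i g where x: "x = (i, g)" by force
    have p: "p \<in> red I" "p = [] \<or> fst (hd p) \<noteq> i" using Cons.prems by (auto simp: x red_Cons)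
    obtain j u where j: "j \<le> length p" "j \<le> length q" "wmul p q = take (length p - j) p @ u"
      "u = drop j q \<or> (0 < j \<and> (\<exists>g. u = (fst (p ! (length p - j)), g) # drop j q))"
      using Cons.IH[OF p(1)] by blast
    show ?case
    proof (cases "j < length p")
      case True
      then obtain y p' where p': "p = y # p'" by (cases p) auto
      have "take (length p - j) p = y # take (length p - j - 1) p'"
        using True by (simp add: p' take_Cons')
      then have "wmul (x # p) q = x # take (length p - j) p @ u"
        using j(3) p(2) by (cases y) (simp add: x p')
      moreover have "length (x # p) - j = Suc (length p - j)" using True by simp
      ultimately show ?thesis
        using j by (intro exI[of _ j] exI[of _ u]) auto
    next
      case False
      then have jp: "j = length p" using j by simp
      then have eq: "wmul (x # p) q = smul i g u" using j(3) by (simp add: x)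
      show ?thesis
      proof (cases "u = drop j q \<and> drop j q \<noteq> [] \<and> fst (hd (drop j q)) = i")
        case True
        then obtain h w where h: "drop j q = (i, h) # w"
          by (metis list.exhaust_sel prod.collapse)
        have w: "drop (Suc j) q = w" by (metis drop_Suc h list.sel(3) tl_drop)
        have "j < length q" using h by (metis drop_all list.distinct(1) not_le_imp_less)
        then show ?thesis using True h w jp eq
          by (intro exI[of _ "Suc j"] exI[of _ "smul i g u"]) (auto simp: x)
      next
        case False
        have "smul i g u = x # u"
        proof (cases u)
          case (Cons z u')
          have "fst z \<noteq> i"
          proof (cases "u = drop j q")
            case True
            then show ?thesis using False Cons by (metis list.distinct(1) list.sel(1))
          next
            case False
            then have "p \<noteq> []" "fst z = fst (hd p)"
              using j(4) jp Cons by (auto simp: hd_conv_nth)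
            then show ?thesis using p by auto
          qed
          then show ?thesis by (cases z) (simp add: Cons x)
        qed (simp add: x)
        then show ?thesis using j eq jp
          by (intro exI[of _ j] exI[of _ u]) auto
      qed
    qed
  qed auto
  then obtain j u where j: "j \<le> length p" "j \<le> length q" "wmul p q = take (length p - j) p @ u"
     "u = drop j q \<or> (0 < j \<and> (\<exists>g. u = (fst (p ! (length p - j)), g) # drop j q))"
    by blast
  from j(4) obtain m where "length m \<le> 1" "u = m @ drop j q"
    by (metis One_nat_def append_Cons append_Nil le_numeral_extra(4) length_Cons list.size(3) zero_le_one)
  then show ?thesis using j by blast
qed

end

section \<open>The action on reduced words\<close>

text \<open>Puts an action into the form that \<open>lift_exists\<close> takes as input; inverses in
  \<open>A\<close> give bijectivity.\<close>

lemma action_hom: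
  assumes "group A"
    and closed: "\<And>g q. g \<in> carrier A \<Longrightarrow> q \<in> S \<Longrightarrow> F g q \<in> S"
    and one: "\<And>q. q \<in> S \<Longrightarrow> F \<one>\<^bsub>A\<^esub> q = q"
    and mult: "\<And>g h q. g \<in> carrier A \<Longrightarrow> h \<in> carrier A \<Longrightarrow> q \<in> S \<Longrightarrow>
      F (g \<otimes>\<^bsub>A\<^esub> h) q = F g (F h q)"
  shows "(\<lambda>g. restrict (F g) S) \<in> hom A (BijGroup S)"
proof -
  interpret group A by fact
  have bij: "restrict (F g) S \<in> Bij S" if "g \<in> carrier A" for g
  proof -
    have "bij_betw (F g) S S"
      using closed one mult[of "inv\<^bsub>A\<^esub> g" g] mult[of g "inv\<^bsub>A\<^esub> g"] that
      by (intro bij_betw_byWitness[of _ "F (inv\<^bsub>A\<^esub> g)"]) auto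
    then show ?thesis by (simp add: Bij_def bij_betw_restrict_eq)
  qed
  show ?thesis
    by (rule homI) (auto simp: bij BijGroup_def compose_def closed mult)
qed

locale graph_of_groups_vertex = graph_of_groups V E G
  for V :: "'v set" and E :: "'v set set" and G :: "'v \<Rightarrow> ('g, 'b) monoid_scheme" +
  fixes s :: 'v
  assumes s_in_V: "s \<in> V"
begin

sublocale Gs: group "G s"
  by (rule vertex_group[OF s_in_V])

abbreviation "base \<equiv> sp (lk V E s)"
abbreviation "rt \<equiv> ret (V - {s})"

text \<open>The indices are the cosets of \<open>base\<close> in \<open>sp (V - {s})\<close>, as sets of elements of \<open>P\<close>. An
  element \<open>x\<close> of \<open>P\<close> acts on them through \<open>rt x\<close>.\<close>

definition idx :: "('v \<times> 'g) list set set set set" where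
  "idx = (\<lambda>a. a <#\<^bsub>P\<^esub> base) ` sp (V - {s})"

text \<open>Under \<open>elt\<close> this shift of indices becomes conjugation by \<open>a\<close>,
  see \<open>elt_sh\<close>.\<close>

definition sh :: "('v \<times> 'g) list set set \<Rightarrow> (('v \<times> 'g) list set set set \<times> 'g) list \<Rightarrow>
    (('v \<times> 'g) list set set set \<times> 'g) list" where
  "sh a = map (apfst (\<lambda>c. a <#\<^bsub>P\<^esub> c))"

lemma base_subset: "base \<subseteq> carrier P"
  by (auto dest: sp_closed)

lemma one_coset: "\<one>\<^bsub>P\<^esub> <#\<^bsub>P\<^esub> base = base"
  using base_subset by (rule P.lcos_mult_one)

lemma base_in_idx: "base \<in> idx"
  unfolding idx_def using one_coset by (metis imageI sp_one)

lemma idx_subset: "c \<in> idx \<Longrightarrow> c \<subseteq> carrier P"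
  unfolding idx_def using base_subset by (auto intro: P.l_coset_subset_G[THEN subsetD] dest: sp_closed)

lemma coset_one: "c \<in> idx \<Longrightarrow> \<one>\<^bsub>P\<^esub> <#\<^bsub>P\<^esub> c = c"
  by (simp add: P.lcos_mult_one idx_subset)

lemma coset_mult:
  "c \<in> idx \<Longrightarrow> a \<in> carrier P \<Longrightarrow> b \<in> carrier P \<Longrightarrow> (a \<cdot> b) <#\<^bsub>P\<^esub> c = a <#\<^bsub>P\<^esub> (b <#\<^bsub>P\<^esub> c)"
  using P.lcos_m_assoc[of c a b] idx_subset[of c] by simp

lemma coset_idx: "c \<in> idx \<Longrightarrow> a \<in> sp (V - {s}) \<Longrightarrow> a <#\<^bsub>P\<^esub> c \<in> idx"
  unfolding idx_def using base_subset
  by (auto simp: P.lcos_m_assoc sp_closed intro!: imageI sp_mult)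

lemma coset_inj: "a \<in> sp (V - {s}) \<Longrightarrow> inj_on (\<lambda>c. a <#\<^bsub>P\<^esub> c) idx"
proof (rule inj_on_inverseI)
  fix c assume "a \<in> sp (V - {s})" "c \<in> idx"
  then show "inv\<^bsub>P\<^esub> a <#\<^bsub>P\<^esub> (a <#\<^bsub>P\<^esub> c) = c"
    using coset_mult[of c "inv\<^bsub>P\<^esub> a" a] by (simp add: sp_closed coset_one)
qed

lemma in_coset: "a \<in> carrier P \<Longrightarrow> a \<in> a <#\<^bsub>P\<^esub> base"
  unfolding l_coset_def by (rule UN_I[of "\<one>\<^bsub>P\<^esub>"]) auto

lemma coset_fixE:
  assumes "c \<in> idx" "y \<in> carrier P" "y <#\<^bsub>P\<^esub> c = c"
  obtains a where "a \<in> carrier P" "P.conjg a y \<in> base"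
proof -
  obtain b where b: "b \<in> carrier P" "c = b <#\<^bsub>P\<^esub> base"
    using assms by (auto simp: idx_def dest: sp_closed)
  have "b \<in> c" using b in_coset by simp
  then have "y \<cdot> b \<in> y <#\<^bsub>P\<^esub> c" unfolding l_coset_def by blast
  then have "y \<cdot> b \<in> b <#\<^bsub>P\<^esub> base" using assms b by simp
  then obtain z where z: "z \<in> base" "y \<cdot> b = b \<cdot> z" unfolding l_coset_def by auto
  then have "P.conjg (inv\<^bsub>P\<^esub> b) y = z"
    using b assms by (simp add: P.conjg_def P.m_assoc sp_closed)
  then show ?thesis using that[of "inv\<^bsub>P\<^esub> b"] b z by simp
qed

text \<open>An element fixing an index is conjugate into \<open>base\<close>, which dies under a
  retraction onto vertices outside the link.\<close>

lemma coset_fix_ret: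
  assumes "c \<in> idx" "y \<in> carrier P" "y <#\<^bsub>P\<^esub> c = c" "W \<inter> lk V E s = {}"
  shows "ret W y = \<one>\<^bsub>P\<^esub>"
proof -
  obtain a where a: "a \<in> carrier P" "P.conjg a y \<in> base"
    using coset_fixE[OF assms(1-3)] by blast
  then have "ret W (P.conjg a y) = \<one>\<^bsub>P\<^esub>" using assms(4) by (simp add: ret_disjoint)
  then show ?thesis using a assms by (simp add: ret.hom_conjg)
qed

lemma sh_one: "q \<in> Gs.red idx \<Longrightarrow> sh \<one>\<^bsub>P\<^esub> q = q"
  unfolding sh_def by (rule map_idI) (auto simp: Gs.red_def coset_one subset_iff)

lemma sh_mult:
  "q \<in> Gs.red idx \<Longrightarrow> a \<in> carrier P \<Longrightarrow> b \<in> carrier P \<Longrightarrow> sh (a \<cdot> b) q = sh a (sh b q)"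
  unfolding sh_def by (auto simp: Gs.red_def coset_mult subset_iff)

lemma sh_red: "q \<in> Gs.red idx \<Longrightarrow> a \<in> sp (V - {s}) \<Longrightarrow> sh a q \<in> Gs.red idx"
  unfolding sh_def by (rule Gs.red_map[of _ idx]) (auto simp: coset_inj coset_idx)

lemma sh_simps [simp]: "sh a [] = []" "sh a ((c, g) # q) = (a <#\<^bsub>P\<^esub> c, g) # sh a q"
  "sh a (p @ q) = sh a p @ sh a q" "length (sh a q) = length q"
  by (simp_all add: sh_def)

lemma sh_wmul:
  "p \<in> Gs.red idx \<Longrightarrow> q \<in> Gs.red idx \<Longrightarrow> a \<in> sp (V - {s}) \<Longrightarrow>
     sh a (Gs.wmul p q) = Gs.wmul (sh a p) (sh a q)"
  unfolding sh_def by (rule Gs.map_wmul[OF coset_inj])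

lemma sh_smul:
  "q \<in> Gs.red idx \<Longrightarrow> c \<in> idx \<Longrightarrow> a \<in> sp (V - {s}) \<Longrightarrow>
     sh a (Gs.smul c g q) = Gs.smul (a <#\<^bsub>P\<^esub> c) g (sh a q)"
  unfolding sh_def by (rule Gs.map_smul[OF coset_inj])

lemma coset_base: "z \<in> base \<Longrightarrow> z <#\<^bsub>P\<^esub> base = base"
proof -
  assume z: "z \<in> base"
  have "subgroup base P"
    by (rule P.subgroupI) (auto simp: sp_closed sp_mult sp_inv intro: sp_one)
  then show ?thesis using z by (simp add: P.coset_join3 sp_closed)
qed

section \<open>Gluing the letters to an action of the graph product\<close>

definition letter_act :: "'v \<Rightarrow> 'g \<Rightarrow> (('v \<times> 'g) list set set set \<times> 'g) list \<Rightarrow>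
    (('v \<times> 'g) list set set set \<times> 'g) list" where
  "letter_act v g q = (if v = s then if g = \<one>\<^bsub>G s\<^esub> then q else Gs.smul base g q else sh (emb v g) q)"

lemma letter_act_closed:
  "v \<in> V \<Longrightarrow> g \<in> carrier (G v) \<Longrightarrow> q \<in> Gs.red idx \<Longrightarrow> letter_act v g q \<in> Gs.red idx"
  by (auto simp: letter_act_def Gs.smul_red base_in_idx sh_red sp_emb)

lemma letter_act_hom:
  assumes "v \<in> V"
  shows "(\<lambda>g. restrict (letter_act v g) (Gs.red idx)) \<in> hom (G v) (BijGroup (Gs.red idx))"
proof (rule action_hom)
  show "group (G v)" by (rule vertex_group) fact
  show "letter_act v g q \<in> Gs.red idx" if "g \<in> carrier (G v)" "q \<in> Gs.red idx" for g q
    using that assms letter_act_closed by simp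
  show "letter_act v \<one>\<^bsub>G v\<^esub> q = q" if "q \<in> Gs.red idx" for q
    using that assms by (simp add: letter_act_def emb_one sh_one)
  show "letter_act v (g \<otimes>\<^bsub>G v\<^esub> h) q = letter_act v g (letter_act v h q)"
    if "g \<in> carrier (G v)" "h \<in> carrier (G v)" "q \<in> Gs.red idx" for g h q
    using that assms by (auto simp: letter_act_def emb_mult sh_mult Gs.smul_smul)
qed

text \<open>The case with content is an edge at \<open>s\<close>: its other end lies in the link, so
  letters there fix \<open>base\<close>, and the shift commutes with multiplication by a syllable at
  \<open>base\<close>.\<close>

lemma letter_act_commute:
  assumes "{v, w} \<in> E" "g \<in> carrier (G v)" "h \<in> carrier (G w)" "q \<in> Gs.red idx"
  shows "letter_act v g (letter_act w h q) = letter_act w h (letter_act v g q)"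
proof -
  have vw: "v \<in> V" "w \<in> V" "v \<noteq> w" using edge_in_V[OF assms(1)] by auto
  have star: "sh (emb u k) (Gs.smul base l p) = Gs.smul base l (sh (emb u k) p)"
    if "{s, u} \<in> E" "k \<in> carrier (G u)" "p \<in> Gs.red idx" for u k l p
  proof -
    have "u \<in> V" "u \<noteq> s" using edge_in_V[OF that(1)] by auto
    then show ?thesis
      using that sh_smul[OF that(3) base_in_idx, of "emb u k" l]
      by (simp add: coset_base sp_emb lk_iff)
  qed
  show ?thesis
  proof (cases "v = s \<or> w = s")
    case True
    then show ?thesis using vw assms star[of w h q g] star[of v g q h]
      by (auto simp: letter_act_def insert_commute)
  next
    case False
    then show ?thesis using vw assms emb_commute[OF assms(1-3)]
      by (simp add: letter_act_def sh_mult[symmetric])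
  qed
qed

definition act :: "('v \<times> 'g) list set set \<Rightarrow> (('v \<times> 'g) list set set set \<times> 'g) list \<Rightarrow>
    (('v \<times> 'g) list set set set \<times> 'g) list" where
  "act = (SOME F. F \<in> hom P (BijGroup (Gs.red idx)) \<and>
     (\<forall>v\<in>V. \<forall>g\<in>carrier (G v). F (emb v g) = restrict (letter_act v g) (Gs.red idx)))"

lemma act_spec:
  "act \<in> hom P (BijGroup (Gs.red idx)) \<and>
     (\<forall>v\<in>V. \<forall>g\<in>carrier (G v). act (emb v g) = restrict (letter_act v g) (Gs.red idx))"
proof -
  let ?X = "Gs.red idx"
  have "\<exists>F\<in>hom P (BijGroup ?X). \<forall>v\<in>V. \<forall>g\<in>carrier (G v). F (emb v g) = restrict (letter_act v g) ?X"
  proof (rule lift_exists[OF group_BijGroup])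
    show "(\<lambda>g. restrict (letter_act v g) ?X) \<in> hom (G v) (BijGroup ?X)" if "v \<in> V" for v
      using letter_act_hom[OF that] .
    show "restrict (letter_act v g) ?X \<otimes>\<^bsub>BijGroup ?X\<^esub> restrict (letter_act w h) ?X =
        restrict (letter_act w h) ?X \<otimes>\<^bsub>BijGroup ?X\<^esub> restrict (letter_act v g) ?X"
      if *: "{v, w} \<in> E" "g \<in> carrier (G v)" "h \<in> carrier (G w)" for v w g h
    proof -
      have vw: "v \<in> V" "w \<in> V" using edge_in_V[OF *(1)] by auto
      have "restrict (letter_act v g) ?X \<in> Bij ?X" "restrict (letter_act w h) ?X \<in> Bij ?X"
        using hom_in_carrier[OF letter_act_hom[OF vw(1)] *(2)]
          hom_in_carrier[OF letter_act_hom[OF vw(2)] *(3)] by (simp_all add: BijGroup_def)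
      then show ?thesis
        using vw * by (auto simp: BijGroup_def compose_def letter_act_closed
            intro!: restrict_ext letter_act_commute)
    qed
  qed
  then have "\<exists>F. F \<in> hom P (BijGroup ?X) \<and>
      (\<forall>v\<in>V. \<forall>g\<in>carrier (G v). F (emb v g) = restrict (letter_act v g) ?X)"
    by blast
  then show ?thesis unfolding act_def by (rule someI_ex)
qed

lemma act_Bij: "x \<in> carrier P \<Longrightarrow> act x \<in> Bij (Gs.red idx)"
  using hom_in_carrier[of act P "BijGroup (Gs.red idx)" x] act_spec by (simp add: BijGroup_def)

lemma act_closed: "x \<in> carrier P \<Longrightarrow> q \<in> Gs.red idx \<Longrightarrow> act x q \<in> Gs.red idx"
  using Bij_imp_funcset[OF act_Bij, of x] by auto

lemma act_emb:
  "v \<in> V \<Longrightarrow> g \<in> carrier (G v) \<Longrightarrow> q \<in> Gs.red idx \<Longrightarrow> act (emb v g) q = letter_act v g q"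
  using act_spec by simp

lemma act_one: "q \<in> Gs.red idx \<Longrightarrow> act \<one>\<^bsub>P\<^esub> q = q"
proof -
  have "act \<one>\<^bsub>P\<^esub> = \<one>\<^bsub>BijGroup (Gs.red idx)\<^esub>"
    using act_spec by (intro hom_one[OF _ P.is_group group_BijGroup]) blast
  then show "q \<in> Gs.red idx \<Longrightarrow> ?thesis" by (simp add: BijGroup_def)
qed

lemma act_mult:
  assumes "x \<in> carrier P" "y \<in> carrier P" "q \<in> Gs.red idx"
  shows "act (x \<cdot> y) q = act x (act y q)"
proof -
  have "act (x \<cdot> y) = act x \<otimes>\<^bsub>BijGroup (Gs.red idx)\<^esub> act y"
    using act_spec assms by (simp add: hom_def)
  then show ?thesis using assms by (simp add: BijGroup_def act_Bij compose_def)
qed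

lemma act_sp:
  assumes "a \<in> sp (V - {s})" "q \<in> Gs.red idx"
  shows "act a q = sh a q"
  using assms(1)
proof (induction rule: sp_induct)
  case (mult v g x)
  then show ?case using assms
    by (simp add: act_mult sp_closed act_emb sh_red letter_act_def sh_mult)
qed (use assms in \<open>simp add: act_one sh_one\<close>)

section \<open>Normal forms for the kernel of the retraction away from s\<close>

definition nu :: "('v \<times> 'g) list set set \<Rightarrow> (('v \<times> 'g) list set set set \<times> 'g) list" where
  "nu x = act x []"

lemma nu_red [simp]: "x \<in> carrier P \<Longrightarrow> nu x \<in> Gs.red idx"
  by (simp add: nu_def act_closed)

lemma nu_sp: "a \<in> sp (V - {s}) \<Longrightarrow> nu a = []"
  by (simp add: nu_def act_sp)

text \<open>By induction over letters: those of \<open>G s\<close> change only the kernel part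
  \<open>nu x\<close>, the others shift it and change \<open>rt x\<close>. So \<open>P\<close> acts
  as a semidirect product.\<close>

lemma act_eq:
  assumes "x \<in> carrier P" "q \<in> Gs.red idx"
  shows "act x q = Gs.wmul (nu x) (sh (rt x) q)"
  using assms(1)
proof (induction rule: P_induct)
  case one
  then show ?case using assms by (simp add: act_one nu_def sh_one)
next
  case (mult v g x)
  have rt: "rt x \<in> sp (V - {s})" using mult by (simp add: ret_sp)
  have q: "sh (rt x) q \<in> Gs.red idx" using assms rt by (simp add: sh_red)
  show ?case
  proof (cases "v = s")
    case True
    have "nu (emb v g \<cdot> x) = letter_act s g (nu x)"
      using mult True by (simp add: nu_def act_mult act_emb act_closed)
    moreover have "act (emb v g \<cdot> x) q = letter_act s g (act x q)"
      using mult(1-3) True assms by (simp add: act_mult act_emb act_closed)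
    moreover have "rt (emb v g \<cdot> x) = rt x"
      using mult True by (simp add: ret_emb)
    ultimately show ?thesis
      using mult True q by (simp add: letter_act_def Gs.wmul_smul[where I = idx])
  next
    case False
    have e: "emb v g \<in> sp (V - {s})" using mult False by (simp add: sp_emb)
    have "nu (emb v g \<cdot> x) = sh (emb v g) (nu x)"
      using mult e by (simp add: nu_def act_mult act_sp act_closed)
    moreover have "act (emb v g \<cdot> x) q = sh (emb v g) (act x q)"
      using mult(1-3) e assms by (simp add: act_mult act_sp act_closed)
    moreover have "sh (rt (emb v g \<cdot> x)) q = sh (emb v g) (sh (rt x) q)"
      using mult False assms by (simp add: ret_emb sh_mult)
    ultimately show ?thesis
      using mult q e by (simp add: sh_wmul)
  qed
qed

lemma nu_mult: "x \<in> carrier P \<Longrightarrow> y \<in> carrier P \<Longrightarrow> nu (x \<cdot> y) = Gs.wmul (nu x) (sh (rt x) (nu y))"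
  using act_mult[of x y "[]"] act_eq[of x "nu y"] by (simp add: nu_def act_closed)

lemma nu_emb: "g \<in> carrier (G s) \<Longrightarrow> g \<noteq> \<one>\<^bsub>G s\<^esub> \<Longrightarrow> nu (emb s g) = [(base, g)]"
  by (simp add: nu_def act_emb s_in_V letter_act_def)

text \<open>A syllable \<open>(c, g)\<close> stands for the conjugate of \<open>g\<close> by an
  element of the coset \<open>c\<close>; by \<open>conjg_rep\<close> it does not matter
  which.\<close>

definition elt :: "(('v \<times> 'g) list set set set \<times> 'g) list \<Rightarrow> ('v \<times> 'g) list set set" where
  "elt w = foldr (\<lambda>(c, g) y. P.conjg (SOME a. a \<in> c) (emb s g) \<cdot> y) w \<one>\<^bsub>P\<^esub>"

text \<open>Two representatives differ by an element of \<open>base\<close> on the right, and it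
  commutes with \<open>G s\<close>.\<close>

lemma conjg_rep:
  assumes "a \<in> carrier P" "g \<in> carrier (G s)"
  shows "P.conjg (SOME b. b \<in> a <#\<^bsub>P\<^esub> base) (emb s g) = P.conjg a (emb s g)"
proof -
  have "(SOME b. b \<in> a <#\<^bsub>P\<^esub> base) \<in> a <#\<^bsub>P\<^esub> base"
    by (rule someI) (rule in_coset[OF assms(1)])
  then obtain z where z: "z \<in> base" "(SOME b. b \<in> a <#\<^bsub>P\<^esub> base) = a \<cdot> z"
    unfolding l_coset_def by auto
  then show ?thesis
    using assms s_in_V by (simp add: P.conjg_conjg[symmetric] sp_closed conjg_emb_lk)
qed

lemma elt_simps:
  "elt [] = \<one>\<^bsub>P\<^esub>"
  "a \<in> carrier P \<Longrightarrow> g \<in> carrier (G s) \<Longrightarrow>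
     elt ((a <#\<^bsub>P\<^esub> base, g) # w) = P.conjg a (emb s g) \<cdot> elt w"
  by (simp_all add: elt_def conjg_rep)

lemma elt_base: "g \<in> carrier (G s) \<Longrightarrow> elt ((base, g) # w) = emb s g \<cdot> elt w"
  using elt_simps(2)[of "\<one>\<^bsub>P\<^esub>" g w] by (simp add: one_coset s_in_V)

lemma red_ConsE:
  assumes "x # w \<in> Gs.red idx"
  obtains a g where "a \<in> sp (V - {s})" "g \<in> carrier (G s)" "g \<noteq> \<one>\<^bsub>G s\<^esub>"
    "w \<in> Gs.red idx" "x = (a <#\<^bsub>P\<^esub> base, g)"
proof -
  obtain c g where x: "x = (c, g)" by force
  have "c \<in> idx" "g \<in> carrier (G s)" "g \<noteq> \<one>\<^bsub>G s\<^esub>" "w \<in> Gs.red idx"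
    using assms by (auto simp: x Gs.red_Cons)
  moreover from this obtain a where "a \<in> sp (V - {s})" "c = a <#\<^bsub>P\<^esub> base"
    by (auto simp: idx_def)
  ultimately show thesis using that x by blast
qed

lemma elt_closed: "w \<in> Gs.red idx \<Longrightarrow> elt w \<in> carrier P"
proof (induction w)
  case (Cons x w)
  then obtain a g where "a \<in> sp (V - {s})" "g \<in> carrier (G s)" "w \<in> Gs.red idx" "x = (a <#\<^bsub>P\<^esub> base, g)"
    by (elim red_ConsE)
  with Cons show ?case by (simp add: elt_simps sp_closed s_in_V)
qed (simp add: elt_simps)

lemma elt_sh:
  assumes "b \<in> carrier P"
  shows "w \<in> Gs.red idx \<Longrightarrow> elt (sh b w) = P.conjg b (elt w)"
proof (induction w)
  case (Cons x w)
  then obtain a g where *: "a \<in> sp (V - {s})" "g \<in> carrier (G s)" "w \<in> Gs.red idx" "x = (a <#\<^bsub>P\<^esub> base, g)"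
    by (elim red_ConsE)
  have "b <#\<^bsub>P\<^esub> (a <#\<^bsub>P\<^esub> base) = (b \<cdot> a) <#\<^bsub>P\<^esub> base"
    using coset_mult[OF base_in_idx assms, of a] * by (simp add: sp_closed)
  with * Cons assms show ?case
    by (simp add: elt_simps sp_closed s_in_V P.conjg_mult P.conjg_conjg elt_closed)
qed (use assms in \<open>simp add: elt_simps\<close>)

lemma elt_smul_base:
  assumes "w \<in> Gs.red idx" "g \<in> carrier (G s)"
  shows "elt (Gs.smul base g w) = emb s g \<cdot> elt w"
proof (cases w)
  case (Cons x w')
  obtain c h where x: "x = (c, h)" by force
  have h: "h \<in> carrier (G s)" "w' \<in> Gs.red idx" using assms by (auto simp: Cons x Gs.red_Cons)
  have inverse: "emb s g \<cdot> (emb s h \<cdot> elt w') = elt w'" if "g \<otimes>\<^bsub>G s\<^esub> h = \<one>\<^bsub>G s\<^esub>"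
  proof -
    have "emb s g \<cdot> emb s h = \<one>\<^bsub>P\<^esub>"
      using emb_mult[OF s_in_V assms(2) h(1)] that s_in_V by (simp add: emb_one)
    then show ?thesis
      using P.m_assoc[of "emb s g" "emb s h" "elt w'"] h assms elt_closed[OF h(2)] s_in_V by simp
  qed
  show ?thesis
    using assms h elt_closed[OF h(2)]
    by (auto simp: Cons x elt_base emb_mult s_in_V P.m_assoc inverse)
qed (use assms in \<open>simp add: elt_base elt_simps s_in_V\<close>)

text \<open>Splits \<open>x\<close> into a factor in the kernel of \<open>rt\<close>, which the word
  \<open>nu x\<close> determines, and a factor in \<open>sp (V - {s})\<close>.\<close>

lemma elt_nu: "x \<in> carrier P \<Longrightarrow> x = elt (nu x) \<cdot> rt x"
proof (induction rule: P_induct)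
  case one
  then show ?case by (simp add: nu_sp elt_simps)
next
  case (mult v g x)
  note closed = elt_closed[OF nu_red[OF mult(3)]]
  show ?case
  proof (cases "v = s")
    case True
    have "elt (nu (emb s g \<cdot> x)) = emb s g \<cdot> elt (nu x)"
      using mult True closed
      by (simp add: nu_def act_mult act_emb letter_act_def emb_one elt_smul_base act_closed s_in_V)
    moreover have "rt (emb v g \<cdot> x) = rt x" using mult True by (simp add: ret_emb)
    ultimately show ?thesis using mult True closed by (simp add: P.m_assoc s_in_V)
  next
    case False
    have e: "emb v g \<in> sp (V - {s})" using mult False by (simp add: sp_emb)
    have "elt (nu (emb v g \<cdot> x)) = P.conjg (emb v g) (elt (nu x))"
      using mult e by (simp add: nu_def act_mult act_sp act_closed elt_sh)
    then have "elt (nu (emb v g \<cdot> x)) \<cdot> rt (emb v g \<cdot> x) = emb v g \<cdot> (elt (nu x) \<cdot> rt x)"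
      using mult(1-3) False closed by (simp add: ret_emb P.conjg_def P.m_assoc)
    also have "\<dots> = emb v g \<cdot> x"
      using mult(4) by simp
    finally show ?thesis by simp
  qed
qed

lemma nu_NilD: "x \<in> carrier P \<Longrightarrow> nu x = [] \<Longrightarrow> x \<in> sp (V - {s})"
  using elt_nu[of x] ret_sp[of x "V - {s}"] by (simp add: elt_simps)

end

section \<open>Centralizers and conjugates of special subgroups\<close>

context graph_of_groups_vertex
begin

lemma base_fixD:
  assumes "a \<in> carrier P" "a <#\<^bsub>P\<^esub> base = base"
  shows "a \<in> base"
  using in_coset[OF assms(1)] assms(2) by simp

lemma sp_lk_subset_st: "sp (lk V E v) \<subseteq> sp (st V E v)"
  by (rule sp_mono) (auto simp: st_def)

text \<open>Multiplying by \<open>emb s g\<close> on the left alters the beginning of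
  \<open>nu x\<close>, on the right its end. The results agree only if \<open>nu x\<close> has at
  most one syllable, at \<open>base\<close>, and \<open>rt x\<close> fixes \<open>base\<close>; then
  both factors of \<open>x\<close> lie in \<open>sp (st V E s)\<close>.\<close>

lemma centralizer_emb:
  assumes x: "x \<in> carrier P" and g: "g \<in> carrier (G s)" "g \<noteq> \<one>\<^bsub>G s\<^esub>"
    and comm: "x \<cdot> emb s g = emb s g \<cdot> x"
  shows "x \<in> sp (st V E s)"
proof -
  define c where "c = rt x <#\<^bsub>P\<^esub> base"
  have c: "c \<in> idx" using x by (simp add: c_def coset_idx base_in_idx ret_sp)
  have rt: "rt x \<in> base" if "c = base"
    using base_fixD[of "rt x"] that x by (simp add: c_def)
  have "nu (emb s g \<cdot> x) = Gs.smul base g (nu x)"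
    using x g by (simp add: nu_def act_mult act_emb letter_act_def act_closed s_in_V)
  moreover have "nu (x \<cdot> emb s g) = Gs.wmul (nu x) [(c, g)]"
    using x g by (simp add: nu_mult nu_emb s_in_V c_def)
  ultimately have eq: "Gs.smul base g (nu x) = Gs.wmul (nu x) [(c, g)]"
    using comm by simp
  show ?thesis
  proof (cases "nu x" rule: rev_cases)
    case Nil
    then have "c = base" using eq by simp
    moreover have "x = rt x" using nu_NilD[OF x Nil] by (simp add: sp_ret)
    ultimately show ?thesis using rt sp_lk_subset_st by auto
  next
    case (snoc p y)
    obtain d h where y: "y = (d, h)" by force
    have red: "p @ [(d, h)] \<in> Gs.red idx" using nu_red[OF x] by (simp add: snoc y)
    then have h: "h \<in> carrier (G s)" "h \<noteq> \<one>\<^bsub>G s\<^esub>" by (auto simp: Gs.red_append Gs.red_Cons)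
    show ?thesis
    proof (cases "d = c")
      \<comment> \<open>The right side grows by a syllable at the end, so the left side has to grow
        at the front; comparing first syllables gives \<open>base = e\<close>, which was just
        refuted.\<close>
      case False
      then have "p @ [(d, h)] @ [(c, g)] \<in> Gs.red idx"
        using red c g by (auto simp: Gs.red_append Gs.red_Cons)
      then have "Gs.smul base g (nu x) = nu x @ [(c, g)]"
        using Gs.wmul_eq_append[of "nu x" "[(c, g)]"] eq by (simp add: snoc y)
      moreover obtain e k q where "nu x = (e, k) # q"
        using snoc by (metis list.exhaust prod.exhaust snoc_eq_iff_butlast)
      ultimately have *: "Gs.smul base g ((e, k) # q) = (e, k) # q @ [(c, g)]" by simp
      have "base \<noteq> e"
      proof
        assume "base = e"
        then show False using arg_cong[OF *, of length] by (auto split: if_splits)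
      qed
      with * show ?thesis by simp
    next
      case True
      define v where "v = Gs.smul c h [(c, g)]"
      have v: "v = (if h \<otimes>\<^bsub>G s\<^esub> g = \<one>\<^bsub>G s\<^esub> then [] else [(c, h \<otimes>\<^bsub>G s\<^esub> g)])"
        by (simp add: v_def)
      have pv: "p @ v \<in> Gs.red idx"
        using red g h c by (auto simp: v True Gs.red_append Gs.red_Cons)
      then have eq': "Gs.smul base g (p @ [(c, h)]) = p @ v"
        using eq Gs.wmul_eq_append[OF pv] by (simp add: snoc y True Gs.wmul_append v_def)
      show ?thesis
      proof (cases p)
        case Nil
        have "c = base"
        proof (rule ccontr)
          assume "c \<noteq> base"
          then have "length (Gs.smul base g (p @ [(c, h)])) = 2" by (simp add: Nil)
          moreover have "length (p @ v) \<le> 1" by (simp add: Nil v)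
          ultimately show False using eq' by simp
        qed
        then have "x = emb s h \<cdot> rt x"
          using elt_nu[OF x] h by (simp add: snoc y Nil True elt_base elt_simps s_in_V)
        moreover have "emb s h \<in> sp (st V E s)" "rt x \<in> sp (st V E s)"
          using h rt[OF \<open>c = base\<close>] sp_lk_subset_st s_in_V by (auto simp: sp_emb st_def)
        ultimately show ?thesis by (metis sp_mult)
      next
        \<comment> \<open>The right side still begins with \<open>z\<close>, whereas multiplication
          by \<open>g\<close> on the left changes, removes or pushes back the first
          syllable.\<close>
        case (Cons z p')
        obtain e k where z: "z = (e, k)" by force
        have k: "k \<in> carrier (G s)" using red by (auto simp: Cons z Gs.red_Cons)
        have "g \<otimes>\<^bsub>G s\<^esub> k \<noteq> k" using g k by simp
        then have False
          using eq' red g by (auto simp: Cons z True Gs.red_Cons split: if_splits)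
        then show ?thesis ..
      qed
    qed
  qed
qed

section \<open>Cyclically reduced elements and their axes\<close>

text \<open>Conjugation carries the first syllable to the end, where \<open>rt x\<close> has shifted
  its index onto that of the last syllable, and the two merge. A single syllable would not get
  shorter; it is excluded by the trivial projection to \<open>G s\<close>.\<close>

lemma shorten_conjugate:
  assumes x: "x \<in> carrier P" and n: "nu x \<noteq> []" and "ret {s} x = \<one>\<^bsub>P\<^esub>"
    and last: "fst (last (nu x)) = rt x <#\<^bsub>P\<^esub> fst (hd (nu x))"
  shows "\<exists>z\<in>carrier P. length (nu (P.conjg z x)) < length (nu x)"
proof -
  obtain y n' where nu_x: "nu x = y # n'" using n by (cases "nu x") auto
  have "y # n' \<in> Gs.red idx" using nu_red[OF x] by (simp add: nu_x)
  then obtain b g where b: "b \<in> sp (V - {s})" "g \<in> carrier (G s)" "g \<noteq> \<one>\<^bsub>G s\<^esub>"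
    "n' \<in> Gs.red idx" "y = (b <#\<^bsub>P\<^esub> base, g)" by (rule red_ConsE)
  have bP: "b \<in> carrier P" using b by (simp add: sp_closed)
  define i where "i = b <#\<^bsub>P\<^esub> base"
  define z where "z = P.conjg b (emb s g)"
  have i: "i \<in> idx" using b by (simp add: i_def coset_idx base_in_idx)
  have zP: "z \<in> carrier P" using b bP s_in_V by (simp add: z_def)
  have rtz: "rt z = \<one>\<^bsub>P\<^esub>"
    using b bP s_in_V by (simp add: z_def ret.hom_conjg ret_emb)
  \<comment> \<open>Moving \<open>i\<close> to \<open>base\<close>, multiplying there and moving
    back is multiplication at the index \<open>i\<close>.\<close>
  have act_conj: "act (P.conjg b (emb s h)) q = Gs.smul i h q"
    if "h \<in> carrier (G s)" "h \<noteq> \<one>\<^bsub>G s\<^esub>" "q \<in> Gs.red idx" for h q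
  proof -
    have q: "sh (inv\<^bsub>P\<^esub> b) q \<in> Gs.red idx" using that b by (simp add: sh_red sp_inv)
    have "act (P.conjg b (emb s h)) q = sh b (Gs.smul base h (sh (inv\<^bsub>P\<^esub> b) q))"
      using that b bP q s_in_V
      by (simp add: P.conjg_def act_mult act_sp sp_inv act_emb letter_act_def Gs.smul_red base_in_idx)
    also have "\<dots> = Gs.smul i h q"
      using that b bP q sh_mult[of q b "inv\<^bsub>P\<^esub> b"] by (simp add: sh_smul base_in_idx i_def sh_one)
    finally show ?thesis .
  qed
  have nuz: "nu z = [(i, g)]" using b by (simp add: nu_def z_def act_conj)
  have ai: "rt x <#\<^bsub>P\<^esub> i \<in> idx" using i x by (simp add: coset_idx ret_sp)
  have nu_xz: "nu (x \<cdot> z) = Gs.smul i g (Gs.wmul n' [(rt x <#\<^bsub>P\<^esub> i, g)])"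
    using x zP b by (simp add: nu_mult nuz nu_x i_def)
  have w: "Gs.wmul n' [(rt x <#\<^bsub>P\<^esub> i, g)] \<in> Gs.red idx"
    using b ai by (intro Gs.wmul_red) (auto simp: Gs.red_Cons)
  have "inv\<^bsub>P\<^esub> z = P.conjg b (emb s (inv\<^bsub>G s\<^esub> g))"
    using b bP s_in_V by (simp add: z_def P.conjg_def P.inv_mult_group emb_inv P.m_assoc)
  then have "act (inv\<^bsub>P\<^esub> z) (nu (x \<cdot> z)) = Gs.smul i (inv\<^bsub>G s\<^esub> g) (nu (x \<cdot> z))"
    using zP x b by (simp add: act_conj)
  moreover have "nu (P.conjg (inv\<^bsub>P\<^esub> z) x) = act (inv\<^bsub>P\<^esub> z) (nu (x \<cdot> z))"
    using zP x by (simp add: P.conjg_def P.m_assoc nu_def act_mult)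
  ultimately have "nu (P.conjg (inv\<^bsub>P\<^esub> z) x) = Gs.smul i (inv\<^bsub>G s\<^esub> g) (nu (x \<cdot> z))"
    by simp
  also have "\<dots> = Gs.wmul n' [(rt x <#\<^bsub>P\<^esub> i, g)]"
    using b w by (simp add: nu_xz Gs.smul_smul[where I = idx])
  finally have eq: "nu (P.conjg (inv\<^bsub>P\<^esub> z) x) = Gs.wmul n' [(rt x <#\<^bsub>P\<^esub> i, g)]" .
  have "length (Gs.wmul n' [(rt x <#\<^bsub>P\<^esub> i, g)]) < length (nu x)"
  proof (cases n' rule: rev_cases)
    case Nil
    have "x = z \<cdot> rt x"
      using elt_nu[OF x] b bP s_in_V by (simp add: nu_x Nil elt_simps z_def)
    moreover have "ret {s} (rt x) = \<one>\<^bsub>P\<^esub>"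
      using ret_sp[OF x] by (rule ret_disjoint) auto
    ultimately have "ret {s} z = \<one>\<^bsub>P\<^esub>"
      using assms(3) x zP by (metis P.r_one ret.hom_closed ret.hom_mult)
    then have "emb s g = \<one>\<^bsub>P\<^esub>"
      using b bP s_in_V by (simp add: z_def ret.hom_conjg ret_emb)
    then show ?thesis using b s_in_V by (simp add: emb_eq_one_iff)
  next
    case (snoc n'' e)
    have "fst e = rt x <#\<^bsub>P\<^esub> i" using last b by (simp add: nu_x snoc i_def)
    then have "length (Gs.smul (fst e) (snd e) [(rt x <#\<^bsub>P\<^esub> i, g)]) \<le> 1" by simp
    then show ?thesis
      using Gs.length_wmul[of n'' "Gs.smul (fst e) (snd e) [(rt x <#\<^bsub>P\<^esub> i, g)]"]
      by (cases e) (simp add: nu_x snoc Gs.wmul_append)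
  qed
  then show ?thesis using eq zP by (intro bexI[of _ "inv\<^bsub>P\<^esub> z"]) auto
qed

text \<open>The analogue of a hyperbolic element: the last syllable of \<open>nu x\<close> does not
  merge with the first one of the next copy, which is shifted by \<open>rt x\<close>, so powers
  concatenate.\<close>

definition cyc_red :: "('v \<times> 'g) list set set \<Rightarrow> bool" where
  "cyc_red x \<longleftrightarrow> x \<in> carrier P \<and> nu x \<noteq> [] \<and> fst (last (nu x)) \<noteq> rt x <#\<^bsub>P\<^esub> fst (hd (nu x))"

text \<open>A conjugate with shortest \<open>nu\<close> is either cyclically reduced or has empty
  \<open>nu\<close>, by \<open>shorten_conjugate\<close>.\<close>

lemma cyc_red_exists:
  assumes x: "x \<in> carrier P" "ret {s} x = \<one>\<^bsub>P\<^esub>"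
  shows "\<exists>z\<in>carrier P. P.conjg z x \<in> sp (V - {s}) \<or> cyc_red (P.conjg z x)"
proof -
  obtain z where z: "z \<in> carrier P"
    "\<And>y. y \<in> carrier P \<Longrightarrow> length (nu (P.conjg z x)) \<le> length (nu (P.conjg y x))"
    using arg_min_nat_lemma[of "\<lambda>y. y \<in> carrier P" "\<one>\<^bsub>P\<^esub>" "\<lambda>y. length (nu (P.conjg y x))"] by auto
  let ?x = "P.conjg z x"
  have xc: "?x \<in> carrier P" "ret {s} ?x = \<one>\<^bsub>P\<^esub>" using x z by (simp_all add: ret.hom_conjg)
  have "\<not> (\<exists>y\<in>carrier P. length (nu (P.conjg y ?x)) < length (nu ?x))"
    using z x by (auto simp: P.conjg_conjg not_less)
  then have "nu ?x = [] \<or> cyc_red ?x"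
    using shorten_conjugate[OF xc(1) _ xc(2)] xc by (auto simp: cyc_red_def)
  then show ?thesis using z nu_NilD[OF xc(1)] by blast
qed

lemma nu_pow_Suc:
  assumes "cyc_red x"
  shows "nu (x [^]\<^bsub>P\<^esub> (N::nat) \<cdot> x) = nu x @ sh (rt x) (nu (x [^]\<^bsub>P\<^esub> N))"
proof -
  have x: "x \<in> carrier P" using assms by (simp add: cyc_red_def)
  \<comment> \<open>Reducedness turns \<open>Gs.wmul\<close> into concatenation; the equation for
    \<open>N\<close> shows that the shifted word begins with the shifted first syllable of
    \<open>nu x\<close>.\<close>
  have *: "nu x @ sh (rt x) (nu (x [^]\<^bsub>P\<^esub> N)) \<in> Gs.red idx \<and>
      nu (x [^]\<^bsub>P\<^esub> Suc N) = nu x @ sh (rt x) (nu (x [^]\<^bsub>P\<^esub> N))" for N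
  proof (induction N)
    case 0
    then show ?case using x by (simp add: nu_sp)
  next
    case (Suc N)
    let ?w = "sh (rt x) (nu (x [^]\<^bsub>P\<^esub> Suc N))"
    have w: "?w \<in> Gs.red idx" using x by (intro sh_red ret_sp nu_red) auto
    have "hd ?w = hd (sh (rt x) (nu x))" "?w \<noteq> []"
      using Suc assms by (auto simp: cyc_red_def sh_def hd_append)
    moreover have "fst (hd (sh (rt x) (nu x))) = rt x <#\<^bsub>P\<^esub> fst (hd (nu x))"
      using assms by (simp add: cyc_red_def sh_def hd_map)
    ultimately have red: "nu x @ ?w \<in> Gs.red idx"
      using w x assms by (simp add: Gs.red_append cyc_red_def)
    have "nu (x [^]\<^bsub>P\<^esub> Suc (Suc N)) = Gs.wmul (nu x) ?w"
      unfolding P.nat_pow_Suc2[OF x, of "Suc N"] using x by (intro nu_mult) auto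
    then show ?case using red by (simp add: Gs.wmul_eq_append)
  qed
  then show ?thesis by simp
qed

lemma length_nu_pow: "cyc_red x \<Longrightarrow> length (nu (x [^]\<^bsub>P\<^esub> (N::nat))) = N * length (nu x)"
proof (induction N)
  case 0
  then show ?case by (simp add: nu_sp)
qed (simp add: nu_pow_Suc)

lemma cyc_red_pow_neq_one: "cyc_red x \<Longrightarrow> N > 0 \<Longrightarrow> x [^]\<^bsub>P\<^esub> (N::nat) \<noteq> \<one>\<^bsub>P\<^esub>"
  using length_nu_pow[of x N] by (auto simp: nu_sp cyc_red_def)

text \<open>The indices of the syllables of \<open>x [^] N\<close> for large \<open>N\<close>: the hyperplanes of type \<open>s\<close>
  crossed by an axis of \<open>x\<close>.\<close>

definition axis :: "('v \<times> 'g) list set set \<Rightarrow> nat \<Rightarrow> ('v \<times> 'g) list set set set" where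
  "axis x t = fst (nu (x [^]\<^bsub>P\<^esub> Suc t) ! t)"

lemma nu_pow_prefix:
  assumes "cyc_red x"
  shows "\<exists>r. nu (x [^]\<^bsub>P\<^esub> (N + M)) = nu (x [^]\<^bsub>P\<^esub> (N::nat)) @ r"
proof (induction N)
  case 0
  then show ?case by (simp add: nu_sp)
next
  case (Suc N)
  then obtain r where "nu (x [^]\<^bsub>P\<^esub> (N + M)) = nu (x [^]\<^bsub>P\<^esub> N) @ r" by auto
  then have "nu (x [^]\<^bsub>P\<^esub> (Suc N + M)) = nu (x [^]\<^bsub>P\<^esub> Suc N) @ sh (rt x) r"
    using assms by (simp add: nu_pow_Suc)
  then show ?case by blast
qed

text \<open>Words of higher powers extend those of lower ones, so position \<open>t\<close> is the
  same in all powers that reach it; exponent \<open>Suc t\<close> does, as \<open>nu x\<close> is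
  nonempty.\<close>

lemma axis_eq:
  assumes "cyc_red x" "t < N * length (nu x)"
  shows "fst (nu (x [^]\<^bsub>P\<^esub> N) ! t) = axis x t"
proof -
  have len: "length (nu x) > 0" using assms by (simp add: cyc_red_def)
  have t: "t < Suc t * length (nu x)" using len by (cases "length (nu x)") auto
  have *: "nu (x [^]\<^bsub>P\<^esub> A) ! t = nu (x [^]\<^bsub>P\<^esub> B) ! t"
    if "t < A * length (nu x)" "A \<le> B" for A B :: nat
  proof -
    have "A + (B - A) = B" using that by simp
    then obtain r where "nu (x [^]\<^bsub>P\<^esub> B) = nu (x [^]\<^bsub>P\<^esub> A) @ r"
      using nu_pow_prefix[OF assms(1), of A "B - A"] by auto
    then show ?thesis using that length_nu_pow[OF assms(1), of A] by (simp add: nth_append)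
  qed
  have "nu (x [^]\<^bsub>P\<^esub> N) ! t = nu (x [^]\<^bsub>P\<^esub> Suc t) ! t"
  proof (cases "N \<le> Suc t")
    case True
    then show ?thesis by (rule *[OF assms(2)])
  next
    case False
    then have "Suc t \<le> N" by simp
    then show ?thesis by (rule *[OF t, symmetric])
  qed
  then show ?thesis unfolding axis_def by (rule arg_cong)
qed

lemma axis_in_idx:
  assumes "cyc_red x"
  shows "axis x t \<in> idx"
proof -
  have x: "x \<in> carrier P" using assms by (simp add: cyc_red_def)
  have "t < length (nu (x [^]\<^bsub>P\<^esub> Suc t))"
    using assms unfolding length_nu_pow[OF assms] by (cases "length (nu x)") (auto simp: cyc_red_def)
  then have "nu (x [^]\<^bsub>P\<^esub> Suc t) ! t \<in> idx \<times> (carrier (G s) - {\<one>\<^bsub>G s\<^esub>})"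
    using nu_red[of "x [^]\<^bsub>P\<^esub> Suc t"] x nth_mem unfolding Gs.red_def by blast
  then show ?thesis unfolding axis_def by auto
qed

lemma nth_sh: "t < length w \<Longrightarrow> fst (sh a w ! t) = a <#\<^bsub>P\<^esub> fst (w ! t)"
  by (simp add: sh_def)

text \<open>Another factor \<open>x\<close> puts one copy of \<open>nu x\<close> in front and shifts
  the rest by \<open>rt x\<close>.\<close>

lemma axis_shift_self:
  assumes "cyc_red x"
  shows "rt x <#\<^bsub>P\<^esub> axis x t = axis x (t + length (nu x))"
proof -
  let ?k = "length (nu x)"
  have k: "?k > 0" using assms by (simp add: cyc_red_def)
  have t: "t < Suc t * ?k" using k by (cases ?k) auto
  have "axis x (t + ?k) = fst (nu (x [^]\<^bsub>P\<^esub> Suc (Suc t)) ! (t + ?k))"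
    using assms t by (intro axis_eq[symmetric]) auto
  also have "nu (x [^]\<^bsub>P\<^esub> Suc (Suc t)) = nu x @ sh (rt x) (nu (x [^]\<^bsub>P\<^esub> Suc t))"
    using nu_pow_Suc[OF assms, of "Suc t"] by simp
  also have "fst (\<dots> ! (t + ?k)) = fst (sh (rt x) (nu (x [^]\<^bsub>P\<^esub> Suc t)) ! t)"
    by (simp add: nth_append)
  also have "\<dots> = rt x <#\<^bsub>P\<^esub> axis x t"
    using t length_nu_pow[OF assms, of "Suc t"] unfolding axis_def by (intro nth_sh) simp
  finally show ?thesis by simp
qed

text \<open>An element commuting with \<open>x\<close> eventually translates the axis of \<open>x\<close>: compare the first
  syllables of \<open>y x\<^sup>N\<close> and \<open>x\<^sup>N y\<close>. The translation length is \<open>D - J\<close>.\<close>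

lemma axis_shift_commuting:
  fixes B :: nat
  assumes "cyc_red x" "y \<in> carrier P" "x \<cdot> y = y \<cdot> x"
  defines "l \<equiv> length (nu y)"
  shows "\<exists>D J. D \<le> l + 1 \<and> J \<le> 2 * l \<and> (\<forall>t. l \<le> t \<and> t < B \<longrightarrow> rt y <#\<^bsub>P\<^esub> axis x t = axis x (t + D - J))"
proof -
  let ?k = "length (nu x)"
  have x: "x \<in> carrier P" and k: "?k > 0" using assms by (simp_all add: cyc_red_def)
  \<comment> \<open>In \<open>x [^] N \<cdot> y\<close> at most \<open>l\<close> syllables are lost
    from the end of \<open>?w\<close>; this exponent keeps all positions below
    \<open>B + l + 1\<close> out of reach.\<close>
  define N where "N = B + 3 * l + 2"
  have Nk: "N * ?k \<ge> N" using k by (simp add: Suc_le_eq)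
  let ?w = "nu (x [^]\<^bsub>P\<^esub> N)"
  have lw: "length ?w = N * ?k" using assms by (simp add: length_nu_pow)
  have xN: "x [^]\<^bsub>P\<^esub> N \<in> carrier P" using x by simp
  have "y \<cdot> x [^]\<^bsub>P\<^esub> N = x [^]\<^bsub>P\<^esub> N \<cdot> y"
    using P.group_commutes_pow[OF assms(3) x assms(2)] by simp
  then have eq: "Gs.wmul (nu y) (sh (rt y) ?w) = Gs.wmul ?w (sh (rt (x [^]\<^bsub>P\<^esub> N)) (nu y))"
    using nu_mult assms xN by metis
  obtain j m where jm: "j \<le> l" "length m \<le> 1"
    "Gs.wmul (nu y) (sh (rt y) ?w) = take (l - j) (nu y) @ m @ drop j (sh (rt y) ?w)"
    using Gs.wmul_cancel[OF nu_red[OF assms(2)], of "sh (rt y) ?w"] unfolding l_def by auto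
  obtain j' m' where jm': "j' \<le> l"
    "Gs.wmul ?w (sh (rt (x [^]\<^bsub>P\<^esub> N)) (nu y)) =
      take (N * ?k - j') ?w @ m' @ drop j' (sh (rt (x [^]\<^bsub>P\<^esub> N)) (nu y))"
    using Gs.wmul_cancel[OF nu_red[OF xN], of "sh (rt (x [^]\<^bsub>P\<^esub> N)) (nu y)"] lw
    unfolding l_def by auto
  define D where "D = l + length m"
  \<comment> \<open>From each factor \<open>j\<close> syllables are dropped and \<open>m\<close> is
    inserted, which moves syllable \<open>t\<close> to \<open>t + D - 2 * j\<close>. The subtraction
    is not truncated, since \<open>j \<le> l \<le> t\<close>.\<close>
  have "rt y <#\<^bsub>P\<^esub> axis x t = axis x (t + D - 2 * j)" if t: "l \<le> t" "t < B" for t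
  proof -
    let ?u = "t + D - 2 * j"
    have u: "?u < N * ?k - j'" "?u = (l - j) + length m + (t - j)"
      using t jm(1,2) jm'(1) Nk by (auto simp: D_def N_def)
    have "fst ((take (l - j) (nu y) @ m @ drop j (sh (rt y) ?w)) ! ?u) = fst (sh (rt y) ?w ! t)"
    proof -
      have "length (take (l - j) (nu y)) = l - j" by (simp add: l_def)
      then have "(take (l - j) (nu y) @ m @ drop j (sh (rt y) ?w)) ! ?u = drop j (sh (rt y) ?w) ! (t - j)"
        unfolding u(2) by (simp add: nth_append)
      then show ?thesis using t jm(1) lw Nk by (simp add: N_def)
    qed
    also have "\<dots> = rt y <#\<^bsub>P\<^esub> axis x t"
      using t lw Nk axis_eq[OF assms(1), of t N] by (simp add: nth_sh N_def)
    finally have "fst (Gs.wmul ?w (sh (rt (x [^]\<^bsub>P\<^esub> N)) (nu y)) ! ?u) = rt y <#\<^bsub>P\<^esub> axis x t"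
      using eq jm(3) by simp
    moreover have "fst (Gs.wmul ?w (sh (rt (x [^]\<^bsub>P\<^esub> N)) (nu y)) ! ?u) = axis x ?u"
      using u(1) lw axis_eq[OF assms(1), of ?u N] unfolding jm'(2) by (simp add: nth_append)
    ultimately show ?thesis by simp
  qed
  then show ?thesis using jm(1,2) by (intro exI[of _ D] exI[of _ "2 * j"]) (auto simp: D_def)
qed

lemma pow_coset:
  "a \<in> carrier P \<Longrightarrow> c \<in> idx \<Longrightarrow> (a [^]\<^bsub>P\<^esub> (n::nat) \<cdot> a) <#\<^bsub>P\<^esub> c = a <#\<^bsub>P\<^esub> ((a [^]\<^bsub>P\<^esub> n) <#\<^bsub>P\<^esub> c)"
  using coset_mult[of c a "a [^]\<^bsub>P\<^esub> n"] P.nat_pow_Suc2[of a n] by simp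

text \<open>Far out, \<open>y\<close> translates the axis of \<open>x\<close> by
  \<open>D - J\<close>, and \<open>x\<close> translates it by its length \<open>k\<close>. So the
  \<open>k\<close>-th power of \<open>y\<close> and the power of \<open>x\<close> with exponent
  \<open>D - J\<close> move an index alike; their quotient fixes it and dies under
  \<open>ret W\<close>, as does \<open>x\<close>.\<close>

lemma commuting_torsion:
  assumes x: "cyc_red x" and y: "y \<in> carrier P" and comm: "x \<cdot> y = y \<cdot> x"
    and W: "s \<notin> W" "W \<inter> lk V E s = {}" "ret W x = \<one>\<^bsub>P\<^esub>"
  shows "\<exists>k>0. ret W y [^]\<^bsub>P\<^esub> (k::nat) = \<one>\<^bsub>P\<^esub>"
proof -
  define l where "l = length (nu y)"
  define k where "k = length (nu x)"
  \<comment> \<open>Each of the \<open>k\<close> translations goes back by at most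
    \<open>2 * l\<close>, so starting here none falls below position \<open>l\<close>, where the
    translation formula begins to hold.\<close>
  define t0 where "t0 = l + k * (2 * l)"
  have xP: "x \<in> carrier P" and k: "k > 0" using x by (simp_all add: cyc_red_def k_def)
  obtain D J where DJ: "D \<le> l + 1" "J \<le> 2 * l"
    "\<And>t. l \<le> t \<Longrightarrow> t < t0 + k * (l + 1) \<Longrightarrow> rt y <#\<^bsub>P\<^esub> axis x t = axis x (t + D - J)"
    using axis_shift_commuting[OF x y comm, of "t0 + k * (l + 1)"] unfolding l_def[symmetric] by blast
  have yk: "(rt y [^]\<^bsub>P\<^esub> r) <#\<^bsub>P\<^esub> axis x t0 = axis x (t0 + r * D - r * J)" if "r \<le> k" for r
    using that
  proof (induction r)
    case 0
    then show ?case using coset_one axis_in_idx[OF x] by simp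
  next
    case (Suc r)
    have r: "r * J \<le> r * (2 * l)" "r * D \<le> r * (l + 1)"
      using DJ(1,2) by (intro mult_le_mono2; simp)+
    have rk: "Suc r * (2 * l) \<le> k * (2 * l)" "Suc r * (l + 1) \<le> k * (l + 1)"
      using Suc.prems by (intro mult_le_mono1; simp)+
    have b: "r * J + J \<le> k * (2 * l)"
      using r(1) rk(1) DJ(2) unfolding mult_Suc by linarith
    have "r * D < k * (l + 1)"
      using r(2) rk(2) unfolding mult_Suc by linarith
    with b have b: "l \<le> t0 + r * D - r * J" "t0 + r * D - r * J < t0 + k * (l + 1)"
      "t0 + r * D - r * J + D - J = t0 + Suc r * D - Suc r * J" "r * J \<le> t0"
      unfolding t0_def mult_Suc by linarith+
    then show ?case
      using Suc DJ(3)[OF b(1,2)] y by (simp add: pow_coset axis_in_idx[OF x])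
  qed
  have xe: "(rt x [^]\<^bsub>P\<^esub> r) <#\<^bsub>P\<^esub> axis x t = axis x (t + r * k)" for r t
  proof (induction r)
    case 0
    then show ?case using coset_one axis_in_idx[OF x] by simp
  next
    case (Suc r)
    then show ?case
      using axis_shift_self[OF x, of "t + r * k"] xP
      by (simp add: pow_coset axis_in_idx[OF x] k_def[symmetric] ac_simps)
  qed
  have t0: "k * J \<le> t0" using DJ(2) by (simp add: t0_def trans_le_add2)
  \<comment> \<open>The power of \<open>rt x\<close> with exponent \<open>J - D\<close>, which may
    have either sign while exponents are natural numbers.\<close>
  define xp where "xp = (if J \<le> D then inv\<^bsub>P\<^esub> (rt x [^]\<^bsub>P\<^esub> (D - J)) else rt x [^]\<^bsub>P\<^esub> (J - D))"
  have xpP: "xp \<in> carrier P" using xP by (simp add: xp_def)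
  have rW: "ret W (rt u) = ret W u" if "u \<in> carrier P" for u
  proof -
    have "W \<inter> (V - {s}) = W \<inter> V" using W by auto
    then show ?thesis using that ret_ret ret_Int_V by metis
  qed
  have retxp: "ret W xp = \<one>\<^bsub>P\<^esub>"
    using W xP by (simp add: xp_def rW ret.hom_nat_pow)
  have "xp <#\<^bsub>P\<^esub> axis x (t0 + k * D - k * J) = axis x t0"
  proof (cases "J \<le> D")
    case True
    let ?z = "rt x [^]\<^bsub>P\<^esub> (D - J)"
    have zP: "?z \<in> carrier P" using xP by simp
    have "t0 + k * D - k * J = t0 + (D - J) * k"
      using True by (auto simp: le_iff_add algebra_simps)
    then have "axis x (t0 + k * D - k * J) = ?z <#\<^bsub>P\<^esub> axis x t0"
      using xe by simp
    then show ?thesis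
      using True coset_mult[OF axis_in_idx[OF x], of "inv\<^bsub>P\<^esub> ?z" ?z t0] zP
      by (simp add: xp_def coset_one axis_in_idx[OF x])
  next
    case False
    have "k * D \<le> k * J" using False by simp
    then have "t0 + k * D - k * J + (J - D) * k = t0"
      using False t0 by (auto simp: not_le less_iff_Suc_add algebra_simps)
    then show ?thesis
      using False xe[of "J - D" "t0 + k * D - k * J"] by (simp add: xp_def)
  qed
  then have "(xp \<cdot> rt y [^]\<^bsub>P\<^esub> k) <#\<^bsub>P\<^esub> axis x t0 = axis x t0"
    using yk[of k] coset_mult[OF axis_in_idx[OF x] xpP, of "rt y [^]\<^bsub>P\<^esub> k" t0] y by simp
  then have "ret W (xp \<cdot> rt y [^]\<^bsub>P\<^esub> k) = \<one>\<^bsub>P\<^esub>"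
    using xpP y W by (intro coset_fix_ret[OF axis_in_idx[OF x]]) auto
  then have "ret W y [^]\<^bsub>P\<^esub> k = \<one>\<^bsub>P\<^esub>"
    using retxp xpP y by (simp add: rW ret.hom_nat_pow)
  then show ?thesis using k by blast
qed

text \<open>As \<open>nu y\<close> is empty, commuting forces the shift by \<open>y\<close> to fix
  \<open>nu x\<close>. A first syllable would have an index fixed by \<open>y\<close>, against the
  nontrivial image under \<open>ret W\<close>.\<close>

lemma elliptic_commuting:
  assumes y: "y \<in> sp (V - {s})" and x: "x \<in> carrier P" and comm: "x \<cdot> y = y \<cdot> x"
    and W: "W \<inter> lk V E s = {}" "ret W y \<noteq> \<one>\<^bsub>P\<^esub>"
  shows "x \<in> sp (V - {s})"
proof (cases "nu x")
  case Nil
  then show ?thesis using nu_NilD x by blast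
next
  case (Cons e n)
  have yP: "y \<in> carrier P" using y by (simp add: sp_closed)
  have "sh y (nu x) = nu x"
    using nu_mult[OF x yP] nu_mult[OF yP x] comm y by (simp add: nu_sp sp_ret Gs.wmul_def)
      (metis Gs.wmul_def Gs.wmul_eq_append append_Nil2 nu_red x)
  then have "y <#\<^bsub>P\<^esub> fst e = fst e" by (cases e) (simp add: Cons)
  moreover have "fst e \<in> idx"
    using nu_red[OF x] by (cases e) (auto simp: Cons Gs.red_Cons)
  ultimately show ?thesis using coset_fix_ret[OF _ yP _ W(1)] W(2) by blast
qed

text \<open>If \<open>y\<close> has finite order it is conjugate into \<open>sp (V - {s})\<close>; otherwise an axis of \<open>x\<close>
  would force \<open>ret W y\<close> to be torsion.\<close>

lemma conjugate_into_sp: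
  assumes x: "x \<in> carrier P" and y: "y \<in> carrier P" and comm: "x \<cdot> y = y \<cdot> x"
    and W: "s \<notin> W" "W \<inter> lk V E s = {}"
    and ret: "ret {s} x = \<one>\<^bsub>P\<^esub>" "ret {s} y = \<one>\<^bsub>P\<^esub>" "ret W x = \<one>\<^bsub>P\<^esub>" "ret W y \<noteq> \<one>\<^bsub>P\<^esub>"
    and torsion: "\<And>k. k > 0 \<Longrightarrow> ret W y [^]\<^bsub>P\<^esub> (k::nat) = \<one>\<^bsub>P\<^esub> \<Longrightarrow> y [^]\<^bsub>P\<^esub> k = \<one>\<^bsub>P\<^esub>"
  shows "\<exists>z\<in>carrier P. P.conjg z x \<in> sp (V - {s})"
proof -
  obtain z where z: "z \<in> carrier P" "P.conjg z x \<in> sp (V - {s}) \<or> cyc_red (P.conjg z x)"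
    using cyc_red_exists[OF x ret(1)] by blast
  have conj_comm: "P.conjg a x \<cdot> P.conjg a y = P.conjg a y \<cdot> P.conjg a x" if "a \<in> carrier P" for a
    using comm that x y by (simp add: P.conjg_mult[symmetric])
  show ?thesis
  proof (cases "cyc_red (P.conjg z x)")
    case True
    have "ret W (P.conjg z x) = \<one>\<^bsub>P\<^esub>" using ret z x by (simp add: ret.hom_conjg)
    then obtain k :: nat where k: "k > 0" "ret W (P.conjg z y) [^]\<^bsub>P\<^esub> k = \<one>\<^bsub>P\<^esub>"
      using commuting_torsion[OF True _ conj_comm[OF z(1)] W] z y by auto
    then have "P.conjg (ret W z) (ret W y [^]\<^bsub>P\<^esub> k) = \<one>\<^bsub>P\<^esub>"
      using z y by (simp add: ret.hom_conjg P.conjg_pow)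
    then have "y [^]\<^bsub>P\<^esub> k = \<one>\<^bsub>P\<^esub>" using torsion[OF k(1)] z y by simp
    \<comment> \<open>The roles change: a conjugate of \<open>y\<close> of finite order cannot be
      cyclically reduced, so \<open>y\<close> is moved first and \<open>x\<close> follows.\<close>
    obtain a where a: "a \<in> carrier P" "P.conjg a y \<in> sp (V - {s}) \<or> cyc_red (P.conjg a y)"
      using cyc_red_exists[OF y ret(2)] by blast
    have "P.conjg a y [^]\<^bsub>P\<^esub> k = \<one>\<^bsub>P\<^esub>"
      using \<open>y [^]\<^bsub>P\<^esub> k = \<one>\<^bsub>P\<^esub>\<close> a y by (simp add: P.conjg_pow[symmetric])
    then have "P.conjg a y \<in> sp (V - {s})"
      using a cyc_red_pow_neq_one k(1) by blast
    moreover have "ret W (P.conjg a y) \<noteq> \<one>\<^bsub>P\<^esub>" using ret a y by (simp add: ret.hom_conjg)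
    ultimately have "P.conjg a x \<in> sp (V - {s})"
      using elliptic_commuting[OF _ _ conj_comm W(2)] a x by simp
    then show ?thesis using a by blast
  next
    case False
    then show ?thesis using z by blast
  qed
qed

end

section \<open>Automorphisms acting trivially on the abelianization\<close>

context group
begin

lemma conjg_commute:
  "x \<otimes> y = y \<otimes> x \<Longrightarrow> a \<in> carrier G \<Longrightarrow> x \<in> carrier G \<Longrightarrow> y \<in> carrier G \<Longrightarrow>
     conjg a x \<otimes> conjg a y = conjg a y \<otimes> conjg a x"
  by (simp add: conjg_mult[symmetric])

abbreviation "D \<equiv> derived G (carrier G)"

lemma coset_derived_eqI:
  assumes "x \<in> carrier G" "y \<in> carrier G" "x \<otimes> inv y \<in> D"
  shows "D #> x = D #> y"
proof -
  interpret N: normal D G by (rule derived_self_is_normal)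
  have "x \<in> D #> y"
    using assms by (metis N.rcos_module_rev is_group)
  then show ?thesis using assms N.subgroup_axioms by (metis repr_independence)
qed

lemma coset_derived_eqD:
  assumes "x \<in> carrier G" "y \<in> carrier G" "D #> x = D #> y"
  shows "x \<otimes> inv y \<in> D"
proof -
  interpret N: normal D G by (rule derived_self_is_normal)
  have "x \<in> D #> y" using assms rcos_self[OF assms(1) N.subgroup_axioms] by simp
  then show ?thesis using assms N.rcos_module_imp is_group by metis
qed

lemma coset_derived_conjg:
  assumes "a \<in> carrier G" "x \<in> carrier G"
  shows "D #> conjg a x = D #> x"
proof (rule coset_derived_eqI)
  have "conjg a x \<otimes> inv x \<in> derived_set G (carrier G)"
    using assms by (auto simp: conjg_def)
  then show "conjg a x \<otimes> inv x \<in> D" unfolding derived_def by (rule generate.incl)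
qed (use assms in auto)

text \<open>The identity of \<open>AutoGroup (abelianization G)\<close> is a restricted identity
  map, so by \<open>ab_map_coset\<close> membership in the kernel is tested coset by coset.\<close>

lemma IA_iff: "f \<in> IA G \<longleftrightarrow> f \<in> auto G \<and> (\<forall>x\<in>carrier G. D #> f x = D #> x)"
proof -
  have car: "carrier (abelianization G) = (\<lambda>x. D #> x) ` carrier G"
    by (auto simp: abelianization_def FactGroup_def RCOSETS_def)
  have "ab_map G f = (\<lambda>A\<in>carrier (abelianization G). A) \<longleftrightarrow> (\<forall>x\<in>carrier G. D #> f x = D #> x)"
    if f: "f \<in> auto G"
  proof
    assume *: "ab_map G f = (\<lambda>A\<in>carrier (abelianization G). A)"
    show "\<forall>x\<in>carrier G. D #> f x = D #> x"
    proof
      fix x assume x: "x \<in> carrier G"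
      then have "ab_map G f (D #> x) = D #> x" unfolding * by (simp add: car)
      then show "D #> f x = D #> x" using ab_map_coset[OF f x] by simp
    qed
  next
    assume *: "\<forall>x\<in>carrier G. D #> f x = D #> x"
    show "ab_map G f = (\<lambda>A\<in>carrier (abelianization G). A)"
    proof
      fix A
      show "ab_map G f A = (\<lambda>A\<in>carrier (abelianization G). A) A"
      proof (cases "A \<in> carrier (abelianization G)")
        case True
        then show ?thesis using ab_map_coset[OF f] * by (auto simp: car)
      qed (simp add: ab_map_def)
    qed
  qed
  then show ?thesis
    by (auto simp: IA_def kernel_def AutoGroup_def BijGroup_def)
qed

text \<open>A homomorphism with commuting values kills the derived subgroup, which contains
  \<open>f x \<otimes> inv x\<close>.\<close>

lemma IA_hom_eq:
  assumes "f \<in> IA G" "group H" "k \<in> hom G H"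
    and comm: "\<And>x y. x \<in> carrier G \<Longrightarrow> y \<in> carrier G \<Longrightarrow> k x \<otimes>\<^bsub>H\<^esub> k y = k y \<otimes>\<^bsub>H\<^esub> k x"
    and x: "x \<in> carrier G"
  shows "k (f x) = k x"
proof -
  interpret k: group_hom G H k using assms(2,3) by (simp add: group_hom_def group_hom_axioms_def is_group)
  have "derived_set G (carrier G) \<subseteq> kernel G H k"
    using k.kernel_commutator[OF _ _ comm] by (auto simp: commutator_def)
  then have D: "D \<subseteq> kernel G H k"
    unfolding derived_def by (rule generate_subgroup_incl) (rule k.subgroup_kernel)
  have f: "f \<in> auto G" "D #> f x = D #> x" using assms(1) x by (auto simp: IA_iff)
  then have fx: "f x \<in> carrier G" using x by (auto simp: auto_def hom_def)
  then have "f x \<otimes> inv x \<in> D" using x f by (simp add: coset_derived_eqD)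
  then have "k (f x \<otimes> inv x) = \<one>\<^bsub>H\<^esub>" using D by (auto simp: kernel_def)
  then have "k (f x) \<otimes>\<^bsub>H\<^esub> inv\<^bsub>H\<^esub> k x = \<one>\<^bsub>H\<^esub>" using fx x by simp
  then show ?thesis using fx x by (simp add: k.H.inv_solve_right')
qed

lemma Inn_eq: "Inn G = (\<lambda>g. restrict (conjg g) (carrier G)) ` carrier G"
proof -
  have "conjg g = (\<lambda>x. g \<otimes> x \<otimes> inv g)" for g
    by (rule ext) (simp add: conjg_def)
  then show ?thesis unfolding Inn_def by auto
qed

lemma Inn_subset_IA: "Inn G \<subseteq> IA G"
proof -
  have "restrict (conjg g) (carrier G) \<in> IA G" if g: "g \<in> carrier G" for g
  proof -
    have "bij_betw (conjg g) (carrier G) (carrier G)"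
      using g by (intro bij_betw_byWitness[of _ "conjg (inv g)"]) auto
    then have "restrict (conjg g) (carrier G) \<in> auto G"
      using g by (auto simp: auto_def Bij_def bij_betw_restrict_eq conjg_mult intro!: homI)
    then show ?thesis using g by (simp add: IA_iff coset_derived_conjg)
  qed
  then show ?thesis by (auto simp: Inn_eq)
qed

end

section \<open>Conjugacy into special subgroups\<close>

context graph_of_groups
begin

lemma centralizer:
  assumes "v \<in> V" "g \<in> carrier (G v)" "g \<noteq> \<one>\<^bsub>G v\<^esub>" "x \<in> carrier P" "P.conjg x (emb v g) = emb v g"
  shows "x \<in> sp (st V E v)"
proof -
  interpret vs: graph_of_groups_vertex V E G v by unfold_locales fact
  show ?thesis using assms by (intro vs.centralizer_emb[of x g]) (simp_all add: P.conjg_fix_iff)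
qed

text \<open>Apply the retraction onto \<open>sp W\<close> to a conjugacy between elements of \<open>sp W\<close> and \<open>sp W'\<close>.\<close>

lemma conjugate_sp_Int:
  assumes "x \<in> carrier P" "z \<in> carrier P" "P.conjg z x \<in> sp W" "z' \<in> carrier P" "P.conjg z' x \<in> sp W'"
  shows "\<exists>y\<in>carrier P. P.conjg y x \<in> sp (W \<inter> W')"
proof -
  let ?c = "z' \<cdot> inv\<^bsub>P\<^esub> z"
  have "P.conjg ?c (P.conjg z x) = P.conjg z' x"
    using assms by (simp add: P.conjg_conjg P.m_assoc)
  then have "ret W (P.conjg z' x) = P.conjg (ret W ?c) (P.conjg z x)"
    using assms ret.hom_conjg[of ?c "P.conjg z x" W] by (simp add: sp_ret)
  then have "P.conjg (ret W ?c \<cdot> z) x \<in> sp (W \<inter> W')"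
    using assms ret_sp_other[OF assms(5), of W] by (simp add: P.conjg_conjg)
  then show ?thesis using assms by (intro bexI[of _ "ret W ?c \<cdot> z"]) auto
qed

lemma conjugate_sp_Diff:
  assumes "x \<in> carrier P" "finite A" "\<And>s. s \<in> A \<Longrightarrow> \<exists>z\<in>carrier P. P.conjg z x \<in> sp (V - {s})"
  shows "\<exists>z\<in>carrier P. P.conjg z x \<in> sp (V - A)"
  using assms(2,3)
proof (induction A)
  case empty
  then show ?case using assms(1) by (intro bexI[of _ "\<one>\<^bsub>P\<^esub>"]) (simp_all add: sp_full)
next
  case (insert s A)
  then obtain z where "z \<in> carrier P" "P.conjg z x \<in> sp (V - A)" by auto
  moreover obtain z' where "z' \<in> carrier P" "P.conjg z' x \<in> sp (V - {s})"
    using insert.prems[of s] by auto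
  moreover have "(V - A) \<inter> (V - {s}) = V - insert s A" by auto
  ultimately show ?case using conjugate_sp_Int[OF assms(1)] by metis
qed

text \<open>The inverses of \<open>a\<close> and of its retraction \<open>?r a\<close> conjugate
  \<open>emb v g\<close> to the same element. So \<open>a \<cdot> inv (?r a)\<close> centralizes
  \<open>emb v g\<close> and lies in \<open>sp (st V E v)\<close>, which avoids
  \<open>u\<close>.\<close>

lemma conjugate_base:
  assumes v: "v \<in> V" "g \<in> carrier (G v)" "g \<noteq> \<one>\<^bsub>G v\<^esub>" and u: "u \<notin> st V E v"
    and a: "a \<in> carrier P" "P.conjg (inv\<^bsub>P\<^esub> a) (emb v g) \<in> sp (V - {u})"
  shows "a \<in> sp (V - {u})"
proof -
  let ?r = "ret (V - {u})"
  have "v \<noteq> u" using u by (auto simp: st_def)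
  then have "?r (P.conjg (inv\<^bsub>P\<^esub> a) (emb v g)) = P.conjg (inv\<^bsub>P\<^esub> ?r a) (emb v g)"
    using v a(1) by (simp add: ret.hom_conjg ret_emb)
  then have eq: "P.conjg (inv\<^bsub>P\<^esub> ?r a) (emb v g) = P.conjg (inv\<^bsub>P\<^esub> a) (emb v g)"
    using a by (simp add: sp_ret)
  have "P.conjg (a \<cdot> inv\<^bsub>P\<^esub> ?r a) (emb v g) = P.conjg a (P.conjg (inv\<^bsub>P\<^esub> ?r a) (emb v g))"
    using a v by (simp add: P.conjg_conjg)
  also have "\<dots> = emb v g" using a v unfolding eq by simp
  finally have "a \<cdot> inv\<^bsub>P\<^esub> ?r a \<in> sp (st V E v)"
    using a v by (intro centralizer) auto
  then have "a \<cdot> inv\<^bsub>P\<^esub> ?r a \<in> sp (V - {u})"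
    using sp_mono[of "st V E v" "V - {u}"] u by auto
  then have "a \<cdot> inv\<^bsub>P\<^esub> ?r a \<cdot> ?r a \<in> sp (V - {u})"
    using ret_sp[OF a(1)] by (rule sp_mult)
  then show ?thesis using a by (simp add: P.m_assoc)
qed

end

locale rigid_graph_of_groups = graph_of_groups +
  assumes nontrivial: "\<And>v. v \<in> V \<Longrightarrow> \<not> trivial_group (G v)"
    and link_not_in_star: "\<And>v w. v \<in> V \<Longrightarrow> w \<in> V \<Longrightarrow> v \<noteq> w \<Longrightarrow> \<not> lk V E v \<subseteq> st V E w"
begin

lemma nontrivialE:
  assumes "v \<in> V"
  obtains g where "g \<in> carrier (G v)" "g \<noteq> \<one>\<^bsub>G v\<^esub>"
proof -
  interpret group "G v" by (rule vertex_group[OF assms])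
  show thesis using nontrivial[OF assms] that by (auto simp: trivial_group_subset)
qed

end

section \<open>Images of the vertex groups under an automorphism in IA\<close>

locale rigid_IA = rigid_graph_of_groups +
  fixes \<phi> :: "('a \<times> 'b) list set set \<Rightarrow> ('a \<times> 'b) list set set"
  assumes abelian: "\<And>v. v \<in> V \<Longrightarrow> comm_group (G v)"
    and \<phi>_IA: "\<phi> \<in> IA P"
begin

lemma \<phi>_auto: "\<phi> \<in> auto P"
  using \<phi>_IA by (simp add: P.IA_iff)

sublocale \<phi>: group_hom P P \<phi>
  using \<phi>_auto by unfold_locales (simp add: auto_def)

lemma emb_commute_same:
  assumes "v \<in> V" "g \<in> carrier (G v)" "h \<in> carrier (G v)"
  shows "emb v g \<cdot> emb v h = emb v h \<cdot> emb v g"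
proof -
  interpret comm_group "G v" using abelian assms by simp
  show ?thesis using assms m_comm by (simp add: emb_mult[symmetric])
qed

lemma sp_single_commute:
  assumes "v \<in> V" "x \<in> sp {v}" "y \<in> sp {v}"
  shows "x \<cdot> y = y \<cdot> x"
  using assms emb_commute_same by (elim sp_singleE) auto

text \<open>\<open>G v\<close> is abelian, so the retraction onto it has commuting values and does
  not see \<phi>.\<close>

lemma ret_single_\<phi>: "v \<in> V \<Longrightarrow> x \<in> carrier P \<Longrightarrow> ret {v} (\<phi> x) = ret {v} x"
  by (rule P.IA_hom_eq[OF \<phi>_IA P.is_group ret_hom])
    (simp_all add: sp_single_commute[of v] ret_sp)

lemma conjg_single:
  assumes "v \<in> V" "a \<in> sp {v}" "g \<in> carrier (G v)"
  shows "P.conjg a (emb v g) = emb v g"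
  using assms sp_single_commute[OF assms(1,2) sp_emb[of v "{v}" g]]
  by (simp add: P.conjg_fix_iff sp_closed)

lemma ret_single_conjg:
  assumes "v \<in> V" "a \<in> carrier P" "g \<in> carrier (G v)"
  shows "ret {v} (P.conjg a (emb v g)) = emb v g"
  using assms by (simp add: ret.hom_conjg ret_emb conjg_single ret_sp)

text \<open>Uses \<open>vs.conjugate_into_sp\<close> with the image of a letter of
  \<open>G w\<close>, for \<open>w\<close> adjacent to \<open>v\<close> but outside the star of
  \<open>s\<close>. Its torsion condition holds because \<open>ret {w}\<close> returns the letter
  itself, and a trivial power of it stays trivial under \<phi>.\<close>

lemma \<phi>_emb_conjugate_sp:
  assumes v: "v \<in> V" "g \<in> carrier (G v)" and s: "s \<in> V" "s \<noteq> v"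
  shows "\<exists>z\<in>carrier P. P.conjg z (\<phi> (emb v g)) \<in> sp (V - {s})"
proof -
  interpret vs: graph_of_groups_vertex V E G s by unfold_locales fact
  obtain w where w: "w \<in> lk V E v" "w \<notin> st V E s"
    using link_not_in_star[of v s] v s by auto
  have wV: "w \<in> V" "w \<noteq> v" "w \<noteq> s" "w \<notin> lk V E s"
    using w lk_subset not_in_lk by (auto simp: st_def)
  obtain h where h: "h \<in> carrier (G w)" "h \<noteq> \<one>\<^bsub>G w\<^esub>" using nontrivialE[OF wV(1)] .
  have e: "emb v g \<in> carrier P" "emb w h \<in> carrier P" using v wV h by auto
  have "emb v g \<cdot> emb w h = emb w h \<cdot> emb v g"
    using emb_commute[of v w g h] w v h by (simp add: lk_iff)
  then have comm: "\<phi> (emb v g) \<cdot> \<phi> (emb w h) = \<phi> (emb w h) \<cdot> \<phi> (emb v g)"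
    using e by (metis \<phi>.hom_mult)
  have ret: "ret {s} (\<phi> (emb v g)) = \<one>\<^bsub>P\<^esub>" "ret {s} (\<phi> (emb w h)) = \<one>\<^bsub>P\<^esub>"
    "ret {w} (\<phi> (emb v g)) = \<one>\<^bsub>P\<^esub>" "ret {w} (\<phi> (emb w h)) = emb w h"
    using v s wV h by (auto simp: ret_single_\<phi> ret_emb)
  show ?thesis
  proof (rule vs.conjugate_into_sp[of _ "\<phi> (emb w h)" "{w}"])
    show "ret {w} (\<phi> (emb w h)) \<noteq> \<one>\<^bsub>P\<^esub>"
      using h wV by (simp add: ret emb_eq_one_iff)
    show "\<phi> (emb w h) [^]\<^bsub>P\<^esub> k = \<one>\<^bsub>P\<^esub>" if "ret {w} (\<phi> (emb w h)) [^]\<^bsub>P\<^esub> k = \<one>\<^bsub>P\<^esub>" for k :: nat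
      using that \<phi>.hom_nat_pow[of "emb w h" k] e by (simp add: ret)
  qed (use e comm ret wV in auto)
qed

text \<open>Conjugacy into all \<open>sp (V - {s})\<close> combines to conjugacy into
  \<open>sp {v}\<close>; there \<open>ret {v}\<close>, which does not see \<phi>, identifies the
  element.\<close>

lemma \<phi>_emb_conjugate:
  assumes v: "v \<in> V" "g \<in> carrier (G v)"
  shows "\<exists>z\<in>carrier P. \<phi> (emb v g) = P.conjg z (emb v g)"
proof -
  have e: "emb v g \<in> carrier P" using v by simp
  have "\<exists>z\<in>carrier P. P.conjg z (\<phi> (emb v g)) \<in> sp (V - (V - {v}))"
  proof (rule conjugate_sp_Diff)
    show "\<exists>z\<in>carrier P. P.conjg z (\<phi> (emb v g)) \<in> sp (V - {s})" if "s \<in> V - {v}" for s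
      using that v by (intro \<phi>_emb_conjugate_sp) auto
  qed (use e finite_V in auto)
  moreover have "V - (V - {v}) = {v}" using v by auto
  ultimately obtain z where z: "z \<in> carrier P" "P.conjg z (\<phi> (emb v g)) \<in> sp {v}" by auto
  have "P.conjg z (\<phi> (emb v g)) = ret {v} (P.conjg z (\<phi> (emb v g)))"
    using z by (simp add: sp_ret)
  also have "\<dots> = emb v g"
    using v z e by (simp add: ret.hom_conjg ret_single_\<phi> ret_emb conjg_single ret_sp)
  finally have "\<phi> (emb v g) = P.conjg (inv\<^bsub>P\<^esub> z) (emb v g)"
    using z e by (simp add: P.conjg_eq_iff)
  then show ?thesis using z by blast
qed

text \<open>A conjugator for one nontrivial \<open>g0\<close> serves all \<open>g\<close>:
  transported back, \<open>\<phi> (emb v g)\<close> centralizes \<open>emb v g0\<close>, so it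
  splits into a part in \<open>G v\<close> and one in the link. Being conjugate to
  \<open>emb v g\<close>, it has trivial link part and first part \<open>g\<close>.\<close>

lemma \<phi>_emb_conjugate_uniform:
  assumes v: "v \<in> V"
  shows "\<exists>c\<in>carrier P. \<forall>g\<in>carrier (G v). \<phi> (emb v g) = P.conjg c (emb v g)"
proof -
  obtain g0 where g0: "g0 \<in> carrier (G v)" "g0 \<noteq> \<one>\<^bsub>G v\<^esub>" using nontrivialE[OF v] .
  obtain c where c: "c \<in> carrier P" "\<phi> (emb v g0) = P.conjg c (emb v g0)"
    using \<phi>_emb_conjugate[OF v g0(1)] by blast
  have "\<phi> (emb v g) = P.conjg c (emb v g)" if g: "g \<in> carrier (G v)" for g
  proof -
    obtain z where z: "z \<in> carrier P" "\<phi> (emb v g) = P.conjg z (emb v g)"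
      using \<phi>_emb_conjugate[OF v g] by blast
    define u where "u = P.conjg (inv\<^bsub>P\<^esub> c) (\<phi> (emb v g))"
    have e: "emb v g \<in> carrier P" "emb v g0 \<in> carrier P" using v g g0 by auto
    have u: "u \<in> carrier P" "u = P.conjg (inv\<^bsub>P\<^esub> c \<cdot> z) (emb v g)"
      using c z e by (simp_all add: u_def P.conjg_conjg)
    have "\<phi> (emb v g) \<cdot> \<phi> (emb v g0) = \<phi> (emb v g0) \<cdot> \<phi> (emb v g)"
      using emb_commute_same[OF v g g0(1)] e by (metis \<phi>.hom_mult)
    then have "u \<cdot> P.conjg (inv\<^bsub>P\<^esub> c) (\<phi> (emb v g0)) = P.conjg (inv\<^bsub>P\<^esub> c) (\<phi> (emb v g0)) \<cdot> u"
      unfolding u_def using c(1) e by (intro P.conjg_commute) auto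
    moreover have "P.conjg (inv\<^bsub>P\<^esub> c) (\<phi> (emb v g0)) = emb v g0"
      using c e by simp
    ultimately have "u \<cdot> emb v g0 = emb v g0 \<cdot> u" by simp
    then have "u \<in> sp (st V E v)"
      using u e by (intro centralizer[OF v g0]) (simp_all add: P.conjg_fix_iff)
    then obtain g' y where y: "g' \<in> carrier (G v)" "y \<in> sp (lk V E v)" "u = emb v g' \<cdot> y"
      using v by (rule sp_stE)
    have "ret (lk V E v) u = \<one>\<^bsub>P\<^esub>"
      using c z v g not_in_lk unfolding u(2) by (simp add: ret.hom_conjg ret_emb)
    moreover have "ret (lk V E v) u = y"
      using y v not_in_lk by (simp add: ret_emb sp_ret sp_closed)
    ultimately have "y = \<one>\<^bsub>P\<^esub>" by simp
    then have "u = emb v g'" using y v by simp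
    moreover have "ret {v} u = emb v g"
      unfolding u(2) using c z v g by (intro ret_single_conjg) auto
    moreover have "ret {v} (emb v g') = emb v g'" using v y by (simp add: ret_emb)
    ultimately have "u = emb v g" by simp
    then show ?thesis
      using c e by (simp add: u_def P.conjg_eq_iff)
  qed
  then show ?thesis using c by blast
qed

end

section \<open>Semicompleteness\<close>

context rigid_IA
begin

text \<open>The conjugate of \<open>G w\<close> by \<open>?a\<close> commutes with
  \<open>G v\<close>, hence lies in \<open>sp (st V E v)\<close>, which avoids \<open>u\<close>;
  \<open>conjugate_base\<close> turns this into a statement about \<open>?a\<close>. Thus
  \<open>c v\<close> and \<open>c w\<close> define the same left coset.\<close>

lemma common_vertex_coset:
  assumes u: "u \<in> V" and c: "\<And>v. v \<in> V \<Longrightarrow> c v \<in> carrier P"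
    and \<phi>c: "\<And>v g. v \<in> V \<Longrightarrow> g \<in> carrier (G v) \<Longrightarrow> \<phi> (emb v g) = P.conjg (c v) (emb v g)"
    and vw: "{v, w} \<in> E" "v \<notin> st V E u" "w \<notin> st V E u"
  shows "inv\<^bsub>P\<^esub> c v \<cdot> c w \<in> sp (V - {u})"
proof -
  have V: "v \<in> V" "w \<in> V" using edge_in_V[OF vw(1)] by auto
  have u_st: "u \<notin> st V E v" "u \<notin> st V E w" using vw(2,3) V by (auto simp: st_def lk_sym)
  obtain g where g: "g \<in> carrier (G v)" "g \<noteq> \<one>\<^bsub>G v\<^esub>" using nontrivialE[OF V(1)] .
  obtain h where h: "h \<in> carrier (G w)" "h \<noteq> \<one>\<^bsub>G w\<^esub>" using nontrivialE[OF V(2)] .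
  let ?a = "inv\<^bsub>P\<^esub> c v \<cdot> c w"
  have e: "emb v g \<in> carrier P" "emb w h \<in> carrier P" "c v \<in> carrier P" "c w \<in> carrier P"
    using V g h c by auto
  have a: "?a \<in> carrier P" using e by simp
  have "\<phi> (emb w h) \<cdot> \<phi> (emb v g) = \<phi> (emb v g) \<cdot> \<phi> (emb w h)"
    using emb_commute[OF vw(1) g(1) h(1)] e by (metis \<phi>.hom_mult)
  then have "P.conjg (inv\<^bsub>P\<^esub> c v) (\<phi> (emb w h)) \<cdot> P.conjg (inv\<^bsub>P\<^esub> c v) (\<phi> (emb v g)) =
      P.conjg (inv\<^bsub>P\<^esub> c v) (\<phi> (emb v g)) \<cdot> P.conjg (inv\<^bsub>P\<^esub> c v) (\<phi> (emb w h))"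
    using e by (intro P.conjg_commute) auto
  then have "P.conjg ?a (emb w h) \<cdot> emb v g = emb v g \<cdot> P.conjg ?a (emb w h)"
    using e V g h by (simp add: \<phi>c P.conjg_conjg)
  then have "P.conjg ?a (emb w h) \<in> sp (st V E v)"
    using e by (intro centralizer[OF V(1) g]) (simp_all add: P.conjg_fix_iff)
  then have "P.conjg (inv\<^bsub>P\<^esub> (inv\<^bsub>P\<^esub> ?a)) (emb w h) \<in> sp (V - {u})"
    using e sp_mono[of "st V E v" "V - {u}"] u_st by auto
  with P.inv_closed[OF a] have "inv\<^bsub>P\<^esub> ?a \<in> sp (V - {u})"
    by (rule conjugate_base[OF V(2) h u_st(2)])
  then have "inv\<^bsub>P\<^esub> (inv\<^bsub>P\<^esub> ?a) \<in> sp (V - {u})" by (rule sp_inv)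
  then show ?thesis using e by simp
qed

text \<open>Without separating stars the coset is the same for all vertices outside
  \<open>st V E u\<close>. Every \<open>v\<close> other than \<open>u\<close>, also one in the link
  of \<open>u\<close>, has a neighbour \<open>z\<close> there; transported back by
  \<open>c z\<close>, the image of \<open>G v\<close> centralizes \<open>G z\<close> and so avoids
  \<open>u\<close>.\<close>

lemma \<phi>_emb_complement:
  assumes no_sep: "\<not> has_separating_star V E" and u: "u \<in> V"
    and c: "\<And>v. v \<in> V \<Longrightarrow> c v \<in> carrier P"
    and \<phi>c: "\<And>v g. v \<in> V \<Longrightarrow> g \<in> carrier (G v) \<Longrightarrow> \<phi> (emb v g) = P.conjg (c v) (emb v g)"
    and z0: "z0 \<in> V" "z0 \<notin> st V E u" and v: "v \<in> V" "v \<noteq> u" "g \<in> carrier (G v)"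
  shows "P.conjg (inv\<^bsub>P\<^esub> c z0) (\<phi> (emb v g)) \<in> sp (V - {u})"
proof -
  let ?U = "V - st V E u"
  have connected: "inv\<^bsub>P\<^esub> c z0 \<cdot> c w \<in> sp (V - {u})" if w: "w \<in> ?U" for w
  proof -
    have "(z0, w) \<in> {(a, b). {a, b} \<in> induced_edges E ?U}\<^sup>*"
      using no_sep u z0 w by (auto simp: has_separating_star_def disconnected_graph_def)
    then show ?thesis
    proof (induction rule: rtrancl_induct)
      case base
      then show ?case using c[OF z0(1)] by simp
    next
      case (step y z)
      then have yz: "{y, z} \<in> E" "y \<in> ?U" "z \<in> ?U" by (auto simp: induced_edges_def)
      then have "inv\<^bsub>P\<^esub> c y \<cdot> c z \<in> sp (V - {u})"
        using common_vertex_coset[OF u c \<phi>c] by simp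
      then have "(inv\<^bsub>P\<^esub> c z0 \<cdot> c y) \<cdot> (inv\<^bsub>P\<^esub> c y \<cdot> c z) \<in> sp (V - {u})"
        by (rule sp_mult[OF step.IH])
      then show ?case using c z0 yz by (simp add: P.m_assoc)
    qed
  qed
  obtain z where z: "z \<in> lk V E v" "z \<notin> st V E u"
    using link_not_in_star[OF v(1) u v(2)] by auto
  have zV: "z \<in> V" "{v, z} \<in> E" "u \<notin> st V E z"
    using z lk_subset[of v] v u by (auto simp: st_def lk_iff insert_commute)
  obtain h where h: "h \<in> carrier (G z)" "h \<noteq> \<one>\<^bsub>G z\<^esub>" using nontrivialE[OF zV(1)] .
  have e: "emb v g \<in> carrier P" "emb z h \<in> carrier P" "c z \<in> carrier P" "c z0 \<in> carrier P"
    using v zV h c z0 by auto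
  have "\<phi> (emb v g) \<cdot> \<phi> (emb z h) = \<phi> (emb z h) \<cdot> \<phi> (emb v g)"
    using emb_commute[OF zV(2) v(3) h(1)] e by (metis \<phi>.hom_mult)
  then have "P.conjg (inv\<^bsub>P\<^esub> c z) (\<phi> (emb v g)) \<cdot> P.conjg (inv\<^bsub>P\<^esub> c z) (\<phi> (emb z h)) =
      P.conjg (inv\<^bsub>P\<^esub> c z) (\<phi> (emb z h)) \<cdot> P.conjg (inv\<^bsub>P\<^esub> c z) (\<phi> (emb v g))"
    using e by (intro P.conjg_commute) auto
  moreover have "P.conjg (inv\<^bsub>P\<^esub> c z) (\<phi> (emb z h)) = emb z h"
    using e zV h by (simp add: \<phi>c)
  ultimately have "P.conjg (inv\<^bsub>P\<^esub> c z) (\<phi> (emb v g)) \<in> sp (st V E z)"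
    using e by (intro centralizer[OF zV(1) h]) (simp_all add: P.conjg_fix_iff)
  then have "P.conjg (inv\<^bsub>P\<^esub> c z) (\<phi> (emb v g)) \<in> sp (V - {u})"
    using sp_mono[of "st V E z" "V - {u}"] zV by auto
  then have "P.conjg (inv\<^bsub>P\<^esub> c z0 \<cdot> c z) (P.conjg (inv\<^bsub>P\<^esub> c z) (\<phi> (emb v g))) \<in> sp (V - {u})"
    using sp_conjg[OF connected[of z]] z zV by simp
  then show ?thesis using e by (simp add: P.conjg_conjg P.m_assoc)
qed

text \<open>\<open>c z0\<close> is right for the vertices other than \<open>u\<close>, and
  \<open>c u\<close> for \<open>u\<close> itself. Multiplying \<open>c z0\<close> by the retraction
  \<open>?r b\<close> of their difference keeps its coset; the remaining factor \<open>k\<close>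
  turns out to lie in the abelian group \<open>G u\<close> and acts trivially there.\<close>

lemma \<phi>_based_at:
  assumes no_sep: "\<not> has_separating_star V E" and u: "u \<in> V"
    and c: "\<And>v. v \<in> V \<Longrightarrow> c v \<in> carrier P"
    and \<phi>c: "\<And>v g. v \<in> V \<Longrightarrow> g \<in> carrier (G v) \<Longrightarrow> \<phi> (emb v g) = P.conjg (c v) (emb v g)"
  shows "\<exists>d\<in>carrier P. (\<forall>g\<in>carrier (G u). \<phi> (emb u g) = P.conjg d (emb u g)) \<and>
     (\<forall>v\<in>V - {u}. \<forall>g\<in>carrier (G v). P.conjg (inv\<^bsub>P\<^esub> d) (\<phi> (emb v g)) \<in> sp (V - {u}))"
proof (cases "V \<subseteq> st V E u")
  case True
  have "V = {u}"
  proof (rule ccontr)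
    assume "V \<noteq> {u}"
    then obtain v where v: "v \<in> V" "v \<noteq> u" using u by auto
    then have "lk V E v \<subseteq> st V E u" using lk_subset True by blast
    then show False using link_not_in_star[OF v(1) u v(2)] by simp
  qed
  then show ?thesis using c \<phi>c u by (intro bexI[of _ "c u"]) auto
next
  case False
  then obtain z0 where z0: "z0 \<in> V" "z0 \<notin> st V E u" by auto
  let ?r = "ret (V - {u})"
  define d where "d = c z0"
  define b where "b = inv\<^bsub>P\<^esub> d \<cdot> c u"
  define k where "k = inv\<^bsub>P\<^esub> ?r b \<cdot> b"
  have cl: "d \<in> carrier P" "b \<in> carrier P" "k \<in> carrier P" "c u \<in> carrier P"
    using c u z0 by (simp_all add: d_def b_def k_def)
  have lk_u: "lk V E u \<subseteq> V - {u}" using lk_subset not_in_lk by auto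
  have ret_lk: "?r x = x" if "x \<in> sp (lk V E u)" for x
    using that sp_mono[of "lk V E u" "V - {u}"] lk_u sp_ret by blast
  \<comment> \<open>For \<open>w\<close> in \<open>lk u\<close>, both \<open>b\<close> and its retraction conjugate \<open>y\<close> to the same element, so \<open>k\<close>
    centralizes a conjugate of \<open>G w\<close> by an element of \<open>sp (lk u)\<close>; vary \<open>w\<close>.\<close>
  have k_sp: "k \<in> sp (V - {s})" if s: "s \<in> V" "s \<notin> st V E u" for s
  proof -
    have us: "u \<noteq> s" using s by (auto simp: st_def)
    obtain w where w: "w \<in> lk V E u" "w \<notin> st V E s" using link_not_in_star[OF u s(1) us] by auto
    have wV: "w \<in> V" "w \<noteq> u" "w \<notin> lk V E w" "s \<notin> st V E w"
      using w lk_u not_in_lk s by (auto simp: st_def lk_sym)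
    obtain h where h: "h \<in> carrier (G w)" "h \<noteq> \<one>\<^bsub>G w\<^esub>" using nontrivialE[OF wV(1)] .
    obtain g where g: "g \<in> carrier (G u)" "g \<noteq> \<one>\<^bsub>G u\<^esub>" using nontrivialE[OF u] .
    have e: "emb w h \<in> carrier P" "emb u g \<in> carrier P" "c w \<in> carrier P" using wV h g u c by auto
    define y where "y = P.conjg (inv\<^bsub>P\<^esub> c u) (\<phi> (emb w h))"
    have y_conj: "y = P.conjg (inv\<^bsub>P\<^esub> c u \<cdot> c w) (emb w h)"
      using e cl wV h by (simp add: y_def \<phi>c P.conjg_conjg)
    have yP: "y \<in> carrier P" using e cl by (simp add: y_def)
    have "\<phi> (emb w h) \<cdot> \<phi> (emb u g) = \<phi> (emb u g) \<cdot> \<phi> (emb w h)"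
      using emb_commute[of u w g h] w(1) g h e by (metis \<phi>.hom_mult lk_iff)
    then have "y \<cdot> P.conjg (inv\<^bsub>P\<^esub> c u) (\<phi> (emb u g)) = P.conjg (inv\<^bsub>P\<^esub> c u) (\<phi> (emb u g)) \<cdot> y"
      unfolding y_def using e cl by (intro P.conjg_commute) auto
    moreover have "P.conjg (inv\<^bsub>P\<^esub> c u) (\<phi> (emb u g)) = emb u g"
      using e cl u g by (simp add: \<phi>c)
    ultimately have "y \<in> sp (st V E u)"
      using e yP by (intro centralizer[OF u g]) (simp_all add: P.conjg_fix_iff)
    then obtain g' y' where y': "g' \<in> carrier (G u)" "y' \<in> sp (lk V E u)" "y = emb u g' \<cdot> y'"
      using u by (rule sp_stE)
    \<comment> \<open>\<open>y\<close> is conjugate to a letter of \<open>G w\<close> with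
      \<open>w \<noteq> u\<close>, so its part in \<open>G u\<close> is trivial and it lies in
      \<open>sp (lk V E u)\<close>.\<close>
    have "ret {u} y = \<one>\<^bsub>P\<^esub>"
      unfolding y_conj using e cl wV h by (simp add: ret.hom_conjg ret_emb)
    moreover have "ret {u} y = emb u g'"
      using y' u not_in_lk by (simp add: ret_emb sp_closed ret_disjoint)
    ultimately have "emb u g' = \<one>\<^bsub>P\<^esub>" by simp
    then have "y = y'" using y' by (simp add: sp_closed)
    then have y_sp: "y \<in> sp (lk V E u)" using y' by simp
    have "P.conjg (inv\<^bsub>P\<^esub> d) (\<phi> (emb w h)) \<in> sp (V - {u})"
      unfolding d_def using wV h by (intro \<phi>_emb_complement[OF no_sep u c \<phi>c z0]) auto
    moreover have "P.conjg (inv\<^bsub>P\<^esub> d) (\<phi> (emb w h)) = P.conjg b y"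
      using e cl by (simp add: y_def b_def P.conjg_conjg P.m_assoc)
    ultimately have "P.conjg b y = ?r (P.conjg b y)" by (simp add: sp_ret)
    also have "?r (P.conjg b y) = P.conjg (?r b) y" using cl yP y_sp by (simp add: ret.hom_conjg ret_lk)
    finally have eq: "P.conjg b y = P.conjg (?r b) y" .
    have "P.conjg k y = P.conjg (inv\<^bsub>P\<^esub> ?r b) (P.conjg b y)"
      using cl yP by (simp add: k_def P.conjg_conjg)
    also have "\<dots> = y" unfolding eq using cl yP by simp
    finally have ky: "P.conjg k y = y" .
    \<comment> \<open>Both \<open>y\<close> and \<open>emb w h\<close> lie in
      \<open>sp (lk V E u)\<close>, so the retraction of the conjugator still conjugates one to the
      other, and it avoids \<open>s\<close>.\<close>
    define a where "a = ret (lk V E u) (inv\<^bsub>P\<^esub> c u \<cdot> c w)"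
    have a: "a \<in> sp (lk V E u)" "a \<in> carrier P" using cl e unfolding a_def by (blast intro!: ret_sp P.m_closed P.inv_closed, simp)
    have "y = ret (lk V E u) y" using y_sp by (simp add: sp_ret)
    also have "\<dots> = P.conjg a (emb w h)"
      using e cl h w(1) wV(1) unfolding y_conj by (simp add: a_def ret.hom_conjg ret_emb)
    finally have ya: "y = P.conjg a (emb w h)" .
    have "P.conjg (inv\<^bsub>P\<^esub> a \<cdot> k \<cdot> a) (emb w h) = P.conjg (inv\<^bsub>P\<^esub> a) (P.conjg k y)"
      using a cl e by (simp add: ya P.conjg_conjg P.m_assoc)
    also have "\<dots> = emb w h" unfolding ky using a e by (simp add: ya)
    finally have "inv\<^bsub>P\<^esub> a \<cdot> k \<cdot> a \<in> sp (st V E w)"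
      using a cl by (intro centralizer[OF wV(1) h]) auto
    then have "inv\<^bsub>P\<^esub> a \<cdot> k \<cdot> a \<in> sp (V - {s})"
      using sp_mono[of "st V E w" "V - {s}"] wV by auto
    moreover have a_s: "a \<in> sp (V - {s})"
      using a(1) sp_mono[of "lk V E u" "V - {s}"] s by (auto simp: st_def)
    ultimately have "a \<cdot> (inv\<^bsub>P\<^esub> a \<cdot> k \<cdot> a) \<cdot> inv\<^bsub>P\<^esub> a \<in> sp (V - {s})"
      using sp_mult[OF sp_mult[OF a_s] sp_inv[OF a_s]] by blast
    then show ?thesis using a cl by (simp add: P.m_assoc)
  qed
  have "k \<in> sp (V - (V - st V E u))"
    by (rule sp_Diff_INT) (use k_sp cl finite_V in auto)
  then have "k \<in> sp (st V E u)"
    using sp_mono[of "V - (V - st V E u)" "st V E u"] by auto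
  then obtain g z where gz: "g \<in> carrier (G u)" "z \<in> sp (lk V E u)" "k = emb u g \<cdot> z"
    using u by (rule sp_stE)
  \<comment> \<open>\<open>k\<close> is \<open>b\<close> with its retraction divided off, so
    \<open>?r\<close> kills it, and with it the link part \<open>z\<close>.\<close>
  have "?r k = \<one>\<^bsub>P\<^esub>" using cl by (simp add: k_def ret_ret)
  moreover have "?r z = z" using gz(2) by (rule ret_lk)
  moreover have "?r k = ?r z" using gz u by (simp add: ret_emb sp_closed)
  ultimately have "z = \<one>\<^bsub>P\<^esub>" by simp
  then have k: "k = emb u g" using gz u by simp
  define d' where "d' = d \<cdot> ?r b"
  have d': "d' \<in> carrier P" using cl by (simp add: d'_def)
  have c_u: "c u = d' \<cdot> k" using cl by (simp add: d'_def k_def b_def P.m_assoc)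
  have "\<phi> (emb u h) = P.conjg d' (emb u h)" if h: "h \<in> carrier (G u)" for h
  proof -
    have "P.conjg k (emb u h) = emb u h"
      unfolding k using u gz h by (intro conjg_single sp_emb) auto
    then show ?thesis using u h d' cl by (simp add: \<phi>c c_u P.conjg_conjg[symmetric])
  qed
  moreover have "P.conjg (inv\<^bsub>P\<^esub> d') (\<phi> (emb v h)) \<in> sp (V - {u})"
    if v: "v \<in> V" "v \<noteq> u" "h \<in> carrier (G v)" for v h
  proof -
    have "P.conjg (inv\<^bsub>P\<^esub> ?r b) (P.conjg (inv\<^bsub>P\<^esub> d) (\<phi> (emb v h))) \<in> sp (V - {u})"
      unfolding d_def using v cl(2)
      by (intro sp_conjg sp_inv ret_sp \<phi>_emb_complement[OF no_sep u c \<phi>c z0]) auto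
    then show ?thesis using v cl by (simp add: d'_def P.conjg_conjg P.inv_mult_group)
  qed
  ultimately show ?thesis using d' by (intro bexI[of _ d']) auto
qed

text \<open>Vertices are added one by one to a set \<open>A\<close> for which a single
  \<open>x\<close> is good at all \<open>u\<close> in \<open>A\<close>. For \<open>A = V\<close>
  each image, transported back by \<open>x\<close>, lies in \<open>sp {v}\<close>, where
  \<open>ret {v}\<close> identifies it.\<close>

lemma \<phi>_inner:
  assumes no_sep: "\<not> has_separating_star V E"
  shows "\<phi> \<in> Inn P"
proof -
  have "\<forall>v\<in>V. \<exists>c. c \<in> carrier P \<and> (\<forall>g\<in>carrier (G v). \<phi> (emb v g) = P.conjg c (emb v g))"
    using \<phi>_emb_conjugate_uniform by blast
  then obtain c where c: "\<And>v. v \<in> V \<Longrightarrow> c v \<in> carrier P"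
    "\<And>v g. v \<in> V \<Longrightarrow> g \<in> carrier (G v) \<Longrightarrow> \<phi> (emb v g) = P.conjg (c v) (emb v g)"
    by (auto dest!: bchoice)
  have "\<exists>x\<in>carrier P. \<forall>u\<in>A. \<forall>v\<in>V - {u}. \<forall>g\<in>carrier (G v).
      P.conjg (inv\<^bsub>P\<^esub> x) (\<phi> (emb v g)) \<in> sp (V - {u})" if "finite A" "A \<subseteq> V" for A
    using that
  proof (induction A)
    case empty
    then show ?case by auto
  next
    case (insert w A)
    then obtain x where x: "x \<in> carrier P"
      "\<And>u v g. u \<in> A \<Longrightarrow> v \<in> V - {u} \<Longrightarrow> g \<in> carrier (G v) \<Longrightarrow>
         P.conjg (inv\<^bsub>P\<^esub> x) (\<phi> (emb v g)) \<in> sp (V - {u})"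
      by auto
    have w: "w \<in> V" "w \<notin> A" "finite A" using insert by auto
    obtain d where d: "d \<in> carrier P"
      "\<And>g. g \<in> carrier (G w) \<Longrightarrow> \<phi> (emb w g) = P.conjg d (emb w g)"
      "\<And>v g. v \<in> V - {w} \<Longrightarrow> g \<in> carrier (G v) \<Longrightarrow> P.conjg (inv\<^bsub>P\<^esub> d) (\<phi> (emb v g)) \<in> sp (V - {w})"
      using \<phi>_based_at[OF no_sep w(1) c] by blast
    obtain g where g: "g \<in> carrier (G w)" "g \<noteq> \<one>\<^bsub>G w\<^esub>" using nontrivialE[OF w(1)] .
    have e: "emb w g \<in> carrier P" using w g by simp
    \<comment> \<open>The aim is \<open>f = t \<cdot> z\<close> with \<open>t\<close> in
      \<open>sp (V - A)\<close> and \<open>z\<close> in \<open>sp (V - {w})\<close>: then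
      \<open>x \<cdot> t\<close> is still good on \<open>A\<close>, and it is good at
      \<open>w\<close> because it equals \<open>d \<cdot> inv z\<close>.\<close>
    define f where "f = inv\<^bsub>P\<^esub> x \<cdot> d"
    let ?r = "ret (V - A)"
    have f: "f \<in> carrier P" using x d by (simp add: f_def)
    have fx: "P.conjg (inv\<^bsub>P\<^esub> x) (\<phi> (emb w g)) = P.conjg f (emb w g)"
      using x d g e by (simp add: f_def P.conjg_conjg)
    have "P.conjg f (emb w g) \<in> sp (V - A)"
      by (rule sp_Diff_INT) (use x(2)[of _ w g] w g f e in \<open>auto simp: fx\<close>)
    then have "P.conjg f (emb w g) = ?r (P.conjg f (emb w g))" by (simp add: sp_ret)
    also have "\<dots> = P.conjg (?r f) (emb w g)" using f e w g by (simp add: ret.hom_conjg ret_emb)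
    finally have eq: "P.conjg f (emb w g) = P.conjg (?r f) (emb w g)" .
    \<comment> \<open>\<open>f\<close> and its retraction conjugate \<open>emb w g\<close> alike, so
      they differ by a centralizing element, which splits into a part in \<open>G w\<close>,
      absorbed by \<open>t\<close>, and the link part \<open>z\<close>.\<close>
    have "P.conjg (inv\<^bsub>P\<^esub> ?r f \<cdot> f) (emb w g) = P.conjg (inv\<^bsub>P\<^esub> ?r f) (P.conjg f (emb w g))"
      using f e by (simp add: P.conjg_conjg)
    also have "\<dots> = emb w g" unfolding eq using f e by simp
    finally have "inv\<^bsub>P\<^esub> ?r f \<cdot> f \<in> sp (st V E w)"
      using f by (intro centralizer[OF w(1) g]) auto
    then obtain h z where hz: "h \<in> carrier (G w)" "z \<in> sp (lk V E w)" "inv\<^bsub>P\<^esub> ?r f \<cdot> f = emb w h \<cdot> z"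
      using w(1) by (rule sp_stE)
    define t where "t = ?r f \<cdot> emb w h"
    have z: "z \<in> carrier P" "z \<in> sp (V - {w})"
      using hz(2) sp_mono[of "lk V E w" "V - {w}"] lk_subset[of w] not_in_lk[of w] by (auto simp: sp_closed)
    have t: "t \<in> sp (V - A)" "t \<in> carrier P"
      using f w hz by (auto simp: t_def intro!: sp_mult ret_sp sp_emb)
    have "f = ?r f \<cdot> (inv\<^bsub>P\<^esub> ?r f \<cdot> f)" using f by simp
    also have "\<dots> = t \<cdot> z" unfolding hz(3) using f z(1) w hz(1) by (simp add: t_def P.m_assoc)
    finally have f_eq: "f = t \<cdot> z" .
    then have d_eq: "d = x \<cdot> t \<cdot> z"
      using x d t z by (metis P.inv_cancel_left(2) P.inv_closed P.m_assoc P.m_closed f_def)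
    have xt: "x \<cdot> t \<in> carrier P" using x t by simp
    have "P.conjg (inv\<^bsub>P\<^esub> (x \<cdot> t)) (\<phi> (emb v k)) \<in> sp (V - {u})"
      if u: "u \<in> insert w A" "v \<in> V - {u}" "k \<in> carrier (G v)" for u v k
    proof (cases "u = w")
      case True
      have "P.conjg z (P.conjg (inv\<^bsub>P\<^esub> d) (\<phi> (emb v k))) \<in> sp (V - {w})"
        by (rule sp_conjg) (use u True z d in auto)
      moreover have "z \<cdot> inv\<^bsub>P\<^esub> d = inv\<^bsub>P\<^esub> (x \<cdot> t)"
        using xt z by (simp add: d_eq P.inv_mult_group)
      ultimately show ?thesis using True u d z by (simp add: P.conjg_conjg)
    next
      case False
      then have "t \<in> sp (V - {u})" using t(1) sp_mono[of "V - A" "V - {u}"] u by auto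
      then have "P.conjg (inv\<^bsub>P\<^esub> t) (P.conjg (inv\<^bsub>P\<^esub> x) (\<phi> (emb v k))) \<in> sp (V - {u})"
        by (rule sp_conjg[OF sp_inv]) (use u False x in auto)
      then show ?thesis using u x t by (simp add: P.conjg_conjg P.inv_mult_group)
    qed
    then show ?case using xt by blast
  qed
  from this[OF finite_V] obtain x where x: "x \<in> carrier P"
    "\<And>u v g. u \<in> V \<Longrightarrow> v \<in> V - {u} \<Longrightarrow> g \<in> carrier (G v) \<Longrightarrow>
       P.conjg (inv\<^bsub>P\<^esub> x) (\<phi> (emb v g)) \<in> sp (V - {u})"
    by auto
  have emb_eq: "\<phi> (emb v g) = P.conjg x (emb v g)" if v: "v \<in> V" "g \<in> carrier (G v)" for v g
  proof -
    let ?y = "P.conjg (inv\<^bsub>P\<^esub> x) (\<phi> (emb v g))"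
    have "?y \<in> sp (V - (V - {v}))"
      by (rule sp_Diff_INT) (use x v finite_V in auto)
    moreover have "V - (V - {v}) = {v}" using v by auto
    ultimately have "?y = ret {v} ?y" by (simp add: sp_ret)
    also have "\<dots> = emb v g"
      using x v by (simp add: ret.hom_conjg ret_single_\<phi> ret_emb conjg_single ret_sp sp_inv)
    finally show ?thesis using x v by (simp add: P.conjg_eq_iff[symmetric] P.conjg_eq_iff)
  qed
  have "\<phi> y = P.conjg x y" if "y \<in> carrier P" for y
    by (rule hom_eqI[OF P.is_group \<phi>.homh P.conjg_hom[OF x(1)] emb_eq that])
  moreover have "\<phi> \<in> extensional (carrier P)"
    using \<phi>_auto by (simp add: auto_def Bij_def)
  ultimately have "\<phi> = restrict (P.conjg x) (carrier P)"
    by (intro extensionalityI[of _ "carrier P"]) auto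
  then show ?thesis using x by (auto simp: P.Inn_eq)
qed

end

section \<open>Partial conjugations\<close>

context graph_of_groups
begin

text \<open>Edges leaving \<open>A\<close> end in the link of \<open>v\<close>, where conjugation by
  \<open>G v\<close> does nothing. So on an edge meeting \<open>A\<close> both ends may be regarded
  as conjugated.\<close>

lemma partial_conjugation_hom:
  assumes v: "v \<in> V" "g \<in> carrier (G v)"
    and A: "\<And>a b. {a, b} \<in> E \<Longrightarrow> a \<in> A \<Longrightarrow> b \<notin> A \<Longrightarrow> b \<in> lk V E v"
  shows "\<exists>F\<in>hom P P. \<forall>a\<in>V. \<forall>h\<in>carrier (G a).
     F (emb a h) = (if a \<in> A then P.conjg (emb v g) (emb a h) else emb a h)"
proof (rule lift_exists[OF P.is_group])
  let ?f = "\<lambda>a h. if a \<in> A then P.conjg (emb v g) (emb a h) else emb a h"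
  have e: "emb v g \<in> carrier P" using v by simp
  show "?f a \<in> hom (G a) P" if "a \<in> V" for a
    using that e by (auto intro!: homI simp: emb_mult P.conjg_mult)
  show "?f a h \<cdot> ?f b k = ?f b k \<cdot> ?f a h"
    if ab: "{a, b} \<in> E" "h \<in> carrier (G a)" "k \<in> carrier (G b)" for a b h k
  proof -
    have V: "a \<in> V" "b \<in> V" using edge_in_V[OF ab(1)] by auto
    have comm: "emb a h \<cdot> emb b k = emb b k \<cdot> emb a h" by (rule emb_commute[OF ab])
    have fix_lk: "P.conjg (emb v g) (emb w l) = emb w l" if "w \<in> lk V E v" "l \<in> carrier (G w)" for w l
      using that v lk_sym[of w v] lk_subset[of v] by (intro conjg_emb_lk sp_emb) auto
    show ?thesis
    proof (cases "a \<in> A \<or> b \<in> A")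
      case True
      have "?f a h = P.conjg (emb v g) (emb a h)" "?f b k = P.conjg (emb v g) (emb b k)"
        using True A[OF ab(1)] A[OF edge_sym[OF ab(1)]] ab by (auto simp: fix_lk)
      then show ?thesis using P.conjg_commute[OF comm e] V ab by simp
    qed (use comm in simp)
  qed
qed

text \<open>Partial conjugation by the inverse of \<open>g\<close> is inverse to it because both
  maps fix \<open>emb v g\<close>. Generators stay in their conjugacy classes, so the abelianization
  is fixed.\<close>

lemma partial_conjugation_IA:
  assumes v: "v \<in> V" "g \<in> carrier (G v)"
    and A: "\<And>a b. {a, b} \<in> E \<Longrightarrow> a \<in> A \<Longrightarrow> b \<notin> A \<Longrightarrow> b \<in> lk V E v"
  shows "\<exists>f\<in>IA P. \<forall>a\<in>V. \<forall>h\<in>carrier (G a).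
     f (emb a h) = (if a \<in> A then P.conjg (emb v g) (emb a h) else emb a h)"
proof -
  interpret Gv: group "G v" using vertex_group v by simp
  let ?g' = "inv\<^bsub>G v\<^esub> g"
  have e: "emb v g \<in> carrier P" "emb v ?g' = inv\<^bsub>P\<^esub> emb v g" using v by (simp_all add: emb_inv)
  have "\<exists>F\<in>hom P P. \<forall>a\<in>V. \<forall>h\<in>carrier (G a).
     F (emb a h) = (if a \<in> A then P.conjg (emb v g) (emb a h) else emb a h)"
    by (rule partial_conjugation_hom[OF v]) (rule A)
  then obtain F where F: "F \<in> hom P P" "\<And>a h. a \<in> V \<Longrightarrow> h \<in> carrier (G a) \<Longrightarrow>
     F (emb a h) = (if a \<in> A then P.conjg (emb v g) (emb a h) else emb a h)"
    by blast
  have "\<exists>F\<in>hom P P. \<forall>a\<in>V. \<forall>h\<in>carrier (G a).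
     F (emb a h) = (if a \<in> A then P.conjg (inv\<^bsub>P\<^esub> emb v g) (emb a h) else emb a h)"
    unfolding e(2)[symmetric] by (rule partial_conjugation_hom[OF v(1) Gv.inv_closed[OF v(2)]]) (rule A)
  then obtain F' where F': "F' \<in> hom P P" "\<And>a h. a \<in> V \<Longrightarrow> h \<in> carrier (G a) \<Longrightarrow>
     F' (emb a h) = (if a \<in> A then P.conjg (inv\<^bsub>P\<^esub> emb v g) (emb a h) else emb a h)"
    by blast
  interpret F: group_hom P P F using F by unfold_locales
  interpret F': group_hom P P F' using F' by unfold_locales
  have fix_g: "F (emb v g) = emb v g" "F' (emb v g) = emb v g"
    using F(2) F'(2) v e by (auto simp: P.conjg_def P.m_assoc)
  have inverse: "F (F' x) = x" if "x \<in> carrier P" for x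
  proof (rule hom_eqI[OF P.is_group _ _ _ that])
    show "F (F' (emb a h)) = emb a h" if "a \<in> V" "h \<in> carrier (G a)" for a h
    proof (cases "a \<in> A")
      case True
      then have "F (F' (emb a h)) = P.conjg (F (inv\<^bsub>P\<^esub> emb v g)) (F (emb a h))"
        using that e(1) F.hom_conjg[of "inv\<^bsub>P\<^esub> emb v g" "emb a h"] F'(2)[OF that] by simp
      then show ?thesis using True that e(1) F(2)[OF that] by (simp add: fix_g)
    qed (use that F(2) F'(2) in simp)
  qed (auto intro!: homI)
  have inverse': "F' (F x) = x" if "x \<in> carrier P" for x
  proof (rule hom_eqI[OF P.is_group _ _ _ that])
    show "F' (F (emb a h)) = emb a h" if "a \<in> V" "h \<in> carrier (G a)" for a h
    proof (cases "a \<in> A")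
      case True
      then have "F' (F (emb a h)) = P.conjg (F' (emb v g)) (F' (emb a h))"
        using that e(1) F'.hom_conjg[of "emb v g" "emb a h"] F(2)[OF that] by simp
      then show ?thesis using True that e(1) F'(2)[OF that] by (simp add: fix_g)
    qed (use that F(2) F'(2) in simp)
  qed (auto intro!: homI)
  have "bij_betw F (carrier P) (carrier P)"
    using inverse inverse' by (intro bij_betw_byWitness[of _ F']) auto
  then have auto: "restrict F (carrier P) \<in> auto P"
    by (auto simp: auto_def Bij_def bij_betw_restrict_eq intro!: homI)
  interpret D: normal "P.D" P by (rule P.derived_self_is_normal)
  have coset_hom: "(\<lambda>x. P.D #>\<^bsub>P\<^esub> x) \<in> hom P (P Mod P.D)" by (rule D.r_coset_hom_Mod)
  have "P.D #>\<^bsub>P\<^esub> F x = P.D #>\<^bsub>P\<^esub> x" if "x \<in> carrier P" for x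
  proof (rule hom_eqI[OF D.factorgroup_is_group _ coset_hom _ that])
    show "(\<lambda>x. P.D #>\<^bsub>P\<^esub> F x) \<in> hom P (P Mod P.D)"
      using hom_compose[OF F(1) coset_hom] by (simp add: comp_def)
  qed (use F(2) e in \<open>simp add: P.coset_derived_conjg\<close>)
  then have "restrict F (carrier P) \<in> IA P" using auto by (simp add: P.IA_iff)
  then show ?thesis using F(2) by (intro bexI[of _ "restrict F (carrier P)"]) auto
qed

lemma partial_conjugation_inner:
  assumes "semicomplete P" "v \<in> V" "g \<in> carrier (G v)"
    and "\<And>a b. {a, b} \<in> E \<Longrightarrow> a \<in> A \<Longrightarrow> b \<notin> A \<Longrightarrow> b \<in> lk V E v"
  shows "\<exists>x\<in>carrier P. \<forall>a\<in>V. \<forall>h\<in>carrier (G a).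
     P.conjg x (emb a h) = (if a \<in> A then P.conjg (emb v g) (emb a h) else emb a h)"
proof -
  have "\<exists>f\<in>IA P. \<forall>a\<in>V. \<forall>h\<in>carrier (G a).
     f (emb a h) = (if a \<in> A then P.conjg (emb v g) (emb a h) else emb a h)"
    by (rule partial_conjugation_IA[OF assms(2,3)]) (rule assms(4))
  then obtain f where f: "f \<in> IA P" "\<And>a h. a \<in> V \<Longrightarrow> h \<in> carrier (G a) \<Longrightarrow>
     f (emb a h) = (if a \<in> A then P.conjg (emb v g) (emb a h) else emb a h)"
    by blast
  obtain x where x: "x \<in> carrier P" "f = restrict (P.conjg x) (carrier P)"
    using f(1) assms(1) by (auto simp: semicomplete_def P.Inn_eq)
  have x_f: "P.conjg x (emb a h) = f (emb a h)" if "a \<in> V" "h \<in> carrier (G a)" for a h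
    unfolding x(2) using that by simp
  have "P.conjg x (emb a h) = (if a \<in> A then P.conjg (emb v g) (emb a h) else emb a h)"
    if "a \<in> V" "h \<in> carrier (G a)" for a h
    by (rule HOL.trans[OF x_f[OF that] f(2)[OF that]])
  then show ?thesis using x(1) by blast
qed

end

section \<open>What semicompleteness forces on the vertex groups and the graph\<close>

context rigid_graph_of_groups
begin

text \<open>Conjugate \<open>G v\<close> alone by \<open>g\<close>. If \<open>x\<close> realizes
  this, it centralizes a letter at some \<open>w\<close> outside the star of \<open>v\<close>, so
  \<open>ret {v} x\<close> is trivial, and retracting to \<open>G v\<close> shows that conjugation
  by \<open>g\<close> fixes \<open>h\<close>.\<close>

lemma semicomplete_imp_comm:
  assumes semi: "semicomplete P" and card: "card V \<ge> 2" and v: "v \<in> V"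
  shows "comm_group (G v)"
proof -
  interpret Gv: group "G v" by (rule vertex_group[OF v])
  have "\<not> V \<subseteq> {v}"
  proof
    assume "V \<subseteq> {v}"
    then have "card V \<le> 1" using card_mono[of "{v}" V] by simp
    then show False using card by simp
  qed
  \<comment> \<open>A second vertex is what yields a \<open>w\<close> outside the star of
    \<open>v\<close>, since its link is not contained in that star.\<close>
  then obtain u where "u \<in> V" "u \<noteq> v" by auto
  then have "\<not> V \<subseteq> st V E v" using link_not_in_star[of u v] lk_subset[of u] v by auto
  then obtain w where w: "w \<in> V" "w \<notin> st V E v" by auto
  have v_st: "v \<notin> st V E w" using w v by (auto simp: st_def lk_sym)
  obtain k where k: "k \<in> carrier (G w)" "k \<noteq> \<one>\<^bsub>G w\<^esub>" using nontrivialE[OF w(1)] .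
  have "g \<otimes>\<^bsub>G v\<^esub> h = h \<otimes>\<^bsub>G v\<^esub> g" if gh: "g \<in> carrier (G v)" "h \<in> carrier (G v)" for g h
  proof -
    have "\<exists>x\<in>carrier P. \<forall>a\<in>V. \<forall>h\<in>carrier (G a).
        P.conjg x (emb a h) = (if a \<in> {v} then P.conjg (emb v g) (emb a h) else emb a h)"
      by (rule partial_conjugation_inner[OF semi v gh(1)]) (simp add: lk_iff)
    then obtain x where x: "x \<in> carrier P" "P.conjg x (emb v h) = P.conjg (emb v g) (emb v h)"
      "P.conjg x (emb w k) = emb w k"
      using v w gh k by (auto simp: st_def)
    have "x \<in> sp (st V E w)" by (rule centralizer[OF w(1) k x(1,3)])
    then have "ret {v} x = \<one>\<^bsub>P\<^esub>" by (rule ret_disjoint) (use v_st in auto)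
    then have "ret {v} (P.conjg x (emb v h)) = emb v h"
      using x(1) v gh by (simp add: ret.hom_conjg ret_emb)
    moreover have "ret {v} (P.conjg (emb v g) (emb v h)) = P.conjg (emb v g) (emb v h)"
      using v gh by (simp add: ret.hom_conjg ret_emb)
    ultimately have "P.conjg (emb v g) (emb v h) = emb v h" using x by simp
    then have "emb v (g \<otimes>\<^bsub>G v\<^esub> h) = emb v (h \<otimes>\<^bsub>G v\<^esub> g)"
      using v gh by (simp add: emb_mult P.conjg_fix_iff)
    then show ?thesis using v gh by (intro emb_inj) auto
  qed
  then show ?thesis by (intro Gv.group_comm_groupI) auto
qed

text \<open>Conjugate one component \<open>A\<close> by \<open>g\<close>. An inner realization
  \<open>x\<close> centralizes a letter at \<open>y0\<close>, and
  \<open>inv (emb v g) \<cdot> x\<close> one at \<open>x0\<close>. Neither star contains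
  \<open>v\<close>, so retracting to \<open>G v\<close> gives that \<open>g\<close> is
  trivial.\<close>

lemma semicomplete_imp_no_separating_star:
  assumes semi: "semicomplete P"
  shows "\<not> has_separating_star V E"
proof
  assume "has_separating_star V E"
  then obtain v x0 y0 where v: "v \<in> V" and x0: "x0 \<in> V" "x0 \<notin> st V E v"
    and y0: "y0 \<in> V" "y0 \<notin> st V E v"
    and not_conn: "(x0, y0) \<notin> {(a, b). {a, b} \<in> induced_edges E (V - st V E v)}\<^sup>*"
    by (auto simp: has_separating_star_def disconnected_graph_def)
  let ?R = "{(a, b). {a, b} \<in> induced_edges E (V - st V E v)}"
  define A where "A = {a \<in> V - st V E v. (x0, a) \<in> ?R\<^sup>*}"
  have v_st: "v \<notin> st V E y0" "v \<notin> st V E x0" using x0 y0 v by (auto simp: st_def lk_sym)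
  have x0_A: "x0 \<in> A" and y0_A: "y0 \<notin> A" using x0 not_conn by (auto simp: A_def)
  obtain g where g: "g \<in> carrier (G v)" "g \<noteq> \<one>\<^bsub>G v\<^esub>" using nontrivialE[OF v] .
  obtain h where h: "h \<in> carrier (G x0)" "h \<noteq> \<one>\<^bsub>G x0\<^esub>" using nontrivialE[OF x0(1)] .
  obtain k where k: "k \<in> carrier (G y0)" "k \<noteq> \<one>\<^bsub>G y0\<^esub>" using nontrivialE[OF y0(1)] .
  \<comment> \<open>An edge leaving the component ends in the star of \<open>v\<close>, and not in
    \<open>v\<close> itself, because it starts outside that star.\<close>
  have A: "b \<in> lk V E v" if ab: "{a, b} \<in> E" "a \<in> A" "b \<notin> A" for a b
  proof (rule ccontr)
    assume b: "b \<notin> lk V E v"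
    have V: "a \<in> V" "b \<in> V" using edge_in_V[OF ab(1)] by auto
    have a: "a \<notin> st V E v" "(x0, a) \<in> ?R\<^sup>*" using ab by (auto simp: A_def)
    then have "b \<noteq> v" using ab(1) by (auto simp: st_def lk_iff insert_commute)
    then have "b \<notin> st V E v" using b by (simp add: st_def)
    then have "(a, b) \<in> ?R" using V a ab by (auto simp: induced_edges_def)
    then have "(x0, b) \<in> ?R\<^sup>*" using a(2) by (rule rtrancl_into_rtrancl[rotated])
    then show False using ab(3) V \<open>b \<notin> st V E v\<close> by (simp add: A_def)
  qed
  have "\<exists>x\<in>carrier P. \<forall>a\<in>V. \<forall>h\<in>carrier (G a).
      P.conjg x (emb a h) = (if a \<in> A then P.conjg (emb v g) (emb a h) else emb a h)"
    by (rule partial_conjugation_inner[OF semi v g(1)]) (rule A)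
  then obtain x where "x \<in> carrier P" and "\<forall>a\<in>V. \<forall>h\<in>carrier (G a).
      P.conjg x (emb a h) = (if a \<in> A then P.conjg (emb v g) (emb a h) else emb a h)"
    by blast
  then have x: "x \<in> carrier P" "P.conjg x (emb x0 h) = P.conjg (emb v g) (emb x0 h)"
    "P.conjg x (emb y0 k) = emb y0 k"
    using x0(1) y0(1) x0_A y0_A h(1) k(1) by simp_all
  have e: "emb v g \<in> carrier P" "emb x0 h \<in> carrier P" using v g x0 h by auto
  have "x \<in> sp (st V E y0)" by (rule centralizer[OF y0(1) k x(1,3)])
  then have "ret {v} x = \<one>\<^bsub>P\<^esub>" by (rule ret_disjoint) (use v_st in auto)
  have "P.conjg (inv\<^bsub>P\<^esub> emb v g \<cdot> x) (emb x0 h) = P.conjg (inv\<^bsub>P\<^esub> emb v g) (P.conjg x (emb x0 h))"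
    using e x(1) by (simp add: P.conjg_conjg)
  also have "\<dots> = emb x0 h" unfolding x(2) using e by simp
  finally have "inv\<^bsub>P\<^esub> emb v g \<cdot> x \<in> sp (st V E x0)"
    using e x by (intro centralizer[OF x0(1) h]) auto
  then have "ret {v} (inv\<^bsub>P\<^esub> emb v g \<cdot> x) = \<one>\<^bsub>P\<^esub>" by (rule ret_disjoint) (use v_st in auto)
  then have "inv\<^bsub>P\<^esub> emb v g = \<one>\<^bsub>P\<^esub>"
    using e x v g \<open>ret {v} x = \<one>\<^bsub>P\<^esub>\<close> by (simp add: ret_emb)
  then have "emb v g = \<one>\<^bsub>P\<^esub>" using e by (metis P.inv_inv P.inv_one)
  then show False using v g by (simp add: emb_eq_one_iff)
qed

end

text \<open>The implication from semicompleteness carries \<open>card V \<ge> 2\<close>: over one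
  vertex the link condition is vacuous and the graph product is the vertex group, which can be
  semicomplete without being abelian.\<close>

theorem propositionE:
  fixes V :: "'v set" and E :: "'v set set" and G :: "'v \<Rightarrow> ('g, 'b) monoid_scheme"
  assumes "simple_graph V E"
    and "\<And>v. v \<in> V \<Longrightarrow> group (G v)"
    and "\<And>v. v \<in> V \<Longrightarrow> \<not> trivial_group (G v)"
    and "\<And>v w. v \<in> V \<Longrightarrow> w \<in> V \<Longrightarrow> v \<noteq> w \<Longrightarrow> \<not> lk V E v \<subseteq> st V E w"
  shows "((\<forall>v\<in>V. comm_group (G v)) \<and> \<not> has_separating_star V E
            \<longrightarrow> semicomplete (graph_product V E G)) \<and>
         (card V \<ge> 2 \<longrightarrow> semicomplete (graph_product V E G)
            \<longrightarrow> (\<forall>v\<in>V. comm_group (G v)) \<and> \<not> has_separating_star V E)"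
proof -
  interpret rigid_graph_of_groups V E G
    by (intro rigid_graph_of_groups.intro graph_of_groups.intro rigid_graph_of_groups_axioms.intro)
      (fact assms)+
  show ?thesis
  proof (intro conjI impI)
    assume *: "(\<forall>v\<in>V. comm_group (G v)) \<and> \<not> has_separating_star V E"
    have "f \<in> Inn (graph_product V E G)" if "f \<in> IA (graph_product V E G)" for f
    proof -
      interpret rigid_IA V E G f 
        by (intro rigid_IA.intro rigid_graph_of_groups_axioms rigid_IA_axioms.intro)
          (use * that in auto)
      show ?thesis using * by (intro \<phi>_inner) auto
    qed
    then show "semicomplete (graph_product V E G)"
      using P.Inn_subset_IA by (auto simp: semicomplete_def)
  next
    assume "card V \<ge> 2" "semicomplete (graph_product V E G)"
    then show "\<forall>v\<in>V. comm_group (G v)" using semicomplete_imp_comm by blast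
  next
    assume "semicomplete (graph_product V E G)"
    then show "\<not> has_separating_star V E" by (rule semicomplete_imp_no_separating_star)
  qed
qed

end
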